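(* There exists a finitely presented special monoid $M$ such that: (1) the group of units $U(M)$ is trivial; (2) $M$ has context-free word problem; (3) $M$ is word-hyperbolic; (4) the Diophantine problem for $M$ is undecidable.
   Context: $A^\ast$ denotes the free monoid on a finite set $A$. A finitely presented special monoid is a monoid $M$ given by a presentation with a finite generating set $A$ and finitely many defining relations, all of the form $w = 1$ with $w \in A^\ast$ (where $1$ is the empty word); thus $M$ is the quotient of $A^\ast$ by the congruence generated by the pairs $(w,1)$. The group of units $U(M)$ is the subgroup of all two-sided invertible elements of $M$. A special monoid $M$ generated by a finite set $A$ has context-free word problem if the set of words in $A^\ast$ representing the identity element of $M$ is a context-free language. A monoid $M$ generated by a finite set $A$ is word-hyperbolic (in the sense of Duncan and Gilman) if there exists a regular language $R \subseteq A^\ast$ such that every element of $M$ is represented by some word of $R$, and such that the "multiplication table" of $M$ with respect to $R$, namely the language $$\{ u \#_1 v \#_2 w^{\mathrm{rev}} : u, v, w \in R,\ uv = w \text{ in } M \},$$ is context-free, where $\#_1, \#_2$ are two new symbols not in $A$ and $w^{\mathrm{rev}}$ denotes the reversal of the word $w$. The Diophantine problem for $M$ (generated by the finite set $A$) is the decision problem which takes as input a finite system of equations $\{ U_i = V_i : 1 \le i \le n \}$ with $U_i, V_i \in (A \cup X)^\ast$, where $X$ is a finite set of variables disjoint from $A$ (so constants from $M$, written as words over $A$, are allowed), and asks whether the system has a solution in $M$, i.e. whether there is a map $X \to M$ such that, extending it to the homomorphism $(A \cup X)^\ast \to M$ which sends each $a \in A$ to the element of $M$ it represents, $U_i$ and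 $V_i$ have the same image in $M$ for all $i$. It is undecidable if no algorithm solves it. *)

theory Defs
  imports "HOL-Algebra.Elementary_Groups" "HOL-Library.Nat_Bijection"
begin

section \<open>Special monoids\<close>

inductive special_cong :: "'a set \<Rightarrow> 'a list set \<Rightarrow> 'a list \<Rightarrow> 'a list \<Rightarrow> bool"
  for A :: "'a set" and W :: "'a list set" where
  relator: "w \<in> W \<Longrightarrow> special_cong A W w []"
| refl: "w \<in> lists A \<Longrightarrow> special_cong A W w w"
| sym: "special_cong A W u v \<Longrightarrow> special_cong A W v u"
| trans: "special_cong A W u v \<Longrightarrow> special_cong A W v w \<Longrightarrow> special_cong A W u w"
| append: "special_cong A W u v \<Longrightarrow> special_cong A W x y \<Longrightarrow> special_cong A W (u @ x) (v @ y)"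

definition word_class :: "'a set \<Rightarrow> 'a list set \<Rightarrow> 'a list \<Rightarrow> 'a list set" where
  "word_class A W w = {v. special_cong A W w v}"

definition special_monoid :: "'a set \<Rightarrow> 'a list set \<Rightarrow> 'a list set monoid" where
  "special_monoid A W =
     \<lparr>carrier = lists A // {(u, v). special_cong A W u v},
      mult = (\<lambda>X Y. \<Union>u\<in>X. \<Union>v\<in>Y. word_class A W (u @ v)),
      one = word_class A W []\<rparr>"

definition generator :: "'a set \<Rightarrow> 'a list set \<Rightarrow> 'a \<Rightarrow> 'a list set" where
  "generator A W a = word_class A W [a]"

text \<open>The homomorphism from words over the letters to \<open>M\<close> that extends \<open>h\<close>.\<close>

definition word_value :: "('m, 'x) monoid_scheme \<Rightarrow> ('s \<Rightarrow> 'm) \<Rightarrow> 's list \<Rightarrow> 'm" where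
  "word_value M h w = foldr (\<lambda>s m. h s \<otimes>\<^bsub>M\<^esub> m) w \<one>\<^bsub>M\<^esub>"

lemma special_cong_in_lists:
  assumes "W \<subseteq> lists A" and "special_cong A W u v"
  shows "u \<in> lists A \<and> v \<in> lists A"
  using assms(2) by induction (use assms(1) in auto)

lemma word_class_eq_iff:
  assumes "v \<in> lists A"
  shows "word_class A W u = word_class A W v \<longleftrightarrow> special_cong A W u v"
proof
  assume eq: "word_class A W u = word_class A W v"
  have "v \<in> word_class A W v"
    using assms by (simp add: word_class_def special_cong.refl)
  then have "v \<in> word_class A W u"
    by (simp only: eq)
  then show "special_cong A W u v"
    by (simp add: word_class_def)
next
  assume uv: "special_cong A W u v"
  have "special_cong A W u w \<longleftrightarrow> special_cong A W v w" for w
    using special_cong.trans[OF uv] special_cong.trans[OF special_cong.sym[OF uv]] by iprover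
  then show "word_class A W u = word_class A W v"
    by (simp add: word_class_def)
qed

lemma carrier_special_monoid:
  "carrier (special_monoid A W) = word_class A W ` lists A"
  by (auto simp: special_monoid_def quotient_def word_class_def)

lemma one_special_monoid: "\<one>\<^bsub>special_monoid A W\<^esub> = word_class A W []"
  by (simp add: special_monoid_def)

lemma mult_special_monoid:
  assumes "u \<in> lists A" "v \<in> lists A"
  shows "word_class A W u \<otimes>\<^bsub>special_monoid A W\<^esub> word_class A W v = word_class A W (u @ v)"
proof -
  have "word_class A W (u' @ v') = word_class A W (u @ v)"
    if "u' \<in> word_class A W u" "v' \<in> word_class A W v" for u' v'
  proof -
    have "special_cong A W (u' @ v') (u @ v)"
      using that unfolding word_class_def mem_Collect_eq
      by (rule special_cong.append[OF special_cong.sym special_cong.sym])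
    then show ?thesis
      using assms by (subst word_class_eq_iff) simp_all
  qed
  then have "(\<Union>u'\<in>word_class A W u. \<Union>v'\<in>word_class A W v. word_class A W (u' @ v'))
      = (\<Union>u'\<in>word_class A W u. \<Union>v'\<in>word_class A W v. word_class A W (u @ v))"
    by (intro SUP_cong HOL.refl)
  moreover have "u \<in> word_class A W u" "v \<in> word_class A W v"
    using assms by (auto simp: word_class_def intro: special_cong.refl)
  ultimately show ?thesis
    unfolding special_monoid_def by auto
qed

lemma monoid_special_monoid: "monoid (special_monoid A W)"
proof (rule monoidI)
  let ?M = "special_monoid A W"
  show "X \<otimes>\<^bsub>?M\<^esub> Y \<in> carrier ?M" if "X \<in> carrier ?M" "Y \<in> carrier ?M" for X Y
    using that unfolding carrier_special_monoid
    by (elim imageE) (simp only: mult_special_monoid append_in_lists_conv imageI simp_thms)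
  show "\<one>\<^bsub>?M\<^esub> \<in> carrier ?M"
    unfolding carrier_special_monoid one_special_monoid by (intro imageI) simp
  show "X \<otimes>\<^bsub>?M\<^esub> Y \<otimes>\<^bsub>?M\<^esub> Z = X \<otimes>\<^bsub>?M\<^esub> (Y \<otimes>\<^bsub>?M\<^esub> Z)"
    if "X \<in> carrier ?M" "Y \<in> carrier ?M" "Z \<in> carrier ?M" for X Y Z
    using that unfolding carrier_special_monoid
    by (elim imageE) (simp only: mult_special_monoid append_in_lists_conv append_assoc simp_thms)
  show "\<one>\<^bsub>?M\<^esub> \<otimes>\<^bsub>?M\<^esub> X = X" if "X \<in> carrier ?M" for X
    using that unfolding carrier_special_monoid one_special_monoid
    by (elim imageE) (simp only: mult_special_monoid lists.Nil append_Nil)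
  show "X \<otimes>\<^bsub>?M\<^esub> \<one>\<^bsub>?M\<^esub> = X" if "X \<in> carrier ?M" for X
    using that unfolding carrier_special_monoid one_special_monoid
    by (elim imageE) (simp only: mult_special_monoid lists.Nil append_Nil2)
qed

lemma word_value_special_monoid:
  assumes "w \<in> lists A"
  shows "word_value (special_monoid A W) (generator A W) w = word_class A W w"
  using assms
proof (induction w)
  case Nil
  show ?case by (simp add: word_value_def one_special_monoid)
next
  case (Cons a w)
  then show ?case
    using mult_special_monoid[of "[a]" A w W] by (simp add: word_value_def generator_def)
qed


section \<open>Regular and context-free languages\<close>

definition regular_language :: "'a set \<Rightarrow> 'a list set \<Rightarrow> bool" where
  "regular_language A L \<longleftrightarrow>
     (\<exists>(Q :: nat set) q0 \<delta> F.
        finite Q \<and> q0 \<in> Q \<and> F \<subseteq> Q \<and> (\<forall>q\<in>Q. \<forall>a\<in>A. \<delta> q a \<in> Q) \<and>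
        L = {w \<in> lists A. foldl \<delta> q0 w \<in> F})"

text \<open>In sentential forms, \<open>Inl\<close> marks nonterminals and \<open>Inr\<close> marks terminals.\<close>

inductive derives_step ::
    "('n \<times> ('n + 'a) list) set \<Rightarrow> ('n + 'a) list \<Rightarrow> ('n + 'a) list \<Rightarrow> bool"
  for P :: "('n \<times> ('n + 'a) list) set" where
  "(N, r) \<in> P \<Longrightarrow> derives_step P (x @ [Inl N] @ y) (x @ r @ y)"

definition context_free_language :: "'a set \<Rightarrow> 'a list set \<Rightarrow> bool" where
  "context_free_language A L \<longleftrightarrow>
     (\<exists>(P :: (nat \<times> (nat + 'a) list) set) S.
        finite P \<and> (\<forall>(N, r)\<in>P. r \<in> lists (range Inl \<union> Inr ` A)) \<and>
        L = {w. (derives_step P)\<^sup>*\<^sup>* [Inl S] (map Inr w)})"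


section \<open>Word problem and word-hyperbolicity\<close>

definition context_free_word_problem ::
    "('m, 'x) monoid_scheme \<Rightarrow> 'a set \<Rightarrow> ('a \<Rightarrow> 'm) \<Rightarrow> bool" where
  "context_free_word_problem M A \<iota> \<longleftrightarrow>
     context_free_language A {w \<in> lists A. word_value M \<iota> w = \<one>\<^bsub>M\<^esub>}"

datatype 'a table_symbol = Letter 'a | Sep1 | Sep2

definition multiplication_table ::
    "('m, 'x) monoid_scheme \<Rightarrow> ('a \<Rightarrow> 'm) \<Rightarrow> 'a list set \<Rightarrow> 'a table_symbol list set" where
  "multiplication_table M \<iota> R =
     {map Letter u @ [Sep1] @ map Letter v @ [Sep2] @ map Letter (rev w) | u v w.
        u \<in> R \<and> v \<in> R \<and> w \<in> R \<and> word_value M \<iota> (u @ v) = word_value M \<iota> w}"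

definition word_hyperbolic ::
    "('m, 'x) monoid_scheme \<Rightarrow> 'a set \<Rightarrow> ('a \<Rightarrow> 'm) \<Rightarrow> bool" where
  "word_hyperbolic M A \<iota> \<longleftrightarrow>
     (\<exists>R \<subseteq> lists A. regular_language A R \<and>
        (\<forall>m\<in>carrier M. \<exists>w\<in>R. word_value M \<iota> w = m) \<and>
        context_free_language (Letter ` A \<union> {Sep1, Sep2}) (multiplication_table M \<iota> R))"


section \<open>Algorithms\<close>

text \<open>Partial recursive functions; \<open>rec_eval f xs y\<close> means that \<open>f\<close> is defined on the
  arguments \<open>xs\<close> with value \<open>y\<close>.\<close>

datatype recf =
    Zero
  | Succ
  | Proj nat
  | Comp recf "recf list"
  | PrimRec recf recf
  | Minimize recf

inductive rec_eval :: "recf \<Rightarrow> nat list \<Rightarrow> nat \<Rightarrow> bool" where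
  "rec_eval Zero xs 0"
| "rec_eval Succ [x] (Suc x)"
| "i < length xs \<Longrightarrow> rec_eval (Proj i) xs (xs ! i)"
| "list_all2 (\<lambda>g y. rec_eval g xs y) gs ys \<Longrightarrow> rec_eval f ys z \<Longrightarrow> rec_eval (Comp f gs) xs z"
| "rec_eval f xs y \<Longrightarrow> rec_eval (PrimRec f g) (0 # xs) y"
| "rec_eval (PrimRec f g) (n # xs) y \<Longrightarrow> rec_eval g (n # y # xs) z \<Longrightarrow>
     rec_eval (PrimRec f g) (Suc n # xs) z"
| "rec_eval f (n # xs) 0 \<Longrightarrow> (\<forall>m<n. \<exists>y>0. rec_eval f (m # xs) y) \<Longrightarrow>
     rec_eval (Minimize f) xs n"
monos list_all2_mono

inductive_cases rec_evalE:
  "rec_eval Zero xs y" "rec_eval Succ xs y" "rec_eval (Proj i) xs y" "rec_eval (Comp f gs) xs y"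
  "rec_eval (PrimRec f g) (0 # xs) y" "rec_eval (PrimRec f g) (Suc n # xs) y"
  "rec_eval (Minimize f) xs y"

lemma rec_eval_deterministic:
  "rec_eval f xs y \<Longrightarrow> rec_eval f xs z \<Longrightarrow> y = z"
proof (induction arbitrary: z rule: rec_eval.induct)
  case (4 xs gs ys f y)
  from 4(4) obtain ys' where ys': "list_all2 (\<lambda>g. rec_eval g xs) gs ys'" "rec_eval f ys' z"
    by (auto elim: rec_evalE)
  have "ys = ys'"
    by (rule nth_equalityI) (use 4(1) ys'(1) in \<open>auto simp: list_all2_conv_all_nth\<close>)
  with ys'(2) have "rec_eval f ys z"
    by (simp only:)
  then show ?case
    by (rule 4(2))
next
  case (7 f n xs)
  from 7(4) have z: "rec_eval f (z # xs) 0" "\<forall>m<z. \<exists>y>0. rec_eval f (m # xs) y"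
    by (auto elim: rec_evalE)
  have "\<not> n < z"
  proof
    assume "n < z"
    with z(2) obtain y where "y > 0" "rec_eval f (n # xs) y"
      by blast
    with "7.IH"(1) show False
      by fastforce
  qed
  moreover have "\<not> z < n"
  proof
    assume "z < n"
    with "7.IH"(2) obtain y where "y > 0" "\<forall>w. rec_eval f (z # xs) w \<longrightarrow> y = w"
      by blast
    with z(1) show False
      by blast
  qed
  ultimately show ?case
    by simp
next
  case 1 then show ?case by (auto elim: rec_evalE)
next
  case 2 then show ?case by (auto elim: rec_evalE)
next
  case 3 then show ?case by (auto elim: rec_evalE)
next
  case (5 f xs y g)
  from 5(3) have "rec_eval f xs z" by (rule rec_evalE)
  then show ?case by (rule "5.IH")
next
  case (6 f g n xs y w)
  from 6(5) obtain v where v: "rec_eval (PrimRec f g) (n # xs) v" "rec_eval g (n # v # xs) z"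
    by (rule rec_evalE)
  have "y = v" using v(1) by (rule "6.IH"(1))
  with v(2) have "rec_eval g (n # y # xs) z" by (simp only:)
  then show ?case by (rule "6.IH"(2))
qed

text \<open>The instances of the decision problem are the elements of \<open>I\<close>, presented as numbers via
  \<open>code\<close>; those in \<open>Y\<close> are the yes-instances. Nothing is required of the algorithm on numbers
  that do not encode an instance.\<close>

definition decidable_problem :: "('i \<Rightarrow> nat) \<Rightarrow> 'i set \<Rightarrow> 'i set \<Rightarrow> bool" where
  "decidable_problem code I Y \<longleftrightarrow>
     (\<exists>f. \<forall>x\<in>I. rec_eval f [code x] (if x \<in> Y then 1 else 0))"


section \<open>The Diophantine problem\<close>

text \<open>In equations, \<open>Inl a\<close> is the constant letter \<open>a\<close> and \<open>Inr x\<close> is the variable \<open>x\<close>.\<close>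

type_synonym equation_system = "((nat + nat) list \<times> (nat + nat) list) list"

definition systems_over :: "nat set \<Rightarrow> equation_system set" where
  "systems_over A = lists (lists (Inl ` A \<union> range Inr) \<times> lists (Inl ` A \<union> range Inr))"

definition solvable ::
    "('m, 'x) monoid_scheme \<Rightarrow> (nat \<Rightarrow> 'm) \<Rightarrow> equation_system \<Rightarrow> bool" where
  "solvable M \<iota> E \<longleftrightarrow>
     (\<exists>\<sigma> \<in> UNIV \<rightarrow> carrier M. \<forall>(U, V) \<in> set E.
        word_value M (case_sum \<iota> \<sigma>) U = word_value M (case_sum \<iota> \<sigma>) V)"

definition word_code :: "(nat + nat) list \<Rightarrow> nat" where
  "word_code U = list_encode (map sum_encode U)"

definition system_code :: "equation_system \<Rightarrow> nat" where
  "system_code E = list_encode (map (\<lambda>(U, V). prod_encode (word_code U, word_code V)) E)"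

definition diophantine_decidable ::
    "('m, 'x) monoid_scheme \<Rightarrow> nat set \<Rightarrow> (nat \<Rightarrow> 'm) \<Rightarrow> bool" where
  "diophantine_decidable M A \<iota> \<longleftrightarrow>
     decidable_problem system_code (systems_over A) {E \<in> systems_over A. solvable M \<iota> E}"

end

theory Submission
  imports Defs
begin

text \<open>
  \<open>M\<close> is given by relations \<open>p q = 1\<close>, where the letters that occur on the left never occur on the
  right. A stack computes the normal form of a word, so words equal to 1 are Dyck words and
  the multiplication table over all words is context-free.

  For words \<open>X\<close> over left letters and \<open>Y\<close> over right letters, \<open>X Y = 1\<close> means that \<open>X\<close> reversed and \<open>Y\<close>
  match letter by letter; hence letterwise relations between words are Diophantine. So is the
  reflexive transitive closure of such a relation, since a whole sequence of steps
  \<open>x = x\<^sub>0, \<dots>, x\<^sub>n = z\<close> is captured by one equation \<open>u # z = # x v\<close> with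
  \<open>u = # x\<^sub>0 \<dots> # x\<^bsub>n-1\<^esub>\<close> and \<open>v\<close> the result of applying a step to each block of \<open>u\<close>. Moving pads to the
  end of a word in this way makes the erasing of letters Diophantine, and this suffices
  to express, for all entries of a list of tuples at once, the graph of every partial recursive
  function, by induction on its definition. If \<open>f\<close> decided the Diophantine problem, then the function that applies \<open>f\<close>
  to the \<open>k\<close>-th system with the number \<open>k\<close> as parameter would be Diophantine, and the
  system defining its zeros, applied to its own code, is solvable iff it is not.
\<close>

section \<open>Monoids presented by cancelling pairs of letters\<close>

text \<open>The right letters generate a free monoid, and solvability of word equations over a free
  monoid is decidable (Makanin); the hardness has to come from the left letters, which test words
  position by position. Such a test yields only relations that preserve the length, while arithmetic
  needs relations that change it; this is what pads are for. Moreover a system has a fixed number of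
  equations, whereas a run has unboundedly many steps, each of which must satisfy a relation defined
  before. If one system checks the relation for all entries of a list, then the steps of a run, or
  of many runs put one after another, can form this list. Erasing is an iteration that is needed
  before lists of tuples can be handled. Its steps are letterwise relations, and extra solutions of
  the iteration equation are harmless there, because the word without its pads is invariant under
  the steps.\<close>

locale pairing =
  fixes A :: "'a set" and Rel :: "('a \<times> 'a) set"
  assumes finite_A: "finite A"
    and Rel_subset: "Rel \<subseteq> A \<times> A"
    and Rel_disjoint: "\<And>p q r. (p, q) \<in> Rel \<Longrightarrow> (q, r) \<notin> Rel"
begin

section \<open>Normal forms computed by a stack\<close>

definition W :: "'a list set" where
  "W = (\<lambda>(p, q). [p, q]) ` Rel"

definition push :: "'a \<Rightarrow> 'a list \<Rightarrow> 'a list" where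
  "push s w = (case w of [] \<Rightarrow> [s] | t # w' \<Rightarrow> if (s, t) \<in> Rel then w' else s # w)"

definition nf :: "'a list \<Rightarrow> 'a list" where
  "nf w = foldr push w []"

abbreviation reduced :: "'a list \<Rightarrow> bool" where
  "reduced \<equiv> successively (\<lambda>s t. (s, t) \<notin> Rel)"

lemma finite_Rel: "finite Rel"
  using finite_subset[OF Rel_subset] finite_A by blast

lemma W_subset: "W \<subseteq> lists A"
  using Rel_subset by (auto simp: W_def)

lemma push_Nil [simp]: "push s [] = [s]"
  by (simp add: push_def)

lemma push_Cons: "push s (t # w) = (if (s, t) \<in> Rel then w else s # t # w)"
  by (simp add: push_def)

text \<open>A right letter \<open>q\<close> cancels with nothing to its right, so it always lands on
  top of the stack, where \<open>p\<close> removes it. Hence words act on arbitrary stacks in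
  accordance with the relations; this replaces a confluence argument.\<close>

lemma push_cancel: "(p, q) \<in> Rel \<Longrightarrow> push p (push q w) = w"
  using Rel_disjoint by (cases w) (auto simp: push_Cons)

lemma nf_Nil [simp]: "nf [] = []"
  by (simp add: nf_def)

lemma nf_Cons: "nf (s # w) = push s (nf w)"
  by (simp add: nf_def)

lemma nf_append: "nf (u @ v) = foldr push u (nf v)"
  by (simp add: nf_def)

text \<open>If \<open>s\<close> cancels the first letter of \<open>w\<close>, putting this pair back
  does not change the action, by \<open>push_cancel\<close>.\<close>

lemma foldr_push_push: "foldr push (push s w) z = push s (foldr push w z)"
  by (cases w) (auto simp: push_Cons push_cancel)

lemma foldr_push_nf: "foldr push (nf u) z = foldr push u z"
  by (induction u) (auto simp: nf_Cons foldr_push_push)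

lemma nf_nf [simp]: "nf (nf w) = nf w"
  using foldr_push_nf[of w "[]"] by (simp add: nf_def)

lemma nf_append_cong: "nf u = nf u' \<Longrightarrow> nf v = nf v' \<Longrightarrow> nf (u @ v) = nf (u' @ v')"
  by (metis foldr_push_nf nf_append)

lemma nf_in_lists: "w \<in> lists A \<Longrightarrow> nf w \<in> lists A"
proof (induction w)
  case (Cons s w)
  then show ?case by (cases "nf w") (auto simp: nf_Cons push_Cons)
qed simp

lemma special_cong_imp_nf: "special_cong A W u v \<Longrightarrow> foldr push u z = foldr push v z"
  by (induction arbitrary: z rule: special_cong.induct) (auto simp: W_def push_cancel)

lemma special_cong_nf: "w \<in> lists A \<Longrightarrow> special_cong A W w (nf w)"
proof (induction w)
  case Nil
  show ?case by (simp add: special_cong.refl)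
next
  case (Cons s w)
  then have s: "s \<in> A" and w: "w \<in> lists A" by auto
  have "special_cong A W ([s] @ w) ([s] @ nf w)"
    using Cons s by (intro special_cong.append special_cong.refl) auto
  moreover have "special_cong A W ([s] @ nf w) (nf (s # w))"
  proof (cases "\<exists>t n. nf w = t # n \<and> (s, t) \<in> Rel")
    case True
    then obtain t n where n: "nf w = t # n" "(s, t) \<in> Rel" by blast
    have "special_cong A W ([s, t] @ n) ([] @ n)"
      using n nf_in_lists[OF w]
      by (intro special_cong.append special_cong.relator special_cong.refl) (auto simp: W_def)
    then show ?thesis using n by (simp add: nf_Cons push_Cons)
  next
    case False
    then have "nf (s # w) = s # nf w"
      by (cases "nf w") (auto simp: nf_Cons push_Cons)
    then show ?thesis using s nf_in_lists[OF w] by (simp add: special_cong.refl)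
  qed
  ultimately show ?case by (simp only: append_Cons append_Nil) (rule special_cong.trans)
qed

lemma special_cong_iff:
  assumes "u \<in> lists A" "v \<in> lists A"
  shows "special_cong A W u v \<longleftrightarrow> nf u = nf v"
proof
  assume "special_cong A W u v"
  then show "nf u = nf v" using special_cong_imp_nf by (auto simp: nf_def)
next
  assume "nf u = nf v"
  then show "special_cong A W u v"
    using special_cong_nf[OF assms(1)] special_cong_nf[OF assms(2)]
    by (metis special_cong.sym special_cong.trans)
qed

lemma reduced_push: "reduced w \<Longrightarrow> reduced (push s w)"
  by (cases w) (auto simp: push_Cons successively_Cons)

lemma reduced_nf: "reduced (nf w)"
  by (induction w) (auto simp: nf_Cons reduced_push)

lemma foldr_push_reduced:
  "reduced (x @ y) \<Longrightarrow> foldr push x y = x @ y"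
proof (induction x)
  case (Cons s x)
  then show ?case by (cases "x @ y") (auto simp: push_Cons successively_Cons)
qed simp

lemma nf_reduced: "reduced w \<Longrightarrow> nf w = w"
  using foldr_push_reduced[of w "[]"] by (simp add: nf_def)

lemma foldr_push_no_cancel:
  assumes "reduced (x @ [l])" "y \<noteq> [] \<Longrightarrow> (l, hd y) \<notin> Rel"
  shows "foldr push (x @ [l]) y = x @ [l] @ y"
proof -
  have "foldr push (x @ [l]) y = x @ [l] @ y"
    using assms
  proof (induction x)
    case Nil
    then show ?case by (cases y) (auto simp: push_Cons)
  next
    case (Cons s x)
    then show ?case by (cases x) (auto simp: push_Cons successively_Cons)
  qed
  then show ?thesis .
qed

text \<open>The last letter of \<open>x\<close> is the first to meet \<open>y\<close>, hence the
  induction from the right. Either it removes the first letter of \<open>y\<close>, or it stays and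
  protects the rest of \<open>x\<close> from cancelling.\<close>

lemma foldr_push_eq_Nil:
  "reduced x \<Longrightarrow> foldr push x y = [] \<longleftrightarrow> list_all2 (\<lambda>p q. (p, q) \<in> Rel) (rev x) y"
proof (induction x arbitrary: y rule: rev_induct)
  case Nil
  then show ?case by simp
next
  case (snoc l x)
  show ?case
  proof (cases "\<exists>q z. y = q # z \<and> (l, q) \<in> Rel")
    case True
    then obtain q z where y: "y = q # z" "(l, q) \<in> Rel" by blast
    have "reduced x" using snoc.prems by (simp add: successively_append_iff)
    then show ?thesis using snoc.IH[of z] y by (simp add: push_Cons)
  next
    case False
    then have "foldr push (x @ [l]) y = x @ [l] @ y"
      by (intro foldr_push_no_cancel snoc.prems) (cases y, auto)
    then show ?thesis using False by (cases y) auto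
  qed
qed

lemma nf_append_eq_Nil:
  "nf (u @ v) = [] \<longleftrightarrow> list_all2 (\<lambda>p q. (p, q) \<in> Rel) (rev (nf u)) (nf v)"
  by (metis foldr_push_eq_Nil foldr_push_nf nf_append reduced_nf)

section \<open>Word classes and the group of units\<close>

abbreviation M :: "'a list set monoid" where
  "M \<equiv> special_monoid A W"

lemma word_class_eq:
  assumes "u \<in> lists A" "v \<in> lists A"
  shows "word_class A W u = word_class A W v \<longleftrightarrow> nf u = nf v"
  using assms by (simp add: word_class_eq_iff special_cong_iff)

lemma word_value_eq_iff:
  assumes "u \<in> lists A" "v \<in> lists A"
  shows "word_value M (generator A W) u = word_value M (generator A W) v \<longleftrightarrow> nf u = nf v"
  using assms by (simp add: word_value_special_monoid word_class_eq)

text \<open>If \<open>X\<close> and \<open>Y\<close> are inverse to each other, every letter of the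
  normal form of \<open>X\<close> is a left letter because of \<open>X Y = 1\<close> and a right
  letter because of \<open>Y X = 1\<close>.\<close>

lemma trivial_group_units: "trivial_group (units_of M)"
proof -
  have one: "X = \<one>\<^bsub>M\<^esub>" if "X \<in> Units M" for X
  proof -
    from that obtain Y where XY: "X \<in> carrier M" "Y \<in> carrier M"
      "Y \<otimes>\<^bsub>M\<^esub> X = \<one>\<^bsub>M\<^esub>" "X \<otimes>\<^bsub>M\<^esub> Y = \<one>\<^bsub>M\<^esub>"
      by (auto simp: Units_def)
    then obtain u v where u: "u \<in> lists A" "X = word_class A W u"
      and v: "v \<in> lists A" "Y = word_class A W v"
      by (auto simp: carrier_special_monoid)
    have "nf (u @ v) = []" "nf (v @ u) = []"
      using XY(3,4) u v
      by (simp_all add: mult_special_monoid one_special_monoid word_class_eq)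
    then have uv: "list_all2 (\<lambda>p q. (p, q) \<in> Rel) (rev (nf u)) (nf v)"
      and vu: "list_all2 (\<lambda>p q. (p, q) \<in> Rel) (rev (nf v)) (nf u)"
      by (simp_all add: nf_append_eq_Nil)
    have "nf u = []"
    proof (rule ccontr)
      assume "nf u \<noteq> []"
      then obtain s where s: "s \<in> set (nf u)" by (cases "nf u") auto
      obtain q where "(s, q) \<in> Rel"
        using uv s by (metis list_all2_conv_all_nth in_set_conv_nth set_rev)
      moreover obtain p where "(p, s) \<in> Rel"
        using vu s by (metis list_all2_conv_all_nth in_set_conv_nth)
      ultimately show False using Rel_disjoint by blast
    qed
    then show ?thesis using u by (simp add: one_special_monoid word_class_eq)
  qed
  have "Units M = {\<one>\<^bsub>M\<^esub>}"
  proof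
    show "Units M \<subseteq> {\<one>\<^bsub>M\<^esub>}"
      by (intro subsetI) (simp only: one singleton_iff)
    show "{\<one>\<^bsub>M\<^esub>} \<subseteq> Units M"
      using monoid.Units_one_closed[OF monoid_special_monoid] by (simp only: insert_subset empty_subsetI simp_thms)
  qed
  then show ?thesis
    unfolding trivial_group_def units_of_carrier units_of_one
    using monoid.units_group[OF monoid_special_monoid] by (simp only: simp_thms)
qed

end

section \<open>Context-free grammars\<close>

text \<open>The language of a grammar is the least assignment \<open>L\<close> that is closed under
  the productions when sentential forms are read in this way. \<open>generates_rule\<close> and
  \<open>generates_sound\<close> express this, so that concrete grammars are treated without
  derivations.\<close>

fun form_language :: "('n \<Rightarrow> 'b list set) \<Rightarrow> ('n + 'b) list \<Rightarrow> 'b list set" where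
  "form_language L [] = {[]}"
| "form_language L (Inl N # r) = {u @ v | u v. u \<in> L N \<and> v \<in> form_language L r}"
| "form_language L (Inr b # r) = {b # v | v. v \<in> form_language L r}"

lemma form_language_append:
  "form_language L (r @ s) = {u @ v | u v. u \<in> form_language L r \<and> v \<in> form_language L s}"
proof (induction L r rule: form_language.induct)
  case (2 L N r)
  have "w \<in> form_language L ((Inl N # r) @ s) \<longleftrightarrow>
      (\<exists>x y z. w = x @ y @ z \<and> x \<in> L N \<and> y \<in> form_language L r \<and> z \<in> form_language L s)" for w
    using 2 by auto
  moreover have "w \<in> {u @ v | u v. u \<in> form_language L (Inl N # r) \<and> v \<in> form_language L s} \<longleftrightarrow>
      (\<exists>x y z. w = x @ y @ z \<and> x \<in> L N \<and> y \<in> form_language L r \<and> z \<in> form_language L s)" for w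
    by auto (metis append.assoc)+
  ultimately show ?case by blast
next
  case (3 L b r)
  then show ?case by (auto, metis append_Cons, blast)
qed simp

lemma form_language_terminals: "form_language L (map Inr w) = {w}"
  by (induction w) auto

lemma form_language_step:
  assumes closed: "\<And>N r. (N, r) \<in> P \<Longrightarrow> form_language L r \<subseteq> L N"
    and "derives_step P \<alpha> \<beta>"
  shows "form_language L \<beta> \<subseteq> form_language L \<alpha>"
  using assms(2)
proof (cases rule: derives_step.cases)
  case (1 N r x y)
  then show ?thesis using closed[OF 1(3)] by (auto simp: form_language_append) blast
qed

lemma derives_sound:
  assumes "\<And>N r. (N, r) \<in> P \<Longrightarrow> form_language L r \<subseteq> L N"
    and "(derives_step P)\<^sup>*\<^sup>* [Inl S] (map Inr w)"
  shows "w \<in> L S"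
proof -
  have "form_language L \<beta> \<subseteq> form_language L \<alpha>" if "(derives_step P)\<^sup>*\<^sup>* \<alpha> \<beta>" for \<alpha> \<beta>
    using that
  proof (induction rule: rtranclp_induct)
    case (step \<beta> \<gamma>)
    then show ?case using form_language_step[OF assms(1) step.hyps(2)] by blast
  qed simp
  from this[OF assms(2)] show ?thesis by (simp add: form_language_terminals)
qed

lemma derives_step_context:
  "derives_step P \<alpha> \<beta> \<Longrightarrow> derives_step P (x @ \<alpha> @ y) (x @ \<beta> @ y)"
proof (induction rule: derives_step.induct)
  case (1 N r u v)
  then show ?case using derives_step.intros[OF 1, of "x @ u" "v @ y"] by simp
qed

lemma derives_context:
  "(derives_step P)\<^sup>*\<^sup>* \<alpha> \<beta> \<Longrightarrow> (derives_step P)\<^sup>*\<^sup>* (x @ \<alpha> @ y) (x @ \<beta> @ y)"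
proof (induction rule: rtranclp_induct)
  case (step \<beta> \<gamma>)
  then show ?case by (meson derives_step_context rtranclp.rtrancl_into_rtrancl)
qed simp

lemma derives_append:
  assumes "(derives_step P)\<^sup>*\<^sup>* \<alpha> \<beta>" "(derives_step P)\<^sup>*\<^sup>* \<gamma> \<delta>"
  shows "(derives_step P)\<^sup>*\<^sup>* (\<alpha> @ \<gamma>) (\<beta> @ \<delta>)"
  using derives_context[OF assms(1), of "[]" \<gamma>] derives_context[OF assms(2), of \<beta> "[]"]
  by (simp add: rtranclp_trans)

lemma derives_complete:
  "w \<in> form_language (\<lambda>N. {w. (derives_step P)\<^sup>*\<^sup>* [Inl N] (map Inr w)}) r
    \<Longrightarrow> (derives_step P)\<^sup>*\<^sup>* r (map Inr w)"
proof (induction r arbitrary: w)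
  case (Cons X r)
  show ?case
  proof (cases X)
    case (Inl N)
    with Cons obtain u v where "w = u @ v" "(derives_step P)\<^sup>*\<^sup>* [Inl N] (map Inr u)"
      "(derives_step P)\<^sup>*\<^sup>* r (map Inr v)" by auto
    then show ?thesis using derives_append[of P "[Inl N]" _ r] Inl by simp
  next
    case (Inr b)
    with Cons obtain v where "w = b # v" "(derives_step P)\<^sup>*\<^sup>* r (map Inr v)" by auto
    then show ?thesis using derives_append[of P "[Inr b]" "[Inr b]" r] Inr by simp
  qed
qed simp

definition generates :: "('n \<times> ('n + 'b) list) set \<Rightarrow> 'n \<Rightarrow> 'b list set" where
  "generates P N = {w. (derives_step P)\<^sup>*\<^sup>* [Inl N] (map Inr w)}"

lemma generates_rule:
  assumes "(N, r) \<in> P" "w \<in> form_language (generates P) r"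
  shows "w \<in> generates P N"
proof -
  have "derives_step P [Inl N] r"
    using derives_step.intros[OF assms(1), of "[]" "[]"] by simp
  moreover have "(derives_step P)\<^sup>*\<^sup>* r (map Inr w)"
    using derives_complete assms(2) unfolding generates_def by blast
  ultimately show ?thesis
    unfolding generates_def by (simp add: converse_rtranclp_into_rtranclp)
qed

lemma generates_sound:
  assumes "\<And>N r. (N, r) \<in> P \<Longrightarrow> form_language L r \<subseteq> L N"
  shows "generates P N \<subseteq> L N"
  using derives_sound[OF assms] unfolding generates_def by blast

lemma context_free_languageI:
  fixes P :: "(nat \<times> (nat + 'b) list) set"
  assumes "L = generates P S" "finite P" "\<forall>(N, r)\<in>P. r \<in> lists (range Inl \<union> Inr ` A)"
  shows "context_free_language A L"
  unfolding context_free_language_def generates_def[symmetric] using assms by blast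

section \<open>Context-free word problem and word-hyperbolicity\<close>

context pairing
begin

section \<open>Dyck words and the word problem\<close>

inductive dyck :: "'a list \<Rightarrow> bool" where
  dyck_Nil: "dyck []"
| dyck_append: "dyck u \<Longrightarrow> dyck v \<Longrightarrow> dyck (u @ v)"
| dyck_pair: "(p, q) \<in> Rel \<Longrightarrow> dyck w \<Longrightarrow> dyck (p # w @ [q])"

text \<open>The deletion of Dyck factors, as a derivation that the productions of the grammars can
  mirror. The second word need not be reduced.\<close>

inductive reduces :: "'a list \<Rightarrow> 'a list \<Rightarrow> bool" where
  reduces_Nil: "reduces [] []"
| reduces_Cons: "reduces w n \<Longrightarrow> reduces (s # w) (s # n)"
| reduces_dyck: "dyck d \<Longrightarrow> reduces w n \<Longrightarrow> reduces (d @ w) n"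

lemma dyck_foldr: "dyck w \<Longrightarrow> foldr push w z = z"
  by (induction arbitrary: z rule: dyck.induct) (auto simp: push_cancel)

lemma dyck_lists: "dyck w \<Longrightarrow> w \<in> lists A"
  by (induction rule: dyck.induct) (use Rel_subset in auto)

text \<open>All that precedes the first surviving letter has been deleted and so forms a Dyck
  word.\<close>

lemma reduces_ConsD:
  "reduces w (s # n) \<Longrightarrow> \<exists>d v. dyck d \<and> w = d @ s # v \<and> reduces v n"
proof (induction w "s # n" rule: reduces.induct)
  case (reduces_Cons w)
  then show ?case by (intro exI[of _ "[]"] exI[of _ w]) (auto intro: dyck_Nil)
next
  case (reduces_dyck d w)
  then obtain d' v where "dyck d'" "w = d' @ s # v" "reduces v n" by blast
  with reduces_dyck(1) show ?case
    by (intro exI[of _ "d @ d'"] exI[of _ v]) (auto intro: dyck_append)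
qed

lemma reduces_NilD: "reduces w [] \<Longrightarrow> dyck w"
  by (induction w "[] :: 'a list" rule: reduces.induct) (auto intro: dyck_Nil dyck_append)

lemma reduces_nf: "reduces w (nf w)"
proof (induction w)
  case Nil
  show ?case by (simp add: reduces_Nil)
next
  case (Cons s w)
  show ?case
  proof (cases "\<exists>t n. nf w = t # n \<and> (s, t) \<in> Rel")
    case True
    then obtain t n where n: "nf w = t # n" "(s, t) \<in> Rel" by blast
    with Cons obtain d v where v: "dyck d" "w = d @ t # v" "reduces v n"
      using reduces_ConsD by metis
    then have "reduces ((s # d @ [t]) @ v) n"
      using n by (intro reduces_dyck dyck_pair)
    then show ?thesis using n v by (simp add: nf_Cons push_Cons)
  next
    case False
    then have "nf (s # w) = s # nf w"
      by (cases "nf w") (auto simp: nf_Cons push_Cons)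
    then show ?thesis using Cons by (simp add: reduces_Cons)
  qed
qed

lemma dyck_iff: "dyck w \<longleftrightarrow> nf w = []"
  using dyck_foldr[of w "[]"] reduces_nf[of w] reduces_NilD by (auto simp: nf_def)

text \<open>The parameter \<open>t\<close> turns letters into terminals: \<open>id\<close> for the
  word problem, \<open>Letter\<close> inside the multiplication table.\<close>

definition dyck_grammar :: "('a \<Rightarrow> 'b) \<Rightarrow> (nat \<times> (nat + 'b) list) set" where
  "dyck_grammar t = {(0, []), (0, [Inl 0, Inl 0])}
     \<union> (\<lambda>(p, q). (0, [Inr (t p), Inl 0, Inr (t q)])) ` Rel"

lemma dyck_grammar_complete:
  assumes "dyck_grammar t \<subseteq> P" "dyck w"
  shows "map t w \<in> generates P 0"
  using assms(2)
proof (induction rule: dyck.induct)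
  case dyck_Nil
  show ?case by (rule generates_rule[of _ "[]"]) (use assms(1) in \<open>auto simp: dyck_grammar_def\<close>)
next
  case (dyck_append u v)
  then show ?case
    by (intro generates_rule[of _ "[Inl 0, Inl 0]"])
      (use assms(1) in \<open>auto simp: dyck_grammar_def\<close>)
next
  case (dyck_pair p q w)
  then show ?case
    by (intro generates_rule[of _ "[Inr (t p), Inl 0, Inr (t q)]"])
      (use assms(1) in \<open>auto simp: dyck_grammar_def\<close>)
qed

lemma dyck_grammar_sound:
  assumes "(N, r) \<in> dyck_grammar t" "L 0 = map t ` Collect dyck"
  shows "form_language L r \<subseteq> L N"
proof -
  have "map t u @ map t v \<in> map t ` Collect dyck" if "dyck u" "dyck v" for u v
    using that by (metis dyck_append image_eqI map_append mem_Collect_eq)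
  moreover have "t p # map t u @ [t q] \<in> map t ` Collect dyck" if "dyck u" "(p, q) \<in> Rel" for p q u
    using that dyck_pair[of p q u] by (intro image_eqI[of _ _ "p # u @ [q]"]) auto
  ultimately show ?thesis
    using assms by (auto simp: dyck_grammar_def dyck_Nil image_iff)
qed

lemma context_free_word_problem:
  "context_free_word_problem M A (generator A W)"
proof -
  have "generates (dyck_grammar id) 0 = Collect dyck"
  proof
    show "generates (dyck_grammar id) 0 \<subseteq> Collect dyck"
      using generates_sound[of "dyck_grammar id" "\<lambda>_. Collect dyck" 0]
        dyck_grammar_sound[of _ _ id "\<lambda>_. Collect dyck"] by (auto simp: list.map_id)
    show "Collect dyck \<subseteq> generates (dyck_grammar id) 0"
      using dyck_grammar_complete[OF order.refl, of _ id] by (auto simp: list.map_id)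
  qed
  moreover have "Collect dyck = {w \<in> lists A. word_value M (generator A W) w = \<one>\<^bsub>M\<^esub>}"
  proof -
    have "dyck w \<longleftrightarrow> word_value M (generator A W) w = \<one>\<^bsub>M\<^esub>" if "w \<in> lists A" for w
      using that word_class_eq[OF that, of "[]"]
      by (simp add: word_value_special_monoid one_special_monoid dyck_iff)
    then show ?thesis using dyck_lists by blast
  qed
  moreover have "finite (dyck_grammar id)"
    using finite_Rel by (simp add: dyck_grammar_def)
  moreover have "\<forall>(N, r)\<in>dyck_grammar id. r \<in> lists (range Inl \<union> Inr ` A)"
    using Rel_subset by (fastforce simp: dyck_grammar_def)
  ultimately show ?thesis
    unfolding context_free_word_problem_def by (intro context_free_languageI[of _ "dyck_grammar id" 0]) simp_all
qed

section \<open>The multiplication table over all words\<close>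

abbreviation "ws u \<equiv> map Letter u"

text \<open>Nonterminals: 0 Dyck words, 1 reversed Dyck words, 2 Dyck words with \<open>Sep1\<close> inserted,
  3 and 4 the words of the table after and before \<open>Sep1\<close> has been produced.\<close>

definition table_grammar :: "(nat \<times> (nat + 'a table_symbol) list) set" where
  "table_grammar =
     dyck_grammar Letter
     \<union> {(1, []), (1, [Inl 1, Inl 1])}
     \<union> (\<lambda>(p, q). (1, [Inr (Letter q), Inl 1, Inr (Letter p)])) ` Rel
     \<union> {(2, [Inr Sep1]), (2, [Inl 0, Inl 2]), (2, [Inl 2, Inl 0])}
     \<union> (\<lambda>(p, q). (2, [Inr (Letter p), Inl 2, Inr (Letter q)])) ` Rel
     \<union> {(3, [Inr Sep2]), (3, [Inl 0, Inl 3]), (3, [Inl 3, Inl 1])}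
     \<union> (\<lambda>s. (3, [Inr (Letter s), Inl 3, Inr (Letter s)])) ` A
     \<union> {(4, [Inl 2, Inl 3]), (4, [Inl 0, Inl 4]), (4, [Inl 4, Inl 1])}
     \<union> (\<lambda>s. (4, [Inr (Letter s), Inl 4, Inr (Letter s)])) ` A"

text \<open>In 3 and 4 the two sides have the same normal form. The productions keep it so: they put
  the same letter on both sides or add a Dyck word to one side.\<close>

definition table_language :: "nat \<Rightarrow> 'a table_symbol list set" where
  "table_language N =
     (if N = 0 then ws ` Collect dyck
      else if N = 1 then (\<lambda>d. ws (rev d)) ` Collect dyck
      else if N = 2 then {ws u @ Sep1 # ws v | u v. dyck (u @ v)}
      else if N = 3 then {ws v @ Sep2 # ws (rev w) | v w. v \<in> lists A \<and> w \<in> lists A \<and> nf v = nf w}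
      else {ws u @ Sep1 # ws v @ Sep2 # ws (rev w) | u v w.
              u \<in> lists A \<and> v \<in> lists A \<and> w \<in> lists A \<and> nf (u @ v) = nf w})"

lemma nf_dyck_append: "dyck d \<Longrightarrow> nf (d @ w) = nf w"
  by (simp add: nf_append dyck_foldr)

lemma table_grammar_sound:
  assumes "(N, r) \<in> table_grammar"
  shows "form_language table_language r \<subseteq> table_language N"
proof
  fix x assume x: "x \<in> form_language table_language r"
  have L: "table_language 0 = ws ` Collect dyck"
    "table_language 1 = (\<lambda>d. ws (rev d)) ` Collect dyck"
    "table_language 2 = {ws u @ Sep1 # ws v | u v. dyck (u @ v)}"
    "table_language 3 = {ws v @ Sep2 # ws (rev w) | v w. v \<in> lists A \<and> w \<in> lists A \<and> nf v = nf w}"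
    "table_language 4 = {ws u @ Sep1 # ws v @ Sep2 # ws (rev w) | u v w.
              u \<in> lists A \<and> v \<in> lists A \<and> w \<in> lists A \<and> nf (u @ v) = nf w}"
    by (simp_all add: table_language_def)
  have I1: "ws (rev d) \<in> table_language 1" if "dyck d" for d
    using that L by blast
  have I2: "ws u @ Sep1 # ws v \<in> table_language 2" if "dyck (u @ v)" for u v
    unfolding L mem_Collect_eq
    by (rule exI[of _ u], rule exI[of _ v]) (use that in simp)
  have I3: "ws v @ Sep2 # ws (rev w) \<in> table_language 3"
    if "v \<in> lists A" "w \<in> lists A" "nf v = nf w" for v w
    unfolding L mem_Collect_eq
    by (rule exI[of _ v], rule exI[of _ w]) (use that in simp)
  have I4: "ws u @ Sep1 # ws v @ Sep2 # ws (rev w) \<in> table_language 4"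
    if "u \<in> lists A" "v \<in> lists A" "w \<in> lists A" "nf (u @ v) = nf w" for u v w
    unfolding L mem_Collect_eq
    by (rule exI[of _ u], rule exI[of _ v], rule exI[of _ w]) (use that in simp)
  have E3: "\<exists>v w. y = ws v @ Sep2 # ws (rev w) \<and> v \<in> lists A \<and> w \<in> lists A \<and> nf v = nf w"
    if "y \<in> table_language 3" for y
    using that unfolding L mem_Collect_eq .
  have E4: "\<exists>u v w. y = ws u @ Sep1 # ws v @ Sep2 # ws (rev w) \<and> u \<in> lists A \<and> v \<in> lists A \<and>
      w \<in> lists A \<and> nf (u @ v) = nf w"
    if "y \<in> table_language 4" for y
    using that unfolding L mem_Collect_eq .
  consider (d) "(N, r) \<in> dyck_grammar Letter"
    | (a1) "N = 1" "r = []" | (a2) "N = 1" "r = [Inl 1, Inl 1]"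
    | (a3) p q where "N = 1" "(p, q) \<in> Rel" "r = [Inr (Letter q), Inl 1, Inr (Letter p)]"
    | (b1) "N = 2" "r = [Inr Sep1]" | (b2) "N = 2" "r = [Inl 0, Inl 2]"
    | (b3) "N = 2" "r = [Inl 2, Inl 0]"
    | (b4) p q where "N = 2" "(p, q) \<in> Rel" "r = [Inr (Letter p), Inl 2, Inr (Letter q)]"
    | (c1) "N = 3" "r = [Inr Sep2]" | (c2) "N = 3" "r = [Inl 0, Inl 3]"
    | (c3) "N = 3" "r = [Inl 3, Inl 1]"
    | (c4) s where "N = 3" "s \<in> A" "r = [Inr (Letter s), Inl 3, Inr (Letter s)]"
    | (e1) "N = 4" "r = [Inl 2, Inl 3]" | (e2) "N = 4" "r = [Inl 0, Inl 4]"
    | (e3) "N = 4" "r = [Inl 4, Inl 1]"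
    | (e4) s where "N = 4" "s \<in> A" "r = [Inr (Letter s), Inl 4, Inr (Letter s)]"
    using assms unfolding table_grammar_def
    by (elim UnE imageE insertE emptyE) (auto split: prod.splits)
  then show "x \<in> table_language N"
  proof cases
    case d
    then show ?thesis using dyck_grammar_sound[OF d, of table_language] L(1) x by blast
  next
    case a1
    then show ?thesis using x I1[OF dyck_Nil] by simp
  next
    case a2
    then obtain d e where "dyck d" "dyck e" "x = ws (rev d) @ ws (rev e)"
      using x L(2) by auto
    then show ?thesis using a2 I1[OF dyck_append[of e d]] by simp
  next
    case a3
    then obtain d where "dyck d" "x = Letter q # ws (rev d) @ [Letter p]"
      using x L(2) by auto
    then show ?thesis using a3 I1[OF dyck_pair[of p q d]] by simp
  next
    case b1
    then show ?thesis using x I2[of "[]" "[]"] dyck_Nil by simp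
  next
    case b2
    then obtain d u v where "dyck d" "dyck (u @ v)" "x = ws d @ ws u @ Sep1 # ws v"
      using x L(1,3) by auto
    then show ?thesis using b2 I2[of "d @ u" v] dyck_append[of d "u @ v"] by simp
  next
    case b3
    then obtain d u v where "dyck d" "dyck (u @ v)" "x = ws u @ Sep1 # ws v @ ws d"
      using x L(1,3) by auto
    then show ?thesis using b3 I2[of u "v @ d"] dyck_append[of "u @ v" d] by simp
  next
    case b4
    then obtain u v where "dyck (u @ v)" "x = Letter p # ws u @ Sep1 # ws v @ [Letter q]"
      using x L(3) by auto
    then show ?thesis using b4 I2[of "p # u" "v @ [q]"] dyck_pair[of p q "u @ v"] by simp
  next
    case c1
    then show ?thesis using x I3[of "[]" "[]"] by simp
  next
    case c2
    then obtain d v w where "dyck d" "v \<in> lists A" "w \<in> lists A" "nf v = nf w"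
      "x = ws d @ ws v @ Sep2 # ws (rev w)"
      using x L(1,4) by auto
    then show ?thesis using c2 I3[of "d @ v" w] dyck_lists[of d] by (simp add: nf_dyck_append)
  next
    case c3
    then obtain y d where y: "y \<in> table_language 3" "dyck d" "x = y @ ws (rev d)"
      using x L(2) by auto
    from E3[OF y(1)] obtain v w where "y = ws v @ Sep2 # ws (rev w)"
      "v \<in> lists A" "w \<in> lists A" "nf v = nf w" by (elim exE conjE)
    then show ?thesis using c3 y I3[of v "d @ w"] dyck_lists[of d] by (simp add: nf_dyck_append)
  next
    case c4
    then obtain y where y: "y \<in> table_language 3" "x = Letter s # y @ [Letter s]"
      using x by auto
    from E3[OF y(1)] obtain v w where "y = ws v @ Sep2 # ws (rev w)"
      "v \<in> lists A" "w \<in> lists A" "nf v = nf w" by (elim exE conjE)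
    then show ?thesis using c4 y I3[of "s # v" "s # w"] by (simp add: nf_Cons)
  next
    case e1
    then obtain y z where y: "y \<in> table_language 2" "z \<in> table_language 3" "x = y @ z"
      using x by auto
    obtain u v where "dyck (u @ v)" "y = ws u @ Sep1 # ws v"
      using y(1) L(3) by auto
    moreover from E3[OF y(2)] obtain v' w where "z = ws v' @ Sep2 # ws (rev w)"
      "v' \<in> lists A" "w \<in> lists A" "nf v' = nf w" by (elim exE conjE)
    ultimately show ?thesis
      using e1 y(3) I4[of u "v @ v'" w] dyck_lists[of "u @ v"] nf_dyck_append[of "u @ v" v'] by simp
  next
    case e2
    then obtain d y where y: "dyck d" "y \<in> table_language 4" "x = ws d @ y"
      using x L(1) by auto
    from E4[OF y(2)] obtain u v w where "y = ws u @ Sep1 # ws v @ Sep2 # ws (rev w)"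
      "u \<in> lists A" "v \<in> lists A" "w \<in> lists A" "nf (u @ v) = nf w" by (elim exE conjE)
    then show ?thesis using e2 y I4[of "d @ u" v w] dyck_lists[of d] by (simp add: nf_dyck_append)
  next
    case e3
    then obtain d y where y: "dyck d" "y \<in> table_language 4" "x = y @ ws (rev d)"
      using x L(2) by auto
    from E4[OF y(2)] obtain u v w where "y = ws u @ Sep1 # ws v @ Sep2 # ws (rev w)"
      "u \<in> lists A" "v \<in> lists A" "w \<in> lists A" "nf (u @ v) = nf w" by (elim exE conjE)
    then show ?thesis using e3 y I4[of u v "d @ w"] dyck_lists[of d] by (simp add: nf_dyck_append)
  next
    case e4
    then obtain y where y: "y \<in> table_language 4" "x = Letter s # y @ [Letter s]"
      using x by auto
    from E4[OF y(1)] obtain u v w where "y = ws u @ Sep1 # ws v @ Sep2 # ws (rev w)"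
      "u \<in> lists A" "v \<in> lists A" "w \<in> lists A" "nf (u @ v) = nf w" by (elim exE conjE)
    then show ?thesis using e4 y I4[of "s # u" v "s # w"] by (simp add: nf_Cons)
  qed
qed

abbreviation "table_gen \<equiv> generates table_grammar"

lemma table_gen_dyck: "dyck d \<Longrightarrow> ws d \<in> table_gen 0"
  by (rule dyck_grammar_complete) (auto simp: table_grammar_def)

lemma table_gen_rev_dyck: "dyck d \<Longrightarrow> ws (rev d) \<in> table_gen 1"
proof (induction rule: dyck.induct)
  case dyck_Nil
  show ?case by (rule generates_rule[of _ "[]"]) (auto simp: table_grammar_def)
next
  case (dyck_append u v)
  then show ?case
    by (intro generates_rule[of 1 "[Inl 1, Inl 1]"]) (auto simp: table_grammar_def)
next
  case (dyck_pair p q w)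
  then show ?case
    by (intro generates_rule[of 1 "[Inr (Letter q), Inl 1, Inr (Letter p)]"])
      (auto simp: table_grammar_def)
qed

lemma table_gen_rules:
  "[Sep1] \<in> table_gen 2"
  "x \<in> table_gen 0 \<Longrightarrow> y \<in> table_gen 2 \<Longrightarrow> x @ y \<in> table_gen 2"
  "y \<in> table_gen 2 \<Longrightarrow> x \<in> table_gen 0 \<Longrightarrow> y @ x \<in> table_gen 2"
  "y \<in> table_gen 2 \<Longrightarrow> (p, q) \<in> Rel \<Longrightarrow> Letter p # y @ [Letter q] \<in> table_gen 2"
  "[Sep2] \<in> table_gen 3"
  "x \<in> table_gen 0 \<Longrightarrow> y \<in> table_gen 3 \<Longrightarrow> x @ y \<in> table_gen 3"
  "y \<in> table_gen 3 \<Longrightarrow> z \<in> table_gen 1 \<Longrightarrow> y @ z \<in> table_gen 3"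
  "y \<in> table_gen 3 \<Longrightarrow> s \<in> A \<Longrightarrow> Letter s # y @ [Letter s] \<in> table_gen 3"
  "x \<in> table_gen 2 \<Longrightarrow> y \<in> table_gen 3 \<Longrightarrow> x @ y \<in> table_gen 4"
  "x \<in> table_gen 0 \<Longrightarrow> y \<in> table_gen 4 \<Longrightarrow> x @ y \<in> table_gen 4"
  "y \<in> table_gen 4 \<Longrightarrow> z \<in> table_gen 1 \<Longrightarrow> y @ z \<in> table_gen 4"
  "y \<in> table_gen 4 \<Longrightarrow> s \<in> A \<Longrightarrow> Letter s # y @ [Letter s] \<in> table_gen 4"
proof -
  note gr = table_grammar_def
  show "[Sep1] \<in> table_gen 2"
    by (rule generates_rule[of _ "[Inr Sep1]"]) (auto simp: gr)
  show "x @ y \<in> table_gen 2" if "x \<in> table_gen 0" "y \<in> table_gen 2"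
    by (rule generates_rule[of _ "[Inl 0, Inl 2]"]) (use that in \<open>auto simp: gr\<close>)
  show "y @ x \<in> table_gen 2" if "y \<in> table_gen 2" "x \<in> table_gen 0"
    by (rule generates_rule[of _ "[Inl 2, Inl 0]"]) (use that in \<open>auto simp: gr\<close>)
  show "Letter p # y @ [Letter q] \<in> table_gen 2" if "y \<in> table_gen 2" "(p, q) \<in> Rel"
    by (rule generates_rule[of _ "[Inr (Letter p), Inl 2, Inr (Letter q)]"]) (use that in \<open>auto simp: gr\<close>)
  show "[Sep2] \<in> table_gen 3"
    by (rule generates_rule[of _ "[Inr Sep2]"]) (auto simp: gr)
  show "x @ y \<in> table_gen 3" if "x \<in> table_gen 0" "y \<in> table_gen 3"
    by (rule generates_rule[of _ "[Inl 0, Inl 3]"]) (use that in \<open>auto simp: gr\<close>)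
  show "y @ z \<in> table_gen 3" if "y \<in> table_gen 3" "z \<in> table_gen 1"
    by (rule generates_rule[of _ "[Inl 3, Inl 1]"]) (use that in \<open>auto simp: gr\<close>)
  show "Letter s # y @ [Letter s] \<in> table_gen 3" if "y \<in> table_gen 3" "s \<in> A"
    by (rule generates_rule[of _ "[Inr (Letter s), Inl 3, Inr (Letter s)]"]) (use that in \<open>auto simp: gr\<close>)
  show "x @ y \<in> table_gen 4" if "x \<in> table_gen 2" "y \<in> table_gen 3"
    by (rule generates_rule[of _ "[Inl 2, Inl 3]"]) (use that in \<open>auto simp: gr\<close>)
  show "x @ y \<in> table_gen 4" if "x \<in> table_gen 0" "y \<in> table_gen 4"
    by (rule generates_rule[of _ "[Inl 0, Inl 4]"]) (use that in \<open>auto simp: gr\<close>)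
  show "y @ z \<in> table_gen 4" if "y \<in> table_gen 4" "z \<in> table_gen 1"
    by (rule generates_rule[of _ "[Inl 4, Inl 1]"]) (use that in \<open>auto simp: gr\<close>)
  show "Letter s # y @ [Letter s] \<in> table_gen 4" if "y \<in> table_gen 4" "s \<in> A"
    by (rule generates_rule[of _ "[Inr (Letter s), Inl 4, Inr (Letter s)]"]) (use that in \<open>auto simp: gr\<close>)
qed

text \<open>Needed for a \<open>Sep1\<close> that lies between two letters which cancel each other.
  A cut of a product falls into one of its factors; a cut of a bracketed word is inside the brackets
  or at an end.\<close>

lemma table_gen_split_dyck: "dyck d \<Longrightarrow> d = u @ v \<Longrightarrow> ws u @ Sep1 # ws v \<in> table_gen 2"
proof (induction arbitrary: u v rule: dyck.induct)
  case dyck_Nil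
  then show ?case using table_gen_rules(1) by simp
next
  case (dyck_append d e)
  from dyck_append.prems consider z where "d = u @ z" "v = z @ e" | z where "u = d @ z" "e = z @ v"
    by (auto simp: append_eq_append_conv2)
  then show ?case
  proof cases
    case 1
    then show ?thesis
      using table_gen_rules(3)[OF dyck_append.IH(1)[OF 1(1)] table_gen_dyck[OF dyck_append.hyps(2)]]
      by simp
  next
    case 2
    then show ?thesis
      using table_gen_rules(2)[OF table_gen_dyck[OF dyck_append.hyps(1)] dyck_append.IH(2)[OF 2(2)]]
      by simp
  qed
next
  case (dyck_pair p q w)
  have d: "ws (p # w @ [q]) \<in> table_gen 0"
    by (intro table_gen_dyck dyck.dyck_pair dyck_pair)
  show ?case
  proof (cases "u = [] \<or> v = []")
    case True
    then show ?thesis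
      using table_gen_rules(2)[OF d table_gen_rules(1)] table_gen_rules(3)[OF table_gen_rules(1) d]
        dyck_pair.prems by auto
  next
    case False
    then obtain u' v' where uv: "u = p # u'" "v = v' @ [q]" "w = u' @ v'"
      using dyck_pair.prems by (cases u; cases v rule: rev_cases) auto
    then show ?thesis
      using table_gen_rules(4)[OF dyck_pair.IH[OF uv(3)] dyck_pair.hyps(1)] by simp
  qed
qed

lemma reduces_ConsE:
  assumes "reduces w (s # n)"
  obtains d v where "dyck d" "w = d @ s # v" "reduces v n"
  using reduces_ConsD[OF assms] by blast

text \<open>The letters of the common normal form are produced in pairs from the outside in. Dyck
  factors of \<open>v\<close> are added on the left by nonterminal 0, those of \<open>w\<close>
  reversed on the right by nonterminal 1.\<close>

lemma table_gen_3:
  "reduces v n \<Longrightarrow> reduces w n \<Longrightarrow> n \<in> lists A \<Longrightarrow> ws v @ Sep2 # ws (rev w) \<in> table_gen 3"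
proof (induction arbitrary: w rule: reduces.induct)
  case reduces_Nil
  then show ?case
    using table_gen_rules(7)[OF table_gen_rules(5) table_gen_rev_dyck[OF reduces_NilD]] by simp
next
  case (reduces_Cons v n s)
  from reduces_Cons.prems(1) obtain d w' where w: "dyck d" "w = d @ s # w'" "reduces w' n"
    by (rule reduces_ConsE)
  have "Letter s # (ws v @ Sep2 # ws (rev w')) @ [Letter s] \<in> table_gen 3"
    using reduces_Cons w by (intro table_gen_rules(8)) auto
  from table_gen_rules(7)[OF this table_gen_rev_dyck[OF w(1)]] show ?case
    using w by simp
next
  case (reduces_dyck d v n)
  then show ?case
    using table_gen_rules(6)[OF table_gen_dyck[of d]] by simp
qed

text \<open>As in \<open>table_gen_3\<close>, until the cut between \<open>u\<close> and
  \<open>v\<close> is reached: if \<open>u\<close> is used up, nonterminal 2 produces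
  \<open>Sep1\<close> alone; if the cut lies in a Dyck factor, it produces this factor by
  \<open>table_gen_split_dyck\<close>.\<close>

lemma table_gen_4:
  "reduces x n \<Longrightarrow> x = u @ v \<Longrightarrow> reduces w n \<Longrightarrow> n \<in> lists A \<Longrightarrow>
    ws u @ Sep1 # ws v @ Sep2 # ws (rev w) \<in> table_gen 4"
proof (induction arbitrary: u v w rule: reduces.induct)
  case reduces_Nil
  then show ?case
    using table_gen_rules(9)[OF table_gen_rules(1) table_gen_3[OF reduces.reduces_Nil]] by simp
next
  case (reduces_Cons x n s)
  show ?case
  proof (cases u)
    case Nil
    then have "reduces v (s # n)"
      using reduces_Cons by (auto intro: reduces.reduces_Cons)
    then show ?thesis
      using table_gen_rules(9)[OF table_gen_rules(1) table_gen_3] reduces_Cons.prems Nil by simp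
  next
    case (Cons t u')
    then have u: "u = s # u'" "x = u' @ v" using reduces_Cons.prems(1) by auto
    from reduces_Cons.prems(2) obtain d w' where w: "dyck d" "w = d @ s # w'" "reduces w' n"
      by (rule reduces_ConsE)
    have "Letter s # (ws u' @ Sep1 # ws v @ Sep2 # ws (rev w')) @ [Letter s] \<in> table_gen 4"
      using reduces_Cons u w by (intro table_gen_rules(12)) auto
    from table_gen_rules(11)[OF this table_gen_rev_dyck[OF w(1)]] show ?thesis
      using w u by simp
  qed
next
  case (reduces_dyck d x n)
  from reduces_dyck.prems(1) consider z where "d = u @ z" "v = z @ x" | z where "u = d @ z" "x = z @ v"
    by (auto simp: append_eq_append_conv2)
  then show ?case
  proof cases
    case 1
    then show ?thesis
      using table_gen_rules(9)[OF table_gen_split_dyck[OF reduces_dyck.hyps(1) 1(1)]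
          table_gen_3[OF reduces_dyck.hyps(2) reduces_dyck.prems(2,3)]] by simp
  next
    case 2
    then show ?thesis
      using table_gen_rules(10)[OF table_gen_dyck[OF reduces_dyck.hyps(1)]
          reduces_dyck.IH[OF 2(2) reduces_dyck.prems(2,3)]] by simp
  qed
qed

lemma table_gen_4_eq: "table_gen 4 = table_language 4"
proof
  show "table_gen 4 \<subseteq> table_language 4"
    by (rule generates_sound) (rule table_grammar_sound)
  show "table_language 4 \<subseteq> table_gen 4"
  proof
    fix x assume "x \<in> table_language 4"
    then obtain u v w where uvw: "x = ws u @ Sep1 # ws v @ Sep2 # ws (rev w)"
      "w \<in> lists A" "nf (u @ v) = nf w"
      by (auto simp: table_language_def)
    then show "x \<in> table_gen 4"
      using table_gen_4[OF reduces_nf[of "u @ v"]] reduces_nf[of w] nf_in_lists by metis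
  qed
qed

lemma word_hyperbolic: "word_hyperbolic M A (generator A W)"
proof -
  let ?\<iota> = "generator A W"
  have "regular_language A (lists A)"
    unfolding regular_language_def
    by (rule exI[of _ "{0}"], rule exI[of _ 0], rule exI[of _ "\<lambda>_ _. 0"], rule exI[of _ "{0}"])
      (auto, metis foldl_Nil list.exhaust foldl_Cons rev_cases foldl_append)
  moreover have "\<forall>m\<in>carrier M. \<exists>w\<in>lists A. word_value M ?\<iota> w = m"
    unfolding carrier_special_monoid by (auto simp: word_value_special_monoid)
  moreover have "context_free_language (Letter ` A \<union> {Sep1, Sep2}) (multiplication_table M ?\<iota> (lists A))"
  proof -
    have "multiplication_table M ?\<iota> (lists A) = table_gen 4"
      unfolding table_gen_4_eq multiplication_table_def table_language_def
      by (simp add: word_value_eq_iff cong: conj_cong)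
    moreover have "finite table_grammar"
      using finite_Rel finite_A by (simp add: table_grammar_def dyck_grammar_def)
    moreover have "\<forall>(N, r)\<in>table_grammar. r \<in> lists (range Inl \<union> Inr ` (Letter ` A \<union> {Sep1, Sep2}))"
      using Rel_subset by (fastforce simp: table_grammar_def dyck_grammar_def)
    ultimately show ?thesis
      by (rule context_free_languageI)
  qed
  ultimately show ?thesis
    unfolding word_hyperbolic_def by blast
qed

section \<open>Words of left letters, words of right letters, powers of a letter\<close>

lemma nf_no_Domain: "set w \<inter> Domain Rel = {} \<Longrightarrow> nf w = w"
  by (intro nf_reduced) (induction w rule: induct_list012; auto)

lemma nf_no_Range: "set w \<inter> Range Rel = {} \<Longrightarrow> nf w = w"
  by (intro nf_reduced) (induction w rule: induct_list012; auto)

lemma commute_letter_imp: "x @ [s] = s # x \<Longrightarrow> set x \<subseteq> {s}"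
  by (induction x) auto

text \<open>Without left letters nothing cancels, so commuting with \<open>s\<close> is an equation
  between words and makes \<open>X\<close> a power of \<open>s\<close>. In this way one equation
  selects the powers of a generator.\<close>

lemma commute_no_Domain:
  assumes "nf (X @ [s]) = nf (s # X)" "set (nf X) \<inter> Domain Rel = {}" "s \<notin> Domain Rel"
  shows "set (nf X) \<subseteq> {s}"
proof -
  have "nf (X @ [s]) = nf (nf X @ [s])" "nf (s # X) = nf (s # nf X)"
    by (metis nf_append_cong nf_nf) (simp add: nf_Cons)
  then have "nf X @ [s] = s # nf X"
    using assms by (simp add: nf_no_Domain)
  then show ?thesis by (rule commute_letter_imp)
qed

lemma commute_no_Range:
  assumes "nf (X @ [s]) = nf (s # X)" "set (nf X) \<inter> Range Rel = {}" "s \<notin> Range Rel"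
  shows "set (nf X) \<subseteq> {s}"
proof -
  have "nf (X @ [s]) = nf (nf X @ [s])" "nf (s # X) = nf (s # nf X)"
    by (metis nf_append_cong nf_nf) (simp add: nf_Cons)
  then have "nf X @ [s] = s # nf X"
    using assms by (simp add: nf_no_Range)
  then show ?thesis by (rule commute_letter_imp)
qed

lemma nf_append_eq_NilD:
  assumes "nf (u @ v) = []"
  shows "set (nf u) \<inter> Range Rel = {}" "set (nf v) \<inter> Domain Rel = {}"
proof -
  from assms have "list_all2 (\<lambda>p q. (p, q) \<in> Rel) (rev (nf u)) (nf v)"
    by (simp add: nf_append_eq_Nil)
  then have *: "length (nf u) = length (nf v)"
    "\<And>i. i < length (nf v) \<Longrightarrow> (rev (nf u) ! i, nf v ! i) \<in> Rel"
    by (auto simp: list_all2_conv_all_nth)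
  show "set (nf v) \<inter> Domain Rel = {}"
    using *(2) Rel_disjoint by (fastforce simp: in_set_conv_nth)
  have "set (rev (nf u)) \<inter> Range Rel = {}"
    using * Rel_disjoint by (fastforce simp: in_set_conv_nth simp del: set_rev)
  then show "set (nf u) \<inter> Range Rel = {}" by simp
qed

subsection \<open>Systems of equations\<close>

definition val :: "(nat \<Rightarrow> 'a list) \<Rightarrow> ('a + nat) list \<Rightarrow> 'a list" where
  "val \<theta> U = concat (map (case_sum (\<lambda>a. [a]) \<theta>) U)"

definition sat :: "(nat \<Rightarrow> 'a list) \<Rightarrow> (('a + nat) list \<times> ('a + nat) list) list \<Rightarrow> bool" where
  "sat \<theta> E \<longleftrightarrow> (\<forall>(U, V)\<in>set E. nf (val \<theta> U) = nf (val \<theta> V))"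

definition ren :: "(nat \<Rightarrow> nat) \<Rightarrow> (('a + nat) list \<times> ('a + nat) list) list \<Rightarrow>
    (('a + nat) list \<times> ('a + nat) list) list" where
  "ren r E = map (map_prod (map (map_sum id r)) (map (map_sum id r))) E"

lemma val_simps [simp]:
  "val \<theta> [] = []"
  "val \<theta> (Inl a # U) = a # val \<theta> U"
  "val \<theta> (Inr x # U) = \<theta> x @ val \<theta> U"
  by (simp_all add: val_def)

lemma sat_Nil [simp]: "sat \<theta> []"
  by (simp add: sat_def)

lemma sat_Cons [simp]: "sat \<theta> ((U, V) # E) \<longleftrightarrow> nf (val \<theta> U) = nf (val \<theta> V) \<and> sat \<theta> E"
  by (simp add: sat_def)

lemma sat_append [simp]: "sat \<theta> (E @ F) \<longleftrightarrow> sat \<theta> E \<and> sat \<theta> F"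
  by (auto simp: sat_def)

lemma val_ren: "val \<theta> (map (map_sum id r) U) = val (\<theta> \<circ> r) U"
proof (induction U)
  case (Cons s U)
  then show ?case by (cases s) auto
qed simp

lemma sat_ren [simp]: "sat \<theta> (ren r E) \<longleftrightarrow> sat (\<theta> \<circ> r) E"
  by (force simp: sat_def ren_def val_ren)

lemma nf_val_cong:
  assumes "\<And>x. nf (\<theta> x) = nf (\<theta>' x)"
  shows "nf (val \<theta> U) = nf (val \<theta>' U)"
proof (induction U)
  case (Cons s U)
  then show ?case using assms by (cases s) (auto simp: nf_Cons intro: nf_append_cong)
qed simp

text \<open>A value that equals an embedded word only in the monoid can therefore be replaced by
  this word itself.\<close>

lemma sat_cong:
  assumes "\<And>x. nf (\<theta> x) = nf (\<theta>' x)"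
  shows "sat \<theta> E \<longleftrightarrow> sat \<theta>' E"
  using nf_val_cong[OF assms] by (simp add: sat_def)

lemma val_in_lists:
  assumes "\<And>x. \<theta> x \<in> lists A" "U \<in> lists (Inl ` A \<union> range Inr)"
  shows "val \<theta> U \<in> lists A"
  using assms(2)
proof (induction U)
  case (Cons s U)
  then show ?case using assms(1) by (cases s) auto
qed simp

lemma word_value_val:
  assumes "\<And>x. \<theta> x \<in> lists A" "U \<in> lists (Inl ` A \<union> range Inr)"
  shows "word_value M (case_sum (generator A W) (\<lambda>x. word_class A W (\<theta> x))) U = word_class A W (val \<theta> U)"
  using assms(2)
proof (induction U)
  case Nil
  show ?case by (simp add: word_value_def one_special_monoid)
next
  case (Cons s U)
  then have U: "val \<theta> U \<in> lists A" by (intro val_in_lists assms(1)) auto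
  show ?case
  proof (cases s)
    case (Inl a)
    then have "a \<in> A" using Cons.hyps(1) by auto
    then show ?thesis
      using Inl Cons.IH mult_special_monoid[of "[a]" A "val \<theta> U" W] U
      by (simp add: word_value_def generator_def)
  next
    case (Inr x)
    then show ?thesis
      using Cons.IH mult_special_monoid[OF assms(1)[of x] U, of W]
      by (simp add: word_value_def)
  qed
qed

lemma word_value_val_eq_iff:
  assumes "\<And>x. \<theta> x \<in> lists A" "U \<in> lists (Inl ` A \<union> range Inr)" "V \<in> lists (Inl ` A \<union> range Inr)"
  shows "word_value M (case_sum (generator A W) (\<lambda>x. word_class A W (\<theta> x))) U =
      word_value M (case_sum (generator A W) (\<lambda>x. word_class A W (\<theta> x))) V
    \<longleftrightarrow> nf (val \<theta> U) = nf (val \<theta> V)"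
  using assms by (simp add: word_value_val word_class_eq val_in_lists)

end

text \<open>Values in the monoid are exchanged for representing words. Stated outside the locale
  because the constants of an \<open>equation_system\<close> are numbers.\<close>

lemma solvable_iff_sat:
  fixes A :: "nat set"
  assumes "pairing A Rel" "E \<in> systems_over A"
  shows "solvable (special_monoid A (pairing.W Rel)) (generator A (pairing.W Rel)) E
    \<longleftrightarrow> (\<exists>\<theta>. (\<forall>x. \<theta> x \<in> lists A) \<and> pairing.sat Rel \<theta> E)"
proof -
  interpret pairing A Rel by (rule assms(1))
  have E: "U \<in> lists (Inl ` A \<union> range Inr)" "V \<in> lists (Inl ` A \<union> range Inr)"
    if "(U, V) \<in> set E" for U V
    using that assms(2) by (auto simp: systems_over_def)
  have *: "(\<forall>(U, V)\<in>set E. word_value M (case_sum (generator A W) (\<lambda>x. word_class A W (\<theta> x))) U =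
      word_value M (case_sum (generator A W) (\<lambda>x. word_class A W (\<theta> x))) V) \<longleftrightarrow> sat \<theta> E"
    if \<theta>: "\<And>x. \<theta> x \<in> lists A" for \<theta>
    unfolding sat_def
  proof (rule ball_cong[OF HOL.refl])
    fix e assume "e \<in> set E"
    moreover obtain U V where "e = (U, V)" by (cases e)
    ultimately show "(case e of (U, V) \<Rightarrow> word_value M (case_sum (generator A W) (\<lambda>x. word_class A W (\<theta> x))) U =
      word_value M (case_sum (generator A W) (\<lambda>x. word_class A W (\<theta> x))) V) \<longleftrightarrow>
      (case e of (U, V) \<Rightarrow> nf (val \<theta> U) = nf (val \<theta> V))"
      using word_value_val_eq_iff[of \<theta> U V, OF \<theta> E(1)[of U V] E(2)[of U V]] by simp
  qed
  show ?thesis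
  proof
    assume "solvable M (generator A W) E"
    then obtain \<sigma> where \<sigma>: "\<sigma> \<in> UNIV \<rightarrow> carrier M"
      "\<forall>(U, V) \<in> set E. word_value M (case_sum (generator A W) \<sigma>) U =
        word_value M (case_sum (generator A W) \<sigma>) V"
      unfolding solvable_def by blast
    have "\<forall>x. \<exists>w. w \<in> lists A \<and> \<sigma> x = word_class A W w"
      using \<sigma>(1) unfolding carrier_special_monoid by blast
    then obtain \<theta> where \<theta>: "\<And>x. \<theta> x \<in> lists A" "\<And>x. \<sigma> x = word_class A W (\<theta> x)"
      by metis
    then have "\<sigma> = (\<lambda>x. word_class A W (\<theta> x))" by auto
    then show "\<exists>\<theta>. (\<forall>x. \<theta> x \<in> lists A) \<and> sat \<theta> E"
      using * \<theta>(1) \<sigma>(2) by auto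
  next
    assume "\<exists>\<theta>. (\<forall>x. \<theta> x \<in> lists A) \<and> sat \<theta> E"
    then obtain \<theta> where \<theta>: "\<And>x. \<theta> x \<in> lists A" "sat \<theta> E" by blast
    have "(\<lambda>x. word_class A W (\<theta> x)) \<in> UNIV \<rightarrow> carrier M"
      using \<theta>(1) unfolding carrier_special_monoid by blast
    then show "solvable M (generator A W) E"
      unfolding solvable_def using * \<theta> by blast
  qed
qed

section \<open>The monoid\<close>

text \<open>\<open>Sym d e\<close> serves to write numbers in unary: \<open>e\<close> marks the last
  letter of an entry and \<open>d\<close> is a flag. \<open>Pad\<close> is the letter to be erased,
  \<open>Mark\<close> separates or bounds words, and \<open>Swap1\<close>, \<open>Swap2\<close>
  record that a \<open>Pad\<close> and a \<open>Sym\<close> change places.\<close>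

datatype letter = Pad | Mark | Sym bool bool | Swap1 bool bool | Swap2 bool bool

text \<open>\<open>Lo\<close>-words stand for words over \<open>letter\<close>. The remaining generators serve to define relations
  between such words: a word of \<open>Both\<close>s lists the letters of two words, and cancelling it against a
  power of \<open>Tag \<rho>\<close> forces all of its letters to belong to \<open>\<rho>\<close>.\<close>

datatype gen = Lo letter | Hi letter | Tag "(letter \<times> letter) set" | Both letter letter | LoS | HiS

text \<open>The two words listed by \<open>Both\<close>s are over disjoint alphabets
  \<open>Lo\<close> and \<open>Hi\<close>, so their roles cannot be confused. Powers of
  \<open>LoS\<close> or \<open>HiS\<close> test that a variable is a word over one of these
  alphabets. Every relation has its own \<open>Tag\<close>, since one finite alphabet must serve all
  relations used later.\<close>

fun cancels :: "gen \<Rightarrow> gen \<Rightarrow> bool" where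
  "cancels (Both x y) (Lo z) \<longleftrightarrow> z = x"
| "cancels (Both x y) (Hi z) \<longleftrightarrow> z = y"
| "cancels (Both x y) (Tag r) \<longleftrightarrow> (x, y) \<in> r"
| "cancels LoS (Lo z) \<longleftrightarrow> True"
| "cancels HiS (Hi z) \<longleftrightarrow> True"
| "cancels _ _ \<longleftrightarrow> False"

lemma finite_UNIV_letter: "finite (UNIV :: letter set)"
proof (rule finite_subset)
  have "x \<in> {Pad, Mark} \<union> range (case_prod Sym) \<union> range (case_prod Swap1) \<union> range (case_prod Swap2)" for x
    by (cases x) (force simp: image_iff)+
  then show "UNIV \<subseteq> {Pad, Mark} \<union> range (case_prod Sym) \<union> range (case_prod Swap1) \<union> range (case_prod Swap2)"
    by blast
qed simp

lemma finite_UNIV_gen: "finite (UNIV :: gen set)"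
proof (rule finite_subset)
  have "x \<in> {LoS, HiS} \<union> range Lo \<union> range Hi \<union> range Tag \<union> range (case_prod Both)" for x
    by (cases x) (force simp: image_iff)+
  then show "UNIV \<subseteq> {LoS, HiS} \<union> range Lo \<union> range Hi \<union> range Tag \<union> range (case_prod Both)"
    by blast
  have "finite (UNIV :: (letter \<times> letter) set)"
    using finite_UNIV_letter by (simp add: finite_prod)
  then show "finite ({LoS, HiS} \<union> range Lo \<union> range Hi \<union> range Tag \<union> range (case_prod Both))"
    using finite_UNIV_letter by (simp add: Finite_Set.finite_set)
qed

text \<open>An arbitrary injection suffices, since codes of letters enter the reduction only as
  constants of a recursive function.\<close>

definition code :: "gen \<Rightarrow> nat" where
  "code = (SOME f. inj f)"

lemma code_eq_iff [simp]: "code g = code h \<longleftrightarrow> g = h"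
proof -
  have "\<exists>f :: gen \<Rightarrow> nat. inj f"
    using finite_imp_inj_to_nat_seg[OF finite_UNIV_gen] by blast
  then have "inj code" unfolding code_def by (rule someI_ex)
  then show ?thesis by (simp add: inj_eq)
qed

definition code_rel :: "(nat \<times> nat) set" where
  "code_rel = {(code g, code h) | g h. cancels g h}"

lemma code_rel_iff [simp]: "(code g, code h) \<in> code_rel \<longleftrightarrow> cancels g h"
  by (auto simp: code_rel_def)

lemma cancels_disjoint: "cancels f g \<Longrightarrow> \<not> cancels g h"
  by (induction f g rule: cancels.induct) auto

interpretation pairing "range code" code_rel
proof
  show "finite (range code)" using finite_UNIV_gen by simp
  show "code_rel \<subseteq> range code \<times> range code" by (auto simp: code_rel_def)
  show "(q, r) \<notin> code_rel" if "(p, q) \<in> code_rel" for p q r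
    using that cancels_disjoint by (auto simp: code_rel_def)
qed

section \<open>Diophantine relations between words\<close>

definition emb :: "letter list \<Rightarrow> nat list" where
  "emb w = map (\<lambda>l. code (Lo l)) w"

text \<open>In the system that defines \<open>P\<close>, the variable \<open>2 * i\<close> carries the \<open>i\<close>-th argument, and the odd
  variables are existentially quantified.\<close>

definition defined_by :: "((nat \<Rightarrow> letter list) \<Rightarrow> bool) \<Rightarrow> equation_system \<Rightarrow> bool" where
  "defined_by P E \<longleftrightarrow> (\<forall>\<sigma>. P \<sigma> \<longleftrightarrow>
     (\<exists>\<theta>. (\<forall>x. \<theta> x \<in> lists (range code)) \<and> (\<forall>i. \<theta> (2 * i) = emb (\<sigma> i)) \<and> sat \<theta> E))"

definition dio :: "((nat \<Rightarrow> letter list) \<Rightarrow> bool) \<Rightarrow> bool" where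
  "dio P \<longleftrightarrow> (\<exists>E\<in>systems_over (range code). defined_by P E)"

lemma defined_byD:
  "defined_by P E \<Longrightarrow> P \<sigma> \<longleftrightarrow> (\<exists>\<theta>. (\<forall>x. \<theta> x \<in> lists (range code)) \<and> (\<forall>i. \<theta> (2 * i) = emb (\<sigma> i)) \<and> sat \<theta> E)"
  unfolding defined_by_def by (erule allE)

lemma dioE:
  assumes "dio P"
  obtains E where "E \<in> systems_over (range code)" "defined_by P E"
  using assms unfolding dio_def by blast

lemma dioI:
  assumes "E \<in> systems_over (range code)"
    "\<And>\<sigma>. P \<sigma> \<longleftrightarrow> (\<exists>\<theta>. (\<forall>x. \<theta> x \<in> lists (range code)) \<and> (\<forall>i. \<theta> (2 * i) = emb (\<sigma> i)) \<and> sat \<theta> E)"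
  shows "dio P"
  unfolding dio_def defined_by_def using assms by blast

section \<open>Words forced by cancellation\<close>

lemma not_in_Domain [simp]:
  "code (Lo x) \<notin> Domain code_rel" "code (Hi x) \<notin> Domain code_rel" "code (Tag r) \<notin> Domain code_rel"
  by (auto simp: code_rel_def)

lemma not_in_Range [simp]:
  "code (Both x y) \<notin> Range code_rel" "code LoS \<notin> Range code_rel" "code HiS \<notin> Range code_rel"
  by (auto simp: code_rel_def elim!: cancels.elims)

lemma not_code_rel [simp]:
  "(code (Lo x), q) \<notin> code_rel" "(code (Hi x), q) \<notin> code_rel" "(code (Tag r), q) \<notin> code_rel"
  "(p, code (Both x y)) \<notin> code_rel" "(p, code LoS) \<notin> code_rel" "(p, code HiS) \<notin> code_rel"
  using not_in_Domain not_in_Range by blast+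

lemma nf_emb [simp]: "nf (emb w) = emb w"
  by (rule nf_no_Domain) (auto simp: emb_def)

lemma emb_in_lists [simp]: "emb w \<in> lists (range code)" "set (emb w) \<subseteq> range code"
  by (auto simp: emb_def)

lemma length_emb [simp]: "length (emb w) = length w"
  by (simp add: emb_def)

lemma nth_emb [simp]: "i < length w \<Longrightarrow> emb w ! i = code (Lo (w ! i))"
  by (simp add: emb_def)

lemma emb_eq_iff [simp]: "emb u = emb v \<longleftrightarrow> u = v"
  by (auto simp: emb_def intro!: map_inj_on[of "\<lambda>l. code (Lo l)"] inj_onI)

lemma cancel_words_iff:
  "nf (u @ v) = [] \<longleftrightarrow> length (nf u) = length (nf v) \<and>
     (\<forall>i<length (nf v). (rev (nf u) ! i, nf v ! i) \<in> code_rel)"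
  by (auto simp: nf_append_eq_Nil list_all2_conv_all_nth)

lemma code_relE:
  assumes "(p, q) \<in> code_rel"
  obtains g h where "p = code g" "q = code h" "cancels g h"
  using assms by (auto simp: code_rel_def)

text \<open>As \<open>X\<close> is cancelled by \<open>Y\<close>, it has no right letters, so
  commuting with \<open>s\<close> makes it a power of \<open>s\<close>. Each letter of
  \<open>Y\<close> is then one that \<open>s\<close> cancels.\<close>

lemma cancel_power_imp:
  assumes "nf (X @ Y) = []" "nf (X @ [s]) = nf (s # X)" "s \<notin> Range code_rel"
    and f: "\<And>q. (s, q) \<in> code_rel \<Longrightarrow> \<exists>l. q = f l"
  shows "\<exists>y. nf Y = map f y"
proof -
  have X: "set (nf X) \<subseteq> {s}"
    using commute_no_Range[OF assms(2) _ assms(3)] nf_append_eq_NilD(1)[OF assms(1)] by simp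
  have "\<exists>l. q = f l" if "q \<in> set (nf Y)" for q
  proof -
    from that obtain i where i: "i < length (nf Y)" "q = nf Y ! i"
      by (metis in_set_conv_nth)
    then have "(rev (nf X) ! i, q) \<in> code_rel" "i < length (rev (nf X))"
      using assms(1) by (simp_all add: cancel_words_iff)
    moreover from this(2) have "rev (nf X) ! i = s"
      using X nth_mem[of i "rev (nf X)"] by auto
    ultimately show ?thesis using f by simp
  qed
  then show ?thesis by (simp add: ex_map_conv)
qed

lemma LoS_word:
  assumes "nf (X @ Y) = []" "nf (X @ [code LoS]) = nf (code LoS # X)"
  shows "\<exists>y. nf Y = emb y"
  unfolding emb_def
proof (rule cancel_power_imp[OF assms])
  fix q assume "(code LoS, q) \<in> code_rel"
  then obtain h where "q = code h" "cancels LoS h" by (auto elim: code_relE)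
  then show "\<exists>l. q = code (Lo l)" by (cases h) auto
qed simp

lemma HiS_word:
  assumes "nf (X @ Y) = []" "nf (X @ [code HiS]) = nf (code HiS # X)"
  shows "\<exists>y. nf Y = map (\<lambda>l. code (Hi l)) y"
proof (rule cancel_power_imp[OF assms])
  fix q assume "(code HiS, q) \<in> code_rel"
  then obtain h where "q = code h" "cancels HiS h" by (auto elim: code_relE)
  then show "\<exists>l. q = code (Hi l)" by (cases h) auto
qed simp

lemma replicate_commutes: "replicate n s @ [s] = s # replicate n s"
  by (simp add: replicate_append_same)

lemma nf_replicate_cancel:
  assumes "\<And>i. i < length w \<Longrightarrow> (p, w ! i) \<in> code_rel" "p \<notin> Range code_rel"
    "set w \<inter> Domain code_rel = {}"
  shows "nf (replicate (length w) p @ w) = []"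
proof -
  have "nf (replicate (length w) p) = replicate (length w) p"
    using assms(2) by (intro nf_no_Range) auto
  then show ?thesis
    using assms by (simp add: cancel_words_iff nf_no_Domain rev_nth)
qed

text \<open>Each letter of \<open>X\<close> cancels a letter of \<open>x\<close>, the corresponding
  letter of \<open>y\<close> and \<open>Tag r\<close>. Only \<open>Both\<close> cancels letters of
  the alphabets \<open>Lo\<close> and \<open>Hi\<close> alike, and its cancelling
  \<open>Tag r\<close> puts the pair into \<open>r\<close>.\<close>

lemma Tag_word_imp:
  assumes X: "nf (X @ emb x) = []" "nf (X @ Y) = []" "nf (X @ T) = []"
    and T: "nf (T @ [code (Tag r)]) = nf (code (Tag r) # T)"
    and Y: "nf Y = map (\<lambda>l. code (Hi l)) y"
  shows "list_all2 (\<lambda>a b. (a, b) \<in> r) x y"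
proof -
  have TT: "set (nf T) \<subseteq> {code (Tag r)}"
    using commute_no_Domain[OF T] nf_append_eq_NilD[OF X(3)] by simp
  have len: "length (rev (nf X)) = length x" "length (nf T) = length x" "length y = length x"
    using X Y by (auto simp: cancel_words_iff)
  have "(x ! i, y ! i) \<in> r" if i: "i < length x" for i
  proof -
    have "(rev (nf X) ! i, code (Lo (x ! i))) \<in> code_rel"
      using X(1) i by (auto simp: cancel_words_iff)
    then obtain g where g: "rev (nf X) ! i = code g" "cancels g (Lo (x ! i))"
      by (metis code_eq_iff code_relE)
    have "(code g, code (Hi (y ! i))) \<in> code_rel"
      using X(2) i Y len g by (auto simp: cancel_words_iff)
    then have "cancels g (Hi (y ! i))" by simp
    moreover have "nf T ! i = code (Tag r)"
      using TT i len(2) nth_mem[of i "nf T"] by (metis singletonD subsetD)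
    then have "(code g, code (Tag r)) \<in> code_rel"
      using X(3) i len g by (auto simp: cancel_words_iff)
    then have "cancels g (Tag r)" by simp
    ultimately show ?thesis using g(2) by (cases g) auto
  qed
  then show ?thesis using len by (simp add: list_all2_conv_all_nth)
qed

lemma Tag_word_ex:
  assumes "list_all2 (\<lambda>a b. (a, b) \<in> r) x y"
  shows "\<exists>X T. X \<in> lists (range code) \<and> T \<in> lists (range code) \<and>
    nf (X @ emb x) = [] \<and> nf (X @ map (\<lambda>l. code (Hi l)) y) = [] \<and> nf (X @ T) = [] \<and>
    nf (T @ [code (Tag r)]) = nf (code (Tag r) # T)"
proof -
  \<comment> \<open>Reversed, because the last letter of \<open>X\<close> meets the first letters of
    \<open>x\<close>, \<open>y\<close> and \<open>T\<close>.\<close>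
  define X where "X = rev (map2 (\<lambda>a b. code (Both a b)) x y)"
  define T where "T = replicate (length x) (code (Tag r))"
  have len: "length x = length y" using assms by (rule list_all2_lengthD)
  have X: "nf X = X"
    by (rule nf_no_Range) (auto simp: X_def)
  have T: "nf T = T"
    by (rule nf_no_Domain) (auto simp: T_def)
  have H: "nf (map (\<lambda>l. code (Hi l)) y) = map (\<lambda>l. code (Hi l)) y"
    by (rule nf_no_Domain) auto
  have "nf (X @ emb x) = []" "nf (X @ map (\<lambda>l. code (Hi l)) y) = []" "nf (X @ T) = []"
    using assms len unfolding cancel_words_iff X T H nf_emb
    by (auto simp: X_def T_def list_all2_conv_all_nth)
  moreover have "T @ [code (Tag r)] = code (Tag r) # T"
    unfolding T_def by (rule replicate_commutes)
  moreover have "X \<in> lists (range code)" "T \<in> lists (range code)"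
    by (auto simp: X_def T_def)
  ultimately show ?thesis by metis
qed

lemma dio_all2: "dio (\<lambda>\<sigma>. list_all2 (\<lambda>a b. (a, b) \<in> r) (\<sigma> i) (\<sigma> j))"
proof -
  let ?c = "\<lambda>g. Inl (code g)"
  \<comment> \<open>Both arguments are \<open>Lo\<close>-words, so variable 5 is made a
    \<open>Hi\<close>-copy of argument \<open>j\<close>; the power 11 of \<open>HiS\<close> forces
    it to be a \<open>Hi\<close>-word. Variables 1 and 7 (\<open>Both\<close>s and a power of
    \<open>Tag r\<close>) relate argument \<open>i\<close> to this copy, and 3 and 9 (with
    \<open>Tag Id\<close>) relate argument \<open>j\<close> to it.\<close>
  define E where "E =
    [([Inr 1, Inr (2 * i)], []), ([Inr 1, Inr 5], []), ([Inr 1, Inr 7], []),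
     ([Inr 7, ?c (Tag r)], [?c (Tag r), Inr 7]),
     ([Inr 3, Inr (2 * j)], []), ([Inr 3, Inr 5], []), ([Inr 3, Inr 9], []),
     ([Inr 9, ?c (Tag Id)], [?c (Tag Id), Inr 9]),
     ([Inr 11, Inr 5], []), ([Inr 11, ?c HiS], [?c HiS, Inr (11 :: nat)])]"
  have "E \<in> systems_over (range code)"
    by (auto simp: E_def systems_over_def)
  moreover have "list_all2 (\<lambda>a b. (a, b) \<in> r) (\<sigma> i) (\<sigma> j) \<longleftrightarrow>
    (\<exists>\<theta>. (\<forall>x. \<theta> x \<in> lists (range code)) \<and> (\<forall>i. \<theta> (2 * i) = emb (\<sigma> i)) \<and> sat \<theta> E)" for \<sigma>
  proof
    assume r: "list_all2 (\<lambda>a b. (a, b) \<in> r) (\<sigma> i) (\<sigma> j)"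
    define h where "h = map (\<lambda>l. code (Hi l)) (\<sigma> j)"
    obtain X T where X: "X \<in> lists (range code)" "T \<in> lists (range code)"
      "nf (X @ emb (\<sigma> i)) = []" "nf (X @ h) = []" "nf (X @ T) = []"
      "nf (T @ [code (Tag r)]) = nf (code (Tag r) # T)"
      using Tag_word_ex[OF r] unfolding h_def by blast
    have "list_all2 (\<lambda>a b. (a, b) \<in> Id) (\<sigma> j) (\<sigma> j)" by (simp add: list_all2_refl)
    then obtain X' T' where X': "X' \<in> lists (range code)" "T' \<in> lists (range code)"
      "nf (X' @ emb (\<sigma> j)) = []" "nf (X' @ h) = []" "nf (X' @ T') = []"
      "nf (T' @ [code (Tag Id)]) = nf (code (Tag Id) # T')"
      using Tag_word_ex unfolding h_def by blast
    define S where "S = replicate (length h) (code HiS)"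
    have "nf (S @ h) = []"
      unfolding S_def by (rule nf_replicate_cancel) (auto simp: h_def)
    moreover have "S @ [code HiS] = code HiS # S"
      unfolding S_def by (rule replicate_commutes)
    moreover have "S \<in> lists (range code)" "h \<in> lists (range code)"
      by (auto simp: S_def h_def)
    moreover define \<theta> where "\<theta> = (\<lambda>n. if even n then emb (\<sigma> (n div 2)) else if n = 1 then X else if n = 3 then X'
      else if n = 5 then h else if n = 7 then T else if n = 9 then T' else S)"
    moreover have "\<theta> 1 = X" "\<theta> 3 = X'" "\<theta> 5 = h" "\<theta> 7 = T" "\<theta> 9 = T'" "\<theta> 11 = S"
      "\<And>k. \<theta> (2 * k) = emb (\<sigma> k)"
      by (simp_all add: \<theta>_def)
    moreover have "\<theta> x \<in> lists (range code)" for x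
      using X X' calculation by (auto simp: \<theta>_def)
    ultimately show "\<exists>\<theta>. (\<forall>x. \<theta> x \<in> lists (range code)) \<and> (\<forall>i. \<theta> (2 * i) = emb (\<sigma> i)) \<and> sat \<theta> E"
      using X X' by (intro exI[of _ \<theta>]) (simp add: E_def)
  next
    assume "\<exists>\<theta>. (\<forall>x. \<theta> x \<in> lists (range code)) \<and> (\<forall>i. \<theta> (2 * i) = emb (\<sigma> i)) \<and> sat \<theta> E"
    then obtain \<theta> where \<theta>: "\<And>i. \<theta> (2 * i) = emb (\<sigma> i)" "sat \<theta> E" by blast
    from \<theta>(2) have e:
      "nf (\<theta> 1 @ emb (\<sigma> i)) = []" "nf (\<theta> 1 @ \<theta> 5) = []" "nf (\<theta> 1 @ \<theta> 7) = []"
      "nf (\<theta> 7 @ [code (Tag r)]) = nf (code (Tag r) # \<theta> 7)"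
      "nf (\<theta> 3 @ emb (\<sigma> j)) = []" "nf (\<theta> 3 @ \<theta> 5) = []" "nf (\<theta> 3 @ \<theta> 9) = []"
      "nf (\<theta> 9 @ [code (Tag Id)]) = nf (code (Tag Id) # \<theta> 9)"
      "nf (\<theta> 11 @ \<theta> 5) = []" "nf (\<theta> 11 @ [code HiS]) = nf (code HiS # \<theta> 11)"
      unfolding E_def by (simp_all add: \<theta>(1))
    obtain y where y: "nf (\<theta> 5) = map (\<lambda>l. code (Hi l)) y"
      using HiS_word[OF e(9,10)] by blast
    have "list_all2 (\<lambda>a b. (a, b) \<in> Id) (\<sigma> j) y"
      by (rule Tag_word_imp[OF e(5-8) y])
    then have "\<sigma> j = y" by (simp add: list_all2_eq)
    moreover have "list_all2 (\<lambda>a b. (a, b) \<in> r) (\<sigma> i) y"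
      by (rule Tag_word_imp[OF e(1-4) y])
    ultimately show "list_all2 (\<lambda>a b. (a, b) \<in> r) (\<sigma> i) (\<sigma> j)" by simp
  qed
  ultimately show ?thesis by (rule dioI)
qed

definition subst :: "(nat \<Rightarrow> letter list) \<Rightarrow> (letter + nat) list \<Rightarrow> letter list" where
  "subst \<sigma> U = concat (map (case_sum (\<lambda>a. [a]) \<sigma>) U)"

lemma dio_eq: "dio (\<lambda>\<sigma>. subst \<sigma> U = subst \<sigma> V)"
proof -
  define c where "c = map (map_sum (\<lambda>l. code (Lo l)) (\<lambda>i::nat. 2 * i))"
  have c: "val \<theta> (c U) = emb (subst \<sigma> U)" if "\<And>i. \<theta> (2 * i) = emb (\<sigma> i)" for \<theta> \<sigma> U
  proof (induction U)
    case Nil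
    show ?case by (simp add: c_def subst_def emb_def)
  next
    case (Cons s U)
    then show ?case using that by (cases s) (auto simp: c_def subst_def emb_def)
  qed
  have "c U \<in> lists (Inl ` range code \<union> range Inr)" for U
  proof (induction U)
    case (Cons s U)
    then show ?case by (cases s) (auto simp: c_def)
  qed (simp add: c_def)
  then have "[(c U, c V)] \<in> systems_over (range code)"
    by (simp add: systems_over_def)
  moreover have "subst \<sigma> U = subst \<sigma> V \<longleftrightarrow> (\<exists>\<theta>. (\<forall>x. \<theta> x \<in> lists (range code)) \<and>
      (\<forall>i. \<theta> (2 * i) = emb (\<sigma> i)) \<and> sat \<theta> [(c U, c V)])" for \<sigma>
  proof
    assume "subst \<sigma> U = subst \<sigma> V"
    then show "\<exists>\<theta>. (\<forall>x. \<theta> x \<in> lists (range code)) \<and> (\<forall>i. \<theta> (2 * i) = emb (\<sigma> i)) \<and> sat \<theta> [(c U, c V)]"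
      by (intro exI[of _ "\<lambda>n. emb (\<sigma> (n div 2))"]) (simp add: c[of _ \<sigma>])
  next
    assume "\<exists>\<theta>. (\<forall>x. \<theta> x \<in> lists (range code)) \<and> (\<forall>i. \<theta> (2 * i) = emb (\<sigma> i)) \<and> sat \<theta> [(c U, c V)]"
    then show "subst \<sigma> U = subst \<sigma> V" by (auto simp: c[of _ \<sigma>])
  qed
  ultimately show ?thesis by (rule dioI)
qed

section \<open>Closure under conjunction, renaming and existential quantification\<close>

lemma ren_systems_over: "E \<in> systems_over A \<Longrightarrow> ren r E \<in> systems_over A"
  by (fastforce simp: systems_over_def ren_def)

lemma systems_over_append: "E \<in> systems_over A \<Longrightarrow> F \<in> systems_over A \<Longrightarrow> E @ F \<in> systems_over A"
  by (simp add: systems_over_def)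

lemma dio_conj:
  assumes "dio P" "dio Q"
  shows "dio (\<lambda>\<sigma>. P \<sigma> \<and> Q \<sigma>)"
proof -
  from assms(1) obtain E where E: "E \<in> systems_over (range code)" and dP: "defined_by P E"
    by (rule dioE)
  note P = defined_byD[OF dP]
  from assms(2) obtain F where F: "F \<in> systems_over (range code)" and dQ: "defined_by Q F"
    by (rule dioE)
  note Q = defined_byD[OF dQ]
  \<comment> \<open>The arguments are shared; the auxiliary variables of \<open>E\<close> and
    \<open>F\<close> are kept apart by sending them to the residues 1 and 3 modulo 4.\<close>
  define r s where "r = (\<lambda>n::nat. if even n then n else 4 * (n div 2) + 1)"
    and "s = (\<lambda>n::nat. if even n then n else 4 * (n div 2) + 3)"
  have "P \<sigma> \<and> Q \<sigma> \<longleftrightarrow> (\<exists>\<theta>. (\<forall>x. \<theta> x \<in> lists (range code)) \<and> (\<forall>i. \<theta> (2 * i) = emb (\<sigma> i)) \<and>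
      sat \<theta> (ren r E @ ren s F))" for \<sigma>
  proof
    assume "P \<sigma> \<and> Q \<sigma>"
    then obtain \<theta> \<eta> where \<theta>: "\<And>x. \<theta> x \<in> lists (range code)" "\<And>i. \<theta> (2 * i) = emb (\<sigma> i)" "sat \<theta> E"
      and \<eta>: "\<And>x. \<eta> x \<in> lists (range code)" "\<And>i. \<eta> (2 * i) = emb (\<sigma> i)" "sat \<eta> F"
      unfolding P Q by blast
    define \<zeta> where "\<zeta> = (\<lambda>n. if even n then emb (\<sigma> (n div 2)) else if n mod 4 = 1 then \<theta> (2 * (n div 4) + 1)
      else \<eta> (2 * (n div 4) + 1))"
    have z: "\<zeta> (4 * k + 1) = \<theta> (2 * k + 1)" "\<zeta> (4 * k + 3) = \<eta> (2 * k + 1)" "\<zeta> (2 * k) = emb (\<sigma> k)" for k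
    proof -
      have "(4 * k + 1) mod 4 = 1" "(4 * k + 1) div 4 = k" "(4 * k + 3) mod 4 \<noteq> 1" "(4 * k + 3) div 4 = k"
        by presburger+
      then show "\<zeta> (4 * k + 1) = \<theta> (2 * k + 1)" "\<zeta> (4 * k + 3) = \<eta> (2 * k + 1)" "\<zeta> (2 * k) = emb (\<sigma> k)"
        by (simp_all add: \<zeta>_def)
    qed
    have "\<zeta> (r n) = \<theta> n" "\<zeta> (s n) = \<eta> n" for n
    proof -
      show "\<zeta> (r n) = \<theta> n"
      proof (cases "even n")
        case True
        then obtain k where "n = 2 * k" by blast
        then show ?thesis using z(3) \<theta>(2) by (simp add: r_def)
      next
        case False
        then obtain k where "n = 2 * k + 1" by (blast elim: oddE)
        then show ?thesis using z(1)[of k] by (simp add: r_def)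
      qed
      show "\<zeta> (s n) = \<eta> n"
      proof (cases "even n")
        case True
        then obtain k where "n = 2 * k" by blast
        then show ?thesis using z(3) \<eta>(2) by (simp add: s_def)
      next
        case False
        then obtain k where "n = 2 * k + 1" by (blast elim: oddE)
        then show ?thesis using z(2)[of k] by (simp add: s_def)
      qed
    qed
    then have "\<zeta> \<circ> r = \<theta>" "\<zeta> \<circ> s = \<eta>" by auto
    moreover have "\<zeta> x \<in> lists (range code)" for x
      using \<theta>(1) \<eta>(1) by (auto simp: \<zeta>_def)
    ultimately show "\<exists>\<theta>. (\<forall>x. \<theta> x \<in> lists (range code)) \<and> (\<forall>i. \<theta> (2 * i) = emb (\<sigma> i)) \<and>
      sat \<theta> (ren r E @ ren s F)"
      using \<theta>(3) \<eta>(3) z(3) by (intro exI[of _ \<zeta>]) auto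
  next
    assume "\<exists>\<theta>. (\<forall>x. \<theta> x \<in> lists (range code)) \<and> (\<forall>i. \<theta> (2 * i) = emb (\<sigma> i)) \<and>
      sat \<theta> (ren r E @ ren s F)"
    then obtain \<theta> where \<theta>: "\<And>x. \<theta> x \<in> lists (range code)" "\<And>i. \<theta> (2 * i) = emb (\<sigma> i)"
      "sat (\<theta> \<circ> r) E" "sat (\<theta> \<circ> s) F" by auto
    have "(\<theta> \<circ> r) (2 * i) = emb (\<sigma> i)" "(\<theta> \<circ> s) (2 * i) = emb (\<sigma> i)" for i
      using \<theta>(2) by (simp_all add: r_def s_def)
    then show "P \<sigma> \<and> Q \<sigma>"
      unfolding P Q using \<theta>(1,3,4) by (metis comp_apply)
  qed
  then show ?thesis using E F by (intro dioI[of "ren r E @ ren s F"] systems_over_append ren_systems_over)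
qed

lemma dio_rename:
  assumes "dio P"
  shows "dio (\<lambda>\<sigma>. P (\<lambda>i. \<sigma> (f i)))"
proof -
  from assms obtain E where E: "E \<in> systems_over (range code)" and dP: "defined_by P E"
    by (rule dioE)
  note P = defined_byD[OF dP]
  define r where "r = (\<lambda>n::nat. if even n then 2 * f (n div 2) else n)"
  have "P (\<lambda>i. \<sigma> (f i)) \<longleftrightarrow> (\<exists>\<theta>. (\<forall>x. \<theta> x \<in> lists (range code)) \<and> (\<forall>i. \<theta> (2 * i) = emb (\<sigma> i)) \<and>
      sat \<theta> (ren r E))" for \<sigma>
  proof
    assume "P (\<lambda>i. \<sigma> (f i))"
    then obtain \<theta> where \<theta>: "\<And>x. \<theta> x \<in> lists (range code)" "\<And>i. \<theta> (2 * i) = emb (\<sigma> (f i))" "sat \<theta> E"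
      unfolding P by blast
    define \<zeta> where "\<zeta> = (\<lambda>n. if even n then emb (\<sigma> (n div 2)) else \<theta> n)"
    have "\<zeta> \<circ> r = \<theta>"
    proof
      fix n
      show "(\<zeta> \<circ> r) n = \<theta> n"
        using \<theta>(2)[of "n div 2"] by (cases "even n") (simp_all add: \<zeta>_def r_def)
    qed
    then show "\<exists>\<theta>. (\<forall>x. \<theta> x \<in> lists (range code)) \<and> (\<forall>i. \<theta> (2 * i) = emb (\<sigma> i)) \<and> sat \<theta> (ren r E)"
      using \<theta>(1,3) by (intro exI[of _ \<zeta>]) (auto simp: \<zeta>_def)
  next
    assume "\<exists>\<theta>. (\<forall>x. \<theta> x \<in> lists (range code)) \<and> (\<forall>i. \<theta> (2 * i) = emb (\<sigma> i)) \<and> sat \<theta> (ren r E)"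
    then obtain \<theta> where \<theta>: "\<And>x. \<theta> x \<in> lists (range code)" "\<And>i. \<theta> (2 * i) = emb (\<sigma> i)"
      "sat (\<theta> \<circ> r) E" by auto
    have "(\<theta> \<circ> r) (2 * i) = emb (\<sigma> (f i))" for i
      using \<theta>(2) by (simp add: r_def)
    then show "P (\<lambda>i. \<sigma> (f i))"
      unfolding P using \<theta>(1,3) by (intro exI[of _ "\<theta> \<circ> r"]) auto
  qed
  then show ?thesis using E by (intro dioI[of "ren r E"] ren_systems_over)
qed

text \<open>The bound word is argument 0, as with de Bruijn indices. An auxiliary variable ranges
  over the whole monoid, so it is cancelled against a power of \<open>LoS\<close> to make it a word
  over \<open>letter\<close>.\<close>

lemma dio_ex:
  assumes "dio (\<lambda>\<sigma>. P (\<sigma> 0) (\<lambda>n. \<sigma> (Suc n)))"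
  shows "dio (\<lambda>\<sigma>. \<exists>x. P x \<sigma>)"
proof -
  from assms obtain E where E: "E \<in> systems_over (range code)" and dP: "defined_by (\<lambda>\<sigma>. P (\<sigma> 0) (\<lambda>n. \<sigma> (Suc n))) E"
    by (rule dioE)
  note P = defined_byD[OF dP]
  \<comment> \<open>Argument 0 becomes variable 1, and the other arguments move down by one.
    Variable 3 is reserved for the power of \<open>LoS\<close>, so old auxiliary variables move up
    by 4.\<close>
  define r where "r = (\<lambda>n::nat. if n = 0 then 1 else if even n then n - 2 else n + 4)"
  define F where "F = ren r E @
    [([Inr 3, Inr 1], []), ([Inr 3, Inl (code LoS)], [Inl (code LoS), Inr 3])]"
  have "F \<in> systems_over (range code)"
    unfolding F_def using E by (intro systems_over_append ren_systems_over) (auto simp: systems_over_def)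
  moreover have "(\<exists>x. P x \<sigma>) \<longleftrightarrow> (\<exists>\<theta>. (\<forall>x. \<theta> x \<in> lists (range code)) \<and> (\<forall>i. \<theta> (2 * i) = emb (\<sigma> i)) \<and>
      sat \<theta> F)" for \<sigma>
  proof
    assume "\<exists>x. P x \<sigma>"
    then obtain x where "P x \<sigma>" by blast
    then obtain \<theta> where \<theta>: "\<And>y. \<theta> y \<in> lists (range code)" "\<And>i. \<theta> (2 * i) = emb (case_nat x \<sigma> i)" "sat \<theta> E"
      using P[of "case_nat x \<sigma>"] by auto
    define S where "S = replicate (length (emb x)) (code LoS)"
    have S: "nf (S @ emb x) = []"
      unfolding S_def by (rule nf_replicate_cancel) (auto simp: emb_def)
    have S': "S @ [code LoS] = code LoS # S"
      unfolding S_def by (rule replicate_commutes)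
    define \<zeta> where "\<zeta> = (\<lambda>n. if even n then emb (\<sigma> (n div 2)) else if n = 1 then emb x
      else if n = 3 then S else \<theta> (n - 4))"
    have "\<zeta> \<circ> r = \<theta>"
    proof
      fix n
      consider "n = 0" | k where "n = 2 * Suc k" | "odd n"
        by (metis evenE not0_implies_Suc mult_0_right)
      then show "(\<zeta> \<circ> r) n = \<theta> n"
      proof cases
        case 1
        then show ?thesis using \<theta>(2)[of 0] by (simp add: \<zeta>_def r_def)
      next
        case 2
        then show ?thesis using \<theta>(2)[of "Suc k"] by (simp add: \<zeta>_def r_def)
      next
        case 3
        then have "n \<noteq> 0" by (cases n) auto
        with 3 show ?thesis by (simp add: \<zeta>_def r_def)
      qed
    qed
    moreover have "\<zeta> y \<in> lists (range code)" for y
      using \<theta>(1) by (auto simp: \<zeta>_def S_def)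
    moreover have "\<zeta> 1 = emb x" "\<zeta> 3 = S" "\<And>k. \<zeta> (2 * k) = emb (\<sigma> k)"
      by (simp_all add: \<zeta>_def)
    ultimately show "\<exists>\<theta>. (\<forall>x. \<theta> x \<in> lists (range code)) \<and> (\<forall>i. \<theta> (2 * i) = emb (\<sigma> i)) \<and> sat \<theta> F"
      using \<theta>(3) S S' by (intro exI[of _ \<zeta>]) (simp add: F_def)
  next
    assume "\<exists>\<theta>. (\<forall>x. \<theta> x \<in> lists (range code)) \<and> (\<forall>i. \<theta> (2 * i) = emb (\<sigma> i)) \<and> sat \<theta> F"
    then obtain \<theta> where \<theta>: "\<And>x. \<theta> x \<in> lists (range code)" "\<And>i. \<theta> (2 * i) = emb (\<sigma> i)"
      "sat (\<theta> \<circ> r) E" and c: "nf (\<theta> 3 @ \<theta> 1) = []" "nf (\<theta> 3 @ [code LoS]) = nf (code LoS # \<theta> 3)"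
      unfolding F_def by auto
    obtain x where x: "nf (\<theta> 1) = emb x" using LoS_word[OF c] by blast
    \<comment> \<open>\<open>\<theta> 1\<close> equals \<open>emb x\<close> only in the monoid,
      while \<open>defined_by\<close> asks for equal words; hence the normal forms.\<close>
    define \<zeta> where "\<zeta> = (\<lambda>n. nf (\<theta> (r n)))"
    have "\<zeta> (2 * i) = emb (case_nat x \<sigma> i)" for i
    proof (cases i)
      case 0
      then show ?thesis using x by (simp add: \<zeta>_def r_def)
    next
      case (Suc k)
      then show ?thesis using \<theta>(2)[of k] by (simp add: \<zeta>_def r_def)
    qed
    moreover have "sat \<zeta> E"
      using \<theta>(3) sat_cong[of \<zeta> "\<theta> \<circ> r" E] by (simp add: \<zeta>_def)
    moreover have "\<zeta> y \<in> lists (range code)" for y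
      unfolding \<zeta>_def using \<theta>(1) by (rule nf_in_lists)
    ultimately have "P x \<sigma>"
      using P[of "case_nat x \<sigma>"] by auto
    then show "\<exists>x. P x \<sigma>" by blast
  qed
  ultimately show ?thesis by (rule dioI)
qed

lemma dio_True: "dio (\<lambda>\<sigma>. True)"
  using dio_eq[of "[]" "[]"] by simp

lemma dio_All_less:
  fixes k :: nat
  assumes "\<And>t. t < k \<Longrightarrow> dio (P t)"
  shows "dio (\<lambda>\<sigma>. \<forall>t<k. P t \<sigma>)"
  using assms
proof (induction k)
  case (Suc k)
  then have "dio (\<lambda>\<sigma>. (\<forall>t<k. P t \<sigma>) \<and> P k \<sigma>)" by (intro dio_conj) auto
  moreover have "(\<forall>t<Suc k. P t \<sigma>) \<longleftrightarrow> (\<forall>t<k. P t \<sigma>) \<and> P k \<sigma>" for \<sigma>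
    by (auto simp: less_Suc_eq)
  ultimately show ?case by simp
qed (simp add: dio_True)

lemma dio_ex_list:
  assumes "dio (\<lambda>\<sigma>. P (map \<sigma> [0..<k]) (\<lambda>n. \<sigma> (n + k)))"
  shows "dio (\<lambda>\<sigma>. \<exists>xs. length xs = k \<and> P xs \<sigma>)"
  using assms
proof (induction k arbitrary: P)
  case 0
  then show ?case by simp
next
  case (Suc k)
  have "dio (\<lambda>\<sigma>. \<exists>xs. length xs = k \<and> P (xs @ [\<sigma> 0]) (\<lambda>n. \<sigma> (Suc n)))"
    by (rule Suc.IH) (use Suc.prems in simp)
  then have "dio (\<lambda>\<sigma>. \<exists>x xs. length xs = k \<and> P (xs @ [x]) \<sigma>)"
    by (rule dio_ex)
  moreover have "(\<exists>x xs. length xs = k \<and> P (xs @ [x]) \<sigma>) \<longleftrightarrow> (\<exists>xs. length xs = Suc k \<and> P xs \<sigma>)" for \<sigma>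
    by (metis length_Suc_conv_rev)
  ultimately show ?case by simp
qed

section \<open>Erasing letters\<close>

lemma dio_subset: "dio (\<lambda>\<sigma>. set (\<sigma> i) \<subseteq> S)"
proof -
  have "set x \<subseteq> S \<longleftrightarrow> list_all2 (\<lambda>a b. (a, b) \<in> Id_on S) x x" for x :: "letter list"
    by (auto simp: list_all2_conv_all_nth set_conv_nth)
  then show ?thesis using dio_all2[of "Id_on S" i i] by simp
qed

lemma list_all2_graph: "list_all2 (\<lambda>a b. (a, b) \<in> range (\<lambda>a. (a, f a))) x y \<longleftrightarrow> y = map f x"
proof -
  have "(a, b) \<in> range (\<lambda>a. (a, f a)) \<longleftrightarrow> b = f a" for a b by auto
  then show ?thesis
    by (auto simp: list_all2_conv_all_nth intro: nth_equalityI)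
qed

lemma dio_map: "dio (\<lambda>\<sigma>. \<sigma> j = map f (\<sigma> i))"
  using dio_all2[of "range (\<lambda>a. (a, f a))" i j] unfolding list_all2_graph .

text \<open>Comparing a word with its shift by one position relates neighbouring letters, with
  \<open>Mark\<close> as the boundary at both ends. So any condition on neighbours is
  Diophantine.\<close>

lemma dio_local:
  "dio (\<lambda>\<sigma>. list_all2 (\<lambda>a b. (a, b) \<in> r) (Mark # \<sigma> i) (\<sigma> i @ [Mark]))"
proof -
  have "dio (\<lambda>\<sigma>. \<exists>u v. u = Mark # \<sigma> i \<and> v = \<sigma> i @ [Mark] \<and> list_all2 (\<lambda>a b. (a, b) \<in> r) u v)"
  proof (intro dio_ex dio_conj dio_all2)
    show "dio (\<lambda>\<sigma>. \<sigma> (Suc 0) = Mark # \<sigma> (Suc (Suc i)))"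
      using dio_eq[of "[Inr (Suc 0)]" "[Inl Mark, Inr (Suc (Suc i))]"] by (simp add: subst_def)
    show "dio (\<lambda>\<sigma>. \<sigma> 0 = \<sigma> (Suc (Suc i)) @ [Mark])"
      using dio_eq[of "[Inr 0]" "[Inr (Suc (Suc i)), Inl Mark]"] by (simp add: subst_def)
  qed
  then show ?thesis by simp
qed

text \<open>A parallel step: any choice of disjoint factors \<open>Pad\<close>, \<open>Sym\<close>
  is exchanged at once, possibly none. It can therefore be applied to each block of a concatenation,
  and it leaves every \<open>Mark\<close> in place.\<close>

inductive swp :: "letter list \<Rightarrow> letter list \<Rightarrow> bool" where
  swp_Nil: "swp [] []"
| swp_Pad: "swp u v \<Longrightarrow> swp (Pad # u) (Pad # v)"
| swp_Mark: "swp u v \<Longrightarrow> swp (Mark # u) (Mark # v)"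
| swp_Sym: "swp u v \<Longrightarrow> swp (Sym d e # u) (Sym d e # v)"
| swp_swap: "swp u v \<Longrightarrow> swp (Pad # Sym d e # u) (Sym d e # Pad # v)"

fun swp_src :: "letter \<Rightarrow> letter" where
  "swp_src (Swap1 d e) = Pad"
| "swp_src (Swap2 d e) = Sym d e"
| "swp_src l = l"

fun swp_tgt :: "letter \<Rightarrow> letter" where
  "swp_tgt (Swap1 d e) = Sym d e"
| "swp_tgt (Swap2 d e) = Pad"
| "swp_tgt l = l"

text \<open>A single word carries source and target of a step. The condition on neighbours makes
  \<open>Swap1 d e\<close> and \<open>Swap2 d e\<close> occur only as adjacent pairs in this
  order.\<close>

fun swp_next :: "letter \<Rightarrow> letter \<Rightarrow> bool" where
  "swp_next (Swap1 d e) l \<longleftrightarrow> l = Swap2 d e"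
| "swp_next _ (Swap2 d e) \<longleftrightarrow> False"
| "swp_next _ _ \<longleftrightarrow> True"

abbreviation chain :: "(letter \<Rightarrow> letter \<Rightarrow> bool) \<Rightarrow> letter \<Rightarrow> letter list \<Rightarrow> bool" where
  "chain r c w \<equiv> list_all2 r (c # w) (w @ [Mark])"

lemma dio_chain: "dio (\<lambda>\<sigma>. chain r Mark (\<sigma> i))"
  using dio_local[of "{(a, b). r a b}" i] by simp

lemma swp_chain_imp:
  "chain swp_next c z \<Longrightarrow> (\<forall>d e. c \<noteq> Swap1 d e) \<Longrightarrow> swp (map swp_src z) (map swp_tgt z)"
proof (induction "length z" arbitrary: c z rule: less_induct)
  case less
  show ?case
  proof (cases z)
    case Nil
    then show ?thesis by (simp add: swp_Nil)
  next
    case (Cons x y)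
    with less.prems(1) have x: "swp_next c x" "chain swp_next x y" by auto
    show ?thesis
    proof (cases x)
      case (Swap1 d e)
      with x(2) obtain y' where y: "y = Swap2 d e # y'" by (cases y) auto
      then have "chain swp_next (Swap2 d e) y'" using x(2) by simp
      then have "swp (map swp_src y') (map swp_tgt y')"
        using less.hyps[of y'] Cons y by simp
      then show ?thesis using Cons Swap1 y by (simp add: swp_swap)
    next
      case (Swap2 d e)
      then show ?thesis using x(1) less.prems(2) by (cases c) auto
    qed (use less.hyps[of y x] x Cons in \<open>auto intro: swp.intros\<close>)
  qed
qed

text \<open>The chain has to hold after every admissible left neighbour \<open>c\<close>, so that
  the induction can put any letter in front.\<close>

lemma swp_imp_chain:
  "swp u v \<Longrightarrow> \<exists>z. (\<forall>c. (\<forall>d e. c \<noteq> Swap1 d e) \<longrightarrow> chain swp_next c z) \<and> u = map swp_src z \<and> v = map swp_tgt z"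
proof (induction rule: swp.induct)
  case swp_Nil
  show ?case
  proof (intro exI[of _ "[]"] conjI allI impI)
    fix c assume "\<forall>d e. c \<noteq> Swap1 d e"
    then show "chain swp_next c []" by (cases c) auto
  qed simp_all
next
  case (swp_Pad u v)
  then obtain z where z: "\<forall>c. (\<forall>d e. c \<noteq> Swap1 d e) \<longrightarrow> chain swp_next c z"
    "u = map swp_src z" "v = map swp_tgt z" by blast
  have "chain swp_next c (Pad # z)" if "\<forall>d e. c \<noteq> Swap1 d e" for c
    using z(1)[rule_format, of Pad] that by (cases c) auto
  with z show ?case by (intro exI[of _ "Pad # z"]) auto
next
  case (swp_Mark u v)
  then obtain z where z: "\<forall>c. (\<forall>d e. c \<noteq> Swap1 d e) \<longrightarrow> chain swp_next c z"
    "u = map swp_src z" "v = map swp_tgt z" by blast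
  have "chain swp_next c (Mark # z)" if "\<forall>d e. c \<noteq> Swap1 d e" for c
    using z(1)[rule_format, of Mark] that by (cases c) auto
  with z show ?case by (intro exI[of _ "Mark # z"]) auto
next
  case (swp_Sym u v d e)
  then obtain z where z: "\<forall>c. (\<forall>d e. c \<noteq> Swap1 d e) \<longrightarrow> chain swp_next c z"
    "u = map swp_src z" "v = map swp_tgt z" by blast
  have "chain swp_next c (Sym d e # z)" if "\<forall>d e. c \<noteq> Swap1 d e" for c
    using z(1)[rule_format, of "Sym d e"] that by (cases c) auto
  with z show ?case by (intro exI[of _ "Sym d e # z"]) auto
next
  case (swp_swap u v d e)
  then obtain z where z: "\<forall>c. (\<forall>d e. c \<noteq> Swap1 d e) \<longrightarrow> chain swp_next c z"
    "u = map swp_src z" "v = map swp_tgt z" by blast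
  have "chain swp_next c (Swap1 d e # Swap2 d e # z)" if "\<forall>d e. c \<noteq> Swap1 d e" for c
    using z(1)[rule_format, of "Swap2 d e"] that by (cases c) auto
  with z show ?case by (intro exI[of _ "Swap1 d e # Swap2 d e # z"]) auto
qed

lemma swp_iff: "swp u v \<longleftrightarrow> (\<exists>z. chain swp_next Mark z \<and> u = map swp_src z \<and> v = map swp_tgt z)"
  using swp_imp_chain[of u v] swp_chain_imp[of Mark] by fastforce

lemma dio_swp: "dio (\<lambda>\<sigma>. swp (\<sigma> i) (\<sigma> j))"
  unfolding swp_iff by (intro dio_ex dio_conj dio_chain dio_map)

section \<open>Erasing pads by a sequence of swaps\<close>

abbreviation unpad :: "letter list \<Rightarrow> letter list" where
  "unpad \<equiv> filter (\<lambda>l. l \<noteq> Pad)"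

lemma swp_unpad: "swp u v \<Longrightarrow> unpad u = unpad v"
  by (induction rule: swp.induct) auto

lemma swp_append: "swp u v \<Longrightarrow> swp u' v' \<Longrightarrow> swp (u @ u') (v @ v')"
  by (induction rule: swp.induct) (auto intro: swp.intros)

text \<open>\<open>u = (Mark x\<^sub>0) (Mark x\<^sub>1) \<dots>\<close> lists the words before the steps of a rewriting sequence from \<open>x\<close>
  to \<open>z\<close>, and \<open>v = (Mark x\<^sub>1) (Mark x\<^sub>2) \<dots>\<close> those after the steps; the equation says that each step
  starts where the previous one ended.\<close>

definition reach :: "letter list \<Rightarrow> letter list \<Rightarrow> bool" where
  "reach x z \<longleftrightarrow> (\<exists>u v. u @ [Mark] @ z = [Mark] @ x @ v \<and> swp u v)"

lemma reach_refl: "reach x x"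
  unfolding reach_def by (intro exI[of _ "[]"]) (simp add: swp_Nil)

lemma reach_step:
  assumes "reach x z" "swp z z'"
  shows "reach x z'"
proof -
  obtain u v where uv: "u @ [Mark] @ z = [Mark] @ x @ v" "swp u v"
    using assms(1) by (auto simp: reach_def)
  have "swp (u @ Mark # z) (v @ Mark # z')"
    using swp_append[OF uv(2) swp_Mark[OF assms(2)]] .
  moreover have "(u @ Mark # z) @ [Mark] @ z' = [Mark] @ x @ (v @ Mark # z')"
    using uv(1) by simp
  ultimately show ?thesis unfolding reach_def by blast
qed

lemma reach_swp_rtranclp: "swp\<^sup>*\<^sup>* x z \<Longrightarrow> reach x z"
  by (induction rule: rtranclp_induct) (auto intro: reach_refl reach_step)

text \<open>A nonempty \<open>u\<close> begins with \<open>Mark\<close> and, as \<open>x\<close>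
  contains no \<open>Mark\<close>, even with \<open>Mark # x\<close>. Removing this prefix leaves a
  shorter solution of the same equation.\<close>

lemma conjugate_single_Mark:
  "u @ Mark # y = Mark # x @ u \<Longrightarrow> Mark \<notin> set x \<Longrightarrow> Mark \<notin> set y \<Longrightarrow> x = y"
proof (induction "length u" arbitrary: u rule: less_induct)
  case less
  show ?case
  proof (cases u)
    case Nil
    then show ?thesis using less.prems by simp
  next
    case (Cons c u1)
    with less.prems(1) have c: "c = Mark" and e: "u1 @ Mark # y = x @ Mark # u1" by auto
    from e consider z where "u1 = x @ z" "z @ Mark # y = Mark # u1"
      | z where "x = u1 @ z" "Mark # y = z @ Mark # u1"
      by (auto simp: append_eq_append_conv2)
    then show ?thesis
    proof cases
      case 1
      show ?thesis
      proof (cases z)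
        case Nil
        then show ?thesis using 1 by simp
      next
        case (Cons d z1)
        then have "z @ Mark # y = Mark # x @ z" using 1 by simp
        then show ?thesis
          using less.hyps[of z] less.prems 1 \<open>u = c # u1\<close> by simp
      qed
    next
      case 2
      then have "z = []" using less.prems(2) by (cases z) auto
      then show ?thesis using 2 by simp
    qed
  qed
qed

text \<open>Instead of recovering a rewriting sequence, erase all \<open>Pad\<close>s: this makes
  \<open>u\<close> and \<open>v\<close> equal and turns the equation into that of
  \<open>conjugate_single_Mark\<close>. So spurious solutions do no harm.\<close>

lemma reach_imp:
  assumes "reach x (y @ n)" "Mark \<notin> set x" "Mark \<notin> set y" "Pad \<notin> set y" "set n \<subseteq> {Pad}"
  shows "y = unpad x"
proof -
  obtain u v where uv: "u @ [Mark] @ y @ n = [Mark] @ x @ v" "swp u v"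
    using assms(1) by (auto simp: reach_def)
  have "unpad (u @ [Mark] @ y @ n) = unpad ([Mark] @ x @ v)"
    by (simp only: uv(1))
  moreover have "unpad n = []" "unpad y = y"
    using assms(4,5) by (auto simp: filter_empty_conv filter_id_conv)
  ultimately have "unpad u @ Mark # y = Mark # unpad x @ unpad u"
    using swp_unpad[OF uv(2)] by simp
  from conjugate_single_Mark[OF this] assms(2,3) show ?thesis by simp
qed

lemma swp_refl: "set w \<subseteq> insert Pad (range (case_prod Sym)) \<Longrightarrow> swp w w"
  by (induction w) (auto intro: swp.intros)

lemma swp_rtranclp_Cons:
  "swp\<^sup>*\<^sup>* u v \<Longrightarrow> l \<in> insert Pad (range (case_prod Sym)) \<Longrightarrow> swp\<^sup>*\<^sup>* (l # u) (l # v)"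
proof (induction rule: rtranclp_induct)
  case (step v w)
  then have "swp (l # v) (l # w)" by (auto intro: swp.intros)
  with step show ?case by (auto intro: rtranclp.rtrancl_into_rtrancl)
qed simp

lemma move_Pad:
  "set w \<subseteq> range (case_prod Sym) \<Longrightarrow> swp\<^sup>*\<^sup>* (Pad # w @ replicate k Pad) (w @ Pad # replicate k Pad)"
proof (induction w)
  case (Cons s w)
  then obtain d e where s: "s = Sym d e" by auto
  have "swp (w @ replicate k Pad) (w @ replicate k Pad)"
    using Cons.prems by (intro swp_refl) auto
  then have "swp (Pad # s # w @ replicate k Pad) (s # Pad # w @ replicate k Pad)"
    unfolding s by (rule swp_swap)
  moreover have "swp\<^sup>*\<^sup>* (s # Pad # w @ replicate k Pad) (s # w @ Pad # replicate k Pad)"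
    using Cons by (intro swp_rtranclp_Cons) auto
  ultimately show ?case by (simp add: converse_rtranclp_into_rtranclp)
qed simp

text \<open>The \<open>Pad\<close>s are collected at the right end, the last one first; a leading
  \<open>Pad\<close> then has only \<open>Sym\<close>s to pass before it joins them.\<close>

lemma unpad_reachable:
  "set x \<subseteq> insert Pad (range (case_prod Sym)) \<Longrightarrow> \<exists>k. swp\<^sup>*\<^sup>* x (unpad x @ replicate k Pad)"
proof (induction x)
  case Nil
  show ?case by (intro exI[of _ 0]) simp
next
  case (Cons l x)
  then obtain k where k: "swp\<^sup>*\<^sup>* x (unpad x @ replicate k Pad)" by auto
  have l: "swp\<^sup>*\<^sup>* (l # x) (l # unpad x @ replicate k Pad)"
    using Cons.prems by (intro swp_rtranclp_Cons k) auto
  show ?case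
  proof (cases "l = Pad")
    case True
    have "set (unpad x) \<subseteq> range (case_prod Sym)" using Cons.prems by auto
    from rtranclp_trans[OF l[unfolded True] move_Pad[OF this]] show ?thesis
      using True by (intro exI[of _ "Suc k"]) simp
  next
    case False
    then show ?thesis using l by (intro exI[of _ k]) simp
  qed
qed

lemma unpad_iff:
  assumes "set x \<subseteq> insert Pad (range (case_prod Sym))"
  shows "y = unpad x \<longleftrightarrow> set y \<subseteq> range (case_prod Sym) \<and>
    (\<exists>n u v. set n \<subseteq> {Pad} \<and> u @ [Mark] @ y @ n = [Mark] @ x @ v \<and> swp u v)"
proof
  assume y: "y = unpad x"
  obtain k where "reach x (y @ replicate k Pad)"
    using unpad_reachable[OF assms] reach_swp_rtranclp y by blast
  moreover have "set y \<subseteq> range (case_prod Sym)" using assms y by auto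
  moreover have "set (replicate k Pad) \<subseteq> {Pad}" by auto
  ultimately show "set y \<subseteq> range (case_prod Sym) \<and>
    (\<exists>n u v. set n \<subseteq> {Pad} \<and> u @ [Mark] @ y @ n = [Mark] @ x @ v \<and> swp u v)"
    unfolding reach_def append_assoc by blast
next
  assume "set y \<subseteq> range (case_prod Sym) \<and>
    (\<exists>n u v. set n \<subseteq> {Pad} \<and> u @ [Mark] @ y @ n = [Mark] @ x @ v \<and> swp u v)"
  then obtain n where "set y \<subseteq> range (case_prod Sym)" "set n \<subseteq> {Pad}" "reach x (y @ n)"
    unfolding reach_def append_assoc by blast
  then show "y = unpad x" using assms by (intro reach_imp[of x y n]) auto
qed

definition filter_map :: "(letter \<Rightarrow> bool) \<Rightarrow> (letter \<Rightarrow> letter) \<Rightarrow> letter list \<Rightarrow> letter list \<Rightarrow> bool" where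
  "filter_map Q f x y \<longleftrightarrow> set x \<subseteq> range (case_prod Sym) \<and> y = map f (filter Q x)"

text \<open>Letters to be dropped are first turned into \<open>Pad\<close>s, which keeps the length,
  and then erased. The assumption on \<open>f\<close> ensures that no letter to be kept becomes a
  \<open>Pad\<close>.\<close>

lemma dio_filter_map:
  assumes f: "\<And>d e. f (Sym d e) \<in> range (case_prod Sym)"
  shows "dio (\<lambda>\<sigma>. filter_map Q f (\<sigma> i) (\<sigma> j))"
proof -
  define g where "g = (\<lambda>l. if Q l then f l else Pad)"
  have g: "y = map f (filter Q x) \<longleftrightarrow> (\<exists>x'. x' = map g x \<and> set y \<subseteq> range (case_prod Sym) \<and>
    (\<exists>n u v. set n \<subseteq> {Pad} \<and> u @ [Mark] @ y @ n = [Mark] @ x' @ v \<and> swp u v))"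
    if "set x \<subseteq> range (case_prod Sym)" for x y
  proof -
    have fs: "f l \<noteq> Pad \<and> f l \<in> range (case_prod Sym)" if "l \<in> range (case_prod Sym)" for l
    proof -
      from that obtain d e where "l = Sym d e" by auto
      then show ?thesis using f[of d e] by auto
    qed
    have "unpad (map g x) = map f (filter Q x)"
      using that fs by (induction x) (auto simp: g_def)
    moreover have "set (map g x) \<subseteq> insert Pad (range (case_prod Sym))"
      using that fs by (auto simp: g_def)
    ultimately show ?thesis using unpad_iff[of "map g x" y] by simp
  qed
  have "dio (\<lambda>\<sigma>. set (\<sigma> i) \<subseteq> range (case_prod Sym) \<and>
    (\<exists>x'. x' = map g (\<sigma> i) \<and> set (\<sigma> j) \<subseteq> range (case_prod Sym) \<and>
    (\<exists>n u v. set n \<subseteq> {Pad} \<and> u @ [Mark] @ \<sigma> j @ n = [Mark] @ x' @ v \<and> swp u v)))"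
  proof (intro dio_ex dio_conj dio_subset dio_map dio_swp)
    have "dio (\<lambda>\<sigma>. subst \<sigma> [Inr 1, Inl Mark, Inr (j + 4), Inr 2] = subst \<sigma> [Inl Mark, Inr 3, Inr 0])"
      by (rule dio_eq)
    then show "dio (\<lambda>\<sigma>. \<sigma> (Suc 0) @ [Mark] @ \<sigma> (Suc (Suc (Suc (Suc j)))) @ \<sigma> (Suc (Suc 0)) =
        [Mark] @ \<sigma> (Suc (Suc (Suc 0))) @ \<sigma> 0)"
      by (simp add: subst_def eval_nat_numeral)
  qed
  then show ?thesis
    unfolding filter_map_def using g by (simp cong: conj_cong)
qed

section \<open>Batches of numbers\<close>

text \<open>The end letter makes concatenations uniquely decodable. The flag is repeated on every
  letter, so that a letterwise filter selects whole entries.\<close>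

definition ent :: "bool \<times> nat \<Rightarrow> letter list" where
  "ent = (\<lambda>(d, n). replicate n (Sym d False) @ [Sym d True])"

definition enc :: "(bool \<times> nat) list \<Rightarrow> letter list" where
  "enc es = concat (map ent es)"

definition bat :: "nat list \<Rightarrow> letter list" where
  "bat xs = enc (map (Pair False) xs)"

fun undot :: "letter \<Rightarrow> letter" where
  "undot (Sym d e) = Sym False e" | "undot l = l"

fun dotted :: "letter \<Rightarrow> bool" where
  "dotted (Sym d e) = d" | "dotted l = False"

fun is_end :: "letter \<Rightarrow> bool" where
  "is_end (Sym d e) = e" | "is_end l = False"

text \<open>Since \<open>zip\<close> stops at the shorter list, \<open>pick b (True # fs) xs\<close>
  with \<open>fs\<close> as long as \<open>xs\<close> shifts the flags by one position and drops the
  last one.\<close>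

definition pick :: "bool \<Rightarrow> bool list \<Rightarrow> 'b list \<Rightarrow> 'b list" where
  "pick b fs xs = map snd (filter (\<lambda>x. fst x = b) (zip fs xs))"

lemma enc_simps [simp]: "enc [] = []" "enc (x # es) = ent x @ enc es"
  by (simp_all add: enc_def)

lemma bat_simps [simp]: "bat [] = []" "bat (x # xs) = ent (False, x) @ bat xs"
  by (simp_all add: bat_def)

lemma pick_simps [simp]:
  "pick b fs [] = []" "pick b [] xs = []"
  "pick b (f # fs) (x # xs) = (if f = b then x # pick b fs xs else pick b fs xs)"
  by (simp_all add: pick_def)

lemma pick_map: "pick b fs (map f xs) = map f (pick b fs xs)"
proof (induction fs arbitrary: xs)
  case (Cons c fs)
  then show ?case by (cases xs) auto
qed simp

lemma set_enc: "set (enc es) \<subseteq> range (case_prod Sym)"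
  by (auto simp: enc_def ent_def split: prod.splits)

lemma ent_append_eq:
  "ent (d, n) @ u = ent (d', n') @ v \<Longrightarrow> d = d' \<and> n = n' \<and> u = v"
proof (induction n arbitrary: n')
  case 0
  then show ?case by (cases n') (auto simp: ent_def)
next
  case (Suc n)
  then show ?case by (cases n') (auto simp: ent_def)
qed

lemma enc_inj: "enc es = enc es' \<Longrightarrow> es = es'"
proof (induction es arbitrary: es')
  case Nil
  then show ?case by (cases es') (auto simp: ent_def split: prod.splits)
next
  case (Cons x es)
  obtain y es'' where es': "es' = y # es''"
    using Cons.prems by (cases es') (auto simp: ent_def split: prod.splits)
  obtain d n d' n' where "x = (d, n)" "y = (d', n')" by fastforce
  then show ?case using Cons es' ent_append_eq[of d n "enc es" d' n' "enc es''"] by simp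
qed

lemma bat_inj [simp]: "bat xs = bat ys \<longleftrightarrow> xs = ys"
proof
  assume "bat xs = bat ys"
  then have "map (Pair False) xs = map (Pair False) ys" unfolding bat_def by (rule enc_inj)
  then show "xs = ys" by (rule map_injective) (simp add: inj_def)
qed simp

lemma undot_enc: "map undot (enc es) = bat (map snd es)"
  by (induction es) (auto simp: ent_def)

lemma ends_enc: "filter is_end (enc es) = map (\<lambda>d. Sym d True) (map fst es)"
  by (induction es) (auto simp: ent_def)

lemma pick_enc:
  "length fs = length xs \<Longrightarrow> map undot (filter (\<lambda>l. dotted l = b) (enc (zip fs xs))) = bat (pick b fs xs)"
  by (induction fs xs rule: list_induct2) (auto simp: ent_def)

lemma ends_bat: "filter is_end (bat xs) = replicate (length xs) (Sym False True)"
  by (induction xs) (auto simp: ent_def)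

text \<open>Within an entry the flag persists up to the end letter. As \<open>Mark\<close> may not
  follow \<open>Sym d False\<close>, a word cannot stop in the middle of an entry.\<close>

fun enc_next :: "letter \<Rightarrow> letter \<Rightarrow> bool" where
  "enc_next (Sym d False) l \<longleftrightarrow> l = Sym d False \<or> l = Sym d True"
| "enc_next _ _ \<longleftrightarrow> True"

text \<open>A left neighbour \<open>Sym d False\<close> means that \<open>w\<close> begins inside an
  entry with flag \<open>d\<close>, and the remainder of that entry is again of the form
  \<open>ent\<close>.\<close>

lemma chain_enc_imp:
  "chain enc_next c w \<Longrightarrow> set w \<subseteq> range (case_prod Sym) \<Longrightarrow>
    (case c of Sym d False \<Rightarrow> \<exists>n es. w = ent (d, n) @ enc es | _ \<Rightarrow> \<exists>es. w = enc es)"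
proof (induction w arbitrary: c)
  case Nil
  have "\<exists>es. [] = enc es" by (rule exI[of _ "[]"]) simp
  then show ?case using Nil by (auto split: letter.splits bool.splits)
next
  case (Cons l w)
  then obtain d e where l: "l = Sym d e" by auto
  have w: "chain enc_next l w" and cl: "enc_next c l" using Cons.prems by auto
  have IH: "case l of Sym d False \<Rightarrow> \<exists>n es. w = ent (d, n) @ enc es | _ \<Rightarrow> \<exists>es. w = enc es"
    by (rule Cons.IH[OF w]) (use Cons.prems in auto)
  have g: "\<exists>n es. l # w = ent (d, n) @ enc es"
  proof (cases e)
    case True
    then obtain es where "w = enc es" using IH l by auto
    then show ?thesis using l True by (intro exI[of _ 0] exI[of _ es]) (simp add: ent_def)
  next
    case False
    then obtain n es where "w = ent (d, n) @ enc es" using IH l by auto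
    then show ?thesis using l False by (intro exI[of _ "Suc n"] exI[of _ es]) (simp add: ent_def)
  qed
  then have g': "\<exists>es. l # w = enc es" by (metis enc_simps(2))
  show ?case
  proof (cases "\<exists>d'. c = Sym d' False")
    case True
    then have "c = Sym d False" using cl l by auto
    then show ?thesis using g by simp
  next
    case False
    then show ?thesis using g' by (auto split: letter.splits bool.splits)
  qed
qed

lemma chain_ent:
  assumes "chain enc_next (Sym d True) w" "\<And>e. enc_next c (Sym d e)"
  shows "chain enc_next c (ent (d, n) @ w)"
  using assms(2)
proof (induction n arbitrary: c)
  case 0
  then show ?case using assms(1) by (simp add: ent_def)
next
  case (Suc n)
  have "chain enc_next (Sym d False) (ent (d, n) @ w)"
  proof (rule Suc.IH)
    show "enc_next (Sym d False) (Sym d e)" for e by (cases e) auto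
  qed
  then show ?case using Suc.prems[of False] by (simp add: ent_def)
qed

lemma chain_enc: "(\<And>l. enc_next c l) \<Longrightarrow> chain enc_next c (enc es)"
proof (induction es arbitrary: c)
  case (Cons x es)
  obtain d n where x: "x = (d, n)" by fastforce
  have "chain enc_next (Sym d True) (enc es)" by (rule Cons.IH) simp
  then show ?case unfolding x enc_simps by (rule chain_ent) (rule Cons.prems)
qed simp

lemma range_enc_iff: "(\<exists>es. w = enc es) \<longleftrightarrow> set w \<subseteq> range (case_prod Sym) \<and> chain enc_next Mark w"
proof
  assume "\<exists>es. w = enc es"
  then show "set w \<subseteq> range (case_prod Sym) \<and> chain enc_next Mark w"
    using chain_enc[of Mark] set_enc by (elim exE) (simp only: simp_thms enc_next.simps)
next
  assume "set w \<subseteq> range (case_prod Sym) \<and> chain enc_next Mark w"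
  then show "\<exists>es. w = enc es" using chain_enc_imp[of Mark w] by simp
qed

lemma dio_range_enc: "dio (\<lambda>\<sigma>. \<exists>es. \<sigma> i = enc es)"
  unfolding range_enc_iff by (intro dio_conj dio_subset dio_chain)

lemma set_bat: "set (bat xs) \<subseteq> range (Sym False)"
  by (induction xs) (auto simp: ent_def)

lemma range_bat_iff: "(\<exists>xs. w = bat xs) \<longleftrightarrow> (\<exists>es. w = enc es) \<and> set w \<subseteq> range (Sym False)"
proof
  assume "\<exists>xs. w = bat xs"
  then show "(\<exists>es. w = enc es) \<and> set w \<subseteq> range (Sym False)"
    using set_bat unfolding bat_def by blast
next
  assume "(\<exists>es. w = enc es) \<and> set w \<subseteq> range (Sym False)"
  then obtain es where w: "w = enc es" "set w \<subseteq> range (Sym False)" by blast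
  have "fst e = False" if "e \<in> set es" for e
  proof -
    have "Sym (fst e) True \<in> set (ent e)"
      by (cases e) (simp add: ent_def)
    then have "Sym (fst e) True \<in> set w"
      using that w(1) by (auto simp: enc_def)
    then show ?thesis using w(2) by blast
  qed
  then have "map (Pair False) (map snd es) = es"
    unfolding map_map by (intro map_idI) (simp add: prod_eq_iff)
  then have "w = bat (map snd es)" using w(1) by (simp add: bat_def)
  then show "\<exists>xs. w = bat xs" by blast
qed

lemma dio_range_bat: "dio (\<lambda>\<sigma>. \<exists>xs. \<sigma> i = bat xs)"
  unfolding range_bat_iff by (intro dio_conj dio_subset dio_range_enc)

lemma dio_filter_undot: "dio (\<lambda>\<sigma>. filter_map Q undot (\<sigma> i) (\<sigma> j))"
  by (rule dio_filter_map) (auto simp: image_iff)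

text \<open>A list of environments is represented by its columns. Allowing lists, not just single
  environments, is what makes the definable relations closed under iteration.\<close>

definition cols :: "(nat \<Rightarrow> nat) list \<Rightarrow> nat \<Rightarrow> letter list" where
  "cols \<nu>s = (\<lambda>i. bat (map (\<lambda>\<nu>. \<nu> i) \<nu>s))"

text \<open>\<open>D\<close> is prescribed only where all columns have one common length and is
  arbitrary elsewhere. Every column that is introduced must be given this length.\<close>

definition bdio :: "((nat \<Rightarrow> nat) \<Rightarrow> bool) \<Rightarrow> bool" where
  "bdio P \<longleftrightarrow> (\<exists>D. dio D \<and> (\<forall>\<nu>s. D (cols \<nu>s) \<longleftrightarrow> (\<forall>\<nu>\<in>set \<nu>s. P \<nu>)))"

section \<open>Closure properties of relations on batches\<close>

lemma bdioI: "dio D \<Longrightarrow> (\<And>\<nu>s. D (cols \<nu>s) \<longleftrightarrow> (\<forall>\<nu>\<in>set \<nu>s. P \<nu>)) \<Longrightarrow> bdio P"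
  unfolding bdio_def by blast

lemma bdioE:
  assumes "bdio P"
  obtains D where "dio D" "\<And>\<nu>s. D (cols \<nu>s) \<longleftrightarrow> (\<forall>\<nu>\<in>set \<nu>s. P \<nu>)"
  using assms unfolding bdio_def by blast

lemma bdio_conj:
  assumes "bdio P" "bdio Q"
  shows "bdio (\<lambda>\<nu>. P \<nu> \<and> Q \<nu>)"
proof -
  obtain D where D: "dio D" "\<And>\<nu>s. D (cols \<nu>s) \<longleftrightarrow> (\<forall>\<nu>\<in>set \<nu>s. P \<nu>)"
    using assms(1) by (rule bdioE) blast
  obtain D' where D': "dio D'" "\<And>\<nu>s. D' (cols \<nu>s) \<longleftrightarrow> (\<forall>\<nu>\<in>set \<nu>s. Q \<nu>)"
    using assms(2) by (rule bdioE) blast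
  show ?thesis by (rule bdioI[OF dio_conj[OF D(1) D'(1)]]) (auto simp: D(2) D'(2))
qed

text \<open>The witnesses for all environments form one new column. Comparing its end letters with
  those of column 0 gives it one entry per environment.\<close>

lemma bdio_ex:
  assumes "bdio (\<lambda>\<nu>. P (\<nu> 0) (\<lambda>n. \<nu> (Suc n)))"
  shows "bdio (\<lambda>\<nu>. \<exists>x. P x \<nu>)"
proof -
  obtain D where D: "dio D" "\<And>\<nu>s. D (cols \<nu>s) \<longleftrightarrow> (\<forall>\<nu>\<in>set \<nu>s. P (\<nu> 0) (\<lambda>n. \<nu> (Suc n)))"
    using assms by (rule bdioE) blast
  define D' where "D' = (\<lambda>\<sigma>. \<exists>X. (\<exists>xs. X = bat xs) \<and>
    (\<exists>p. filter_map is_end undot X p \<and> filter_map is_end undot (\<sigma> 0) p) \<and> D (case_nat X \<sigma>))"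
  have cn: "case_nat (\<sigma> 0) (\<lambda>n. \<sigma> (Suc n)) = \<sigma>" for \<sigma> :: "nat \<Rightarrow> 'b"
    by (auto split: nat.splits)
  have "dio D'"
    unfolding D'_def
    by (intro dio_ex dio_conj dio_range_bat dio_filter_undot) (simp add: cn D(1))
  moreover have "D' (cols \<nu>s) \<longleftrightarrow> (\<forall>\<nu>\<in>set \<nu>s. \<exists>x. P x \<nu>)" for \<nu>s
  proof -
    have len: "(\<exists>p. filter_map is_end undot (bat xs) p \<and> filter_map is_end undot (bat ys) p) \<longleftrightarrow>
      length xs = length ys" for xs ys
      using set_enc by (auto simp: filter_map_def ends_bat) (auto simp: bat_def)
    have c: "case_nat (bat xs) (cols \<nu>s) = cols (map2 case_nat xs \<nu>s)" if "length xs = length \<nu>s" for xs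
    proof
      fix i
      show "case_nat (bat xs) (cols \<nu>s) i = cols (map2 case_nat xs \<nu>s) i"
        using that by (cases i) (auto simp: cols_def intro!: nth_equalityI)
    qed
    have "D' (cols \<nu>s) \<longleftrightarrow> (\<exists>xs. length xs = length \<nu>s \<and> D (case_nat (bat xs) (cols \<nu>s)))"
    proof -
      have "cols \<nu>s 0 = bat (map (\<lambda>\<nu>. \<nu> 0) \<nu>s)" by (simp add: cols_def)
      then show ?thesis unfolding D'_def using len[of _ "map (\<lambda>\<nu>. \<nu> 0) \<nu>s"] by auto
    qed
    also have "\<dots> \<longleftrightarrow> (\<exists>xs. length xs = length \<nu>s \<and> (\<forall>i<length \<nu>s. P (xs ! i) (\<nu>s ! i)))"
    proof -
      have "D (case_nat (bat xs) (cols \<nu>s)) \<longleftrightarrow> (\<forall>i<length \<nu>s. P (xs ! i) (\<nu>s ! i))"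
        if "length xs = length \<nu>s" for xs
        using that by (auto simp: c[OF that] D(2) set_zip in_set_conv_nth)
      then show ?thesis by blast
    qed
    also have "\<dots> \<longleftrightarrow> (\<forall>\<nu>\<in>set \<nu>s. \<exists>x. P x \<nu>)"
    proof
      assume "\<forall>\<nu>\<in>set \<nu>s. \<exists>x. P x \<nu>"
      then obtain g where "\<forall>\<nu>\<in>set \<nu>s. P (g \<nu>) \<nu>" by metis
      then show "\<exists>xs. length xs = length \<nu>s \<and> (\<forall>i<length \<nu>s. P (xs ! i) (\<nu>s ! i))"
        by (intro exI[of _ "map g \<nu>s"]) auto
    qed (metis in_set_conv_nth)
    finally show ?thesis .
  qed
  ultimately show ?thesis by (rule bdioI)
qed

lemma bdio_ex_list:
  assumes "bdio (\<lambda>\<nu>. P (map \<nu> [0..<k]) (\<lambda>n. \<nu> (n + k)))"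
  shows "bdio (\<lambda>\<nu>. \<exists>xs. length xs = k \<and> P xs \<nu>)"
  using assms
proof (induction k arbitrary: P)
  case 0
  then show ?case by simp
next
  case (Suc k)
  have "bdio (\<lambda>\<nu>. \<exists>xs. length xs = k \<and> P (xs @ [\<nu> 0]) (\<lambda>n. \<nu> (Suc n)))"
    by (rule Suc.IH) (use Suc.prems in simp)
  then have "bdio (\<lambda>\<nu>. \<exists>x xs. length xs = k \<and> P (xs @ [x]) \<nu>)"
    by (rule bdio_ex)
  moreover have "(\<exists>x xs. length xs = k \<and> P (xs @ [x]) \<nu>) \<longleftrightarrow> (\<exists>xs. length xs = Suc k \<and> P xs \<nu>)" for \<nu>
    by (metis length_Suc_conv_rev)
  ultimately show ?case by simp
qed

lemma bdio_eq: "bdio (\<lambda>\<nu>. \<nu> i = \<nu> j)"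
  by (rule bdioI[OF dio_eq[of "[Inr i]" "[Inr j]"]]) (auto simp: subst_def cols_def)

lemma bdio_True: "bdio (\<lambda>\<nu>. True)"
  using bdio_eq[of 0 0] by simp

text \<open>\<open>False\<close> holds throughout the empty batch and no other, and an empty column
  0 recognizes this batch.\<close>

lemma bdio_False: "bdio (\<lambda>\<nu>. False)"
proof (rule bdioI[OF dio_eq[of "[Inr 0]" "[]"]])
  fix \<nu>s
  show "subst (cols \<nu>s) [Inr 0] = subst (cols \<nu>s) [] \<longleftrightarrow> (\<forall>\<nu>\<in>set \<nu>s. False)"
    by (cases \<nu>s) (auto simp: subst_def cols_def ent_def)
qed

lemma bdio_All_less:
  fixes k :: nat
  assumes "\<And>t. t < k \<Longrightarrow> bdio (P t)"
  shows "bdio (\<lambda>\<nu>. \<forall>t<k. P t \<nu>)"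
  using assms
proof (induction k)
  case (Suc k)
  then have "bdio (\<lambda>\<nu>. (\<forall>t<k. P t \<nu>) \<and> P k \<nu>)" by (intro bdio_conj) auto
  moreover have "(\<forall>t<Suc k. P t \<nu>) \<longleftrightarrow> (\<forall>t<k. P t \<nu>) \<and> P k \<nu>" for \<nu>
    by (auto simp: less_Suc_eq)
  ultimately show ?case by simp
qed (simp add: bdio_True)

lemma bdio_zero: "bdio (\<lambda>\<nu>. \<nu> i = 0)"
proof (rule bdioI[OF dio_subset[of i "{Sym False True}"]])
  fix \<nu>s
  show "set (cols \<nu>s i) \<subseteq> {Sym False True} \<longleftrightarrow> (\<forall>\<nu>\<in>set \<nu>s. \<nu> i = 0)"
    unfolding cols_def by (induction \<nu>s) (auto simp: ent_def)
qed

text \<open>One word for both columns of the successor relation: a dotted unit stands before each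
  end letter. Undotting all letters gives the successors, deleting the dotted ones gives the numbers
  themselves.\<close>

definition suc_bat :: "nat list \<Rightarrow> letter list" where
  "suc_bat xs = concat (map (\<lambda>x. replicate x (Sym False False) @ [Sym True False, Sym False True]) xs)"

definition suc_next :: "letter \<Rightarrow> letter \<Rightarrow> bool" where
  "suc_next l l' \<longleftrightarrow> (l = Sym True False \<longleftrightarrow> l' = Sym False True)"

lemma suc_bat_Cons [simp]:
  "suc_bat [] = []"
  "suc_bat (x # xs) = replicate x (Sym False False) @ Sym True False # Sym False True # suc_bat xs"
  by (simp_all add: suc_bat_def)

text \<open>The condition on neighbours also admits units after the last end letter; these are
  excluded later by \<open>bat_append_replicate\<close>.\<close>

lemma chain_suc_imp:
  "chain suc_next c w \<Longrightarrow> set w \<subseteq> {Sym False False, Sym True False, Sym False True} \<Longrightarrow>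
    \<exists>xs k. w = (if c = Sym True False then [Sym False True] else []) @ suc_bat xs @ replicate k (Sym False False)"
proof (induction w arbitrary: c)
  case Nil
  have "\<exists>xs k. [] = suc_bat xs @ replicate k (Sym False False)"
    by (intro exI[of _ "[]"] exI[of _ 0]) simp
  then show ?case using Nil by (auto simp: suc_next_def)
next
  case (Cons l w)
  have cl: "suc_next c l" and w: "chain suc_next l w" using Cons.prems by auto
  obtain xs k where IH: "w = (if l = Sym True False then [Sym False True] else []) @ suc_bat xs @ replicate k (Sym False False)"
    using Cons.IH[OF w] Cons.prems(2) by auto
  consider "l = Sym False False" | "l = Sym True False" | "l = Sym False True"
    using Cons.prems(2) by auto
  then show ?case
  proof cases
    case 1
    show ?thesis
    proof (cases xs)
      case Nil
      then show ?thesis using 1 IH cl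
        by (intro exI[of _ "[]"] exI[of _ "Suc k"]) (auto simp: suc_next_def)
    next
      case (Cons x xs')
      then show ?thesis using 1 IH cl
        by (intro exI[of _ "Suc x # xs'"] exI[of _ k]) (auto simp: suc_next_def)
    qed
  next
    case 2
    then show ?thesis using IH cl
      by (intro exI[of _ "0 # xs"] exI[of _ k]) (auto simp: suc_next_def)
  next
    case 3
    then show ?thesis using IH cl
      by (intro exI[of _ xs] exI[of _ k]) (auto simp: suc_next_def)
  qed
qed

lemma chain_suc_replicate:
  "c \<noteq> Sym True False \<Longrightarrow> chain suc_next (Sym True False) w \<Longrightarrow>
    chain suc_next c (replicate x (Sym False False) @ Sym True False # w)"
  by (induction x arbitrary: c) (auto simp: suc_next_def)

lemma chain_suc: "c \<noteq> Sym True False \<Longrightarrow> chain suc_next c (suc_bat xs)"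
proof (induction xs arbitrary: c)
  case (Cons x xs)
  have "chain suc_next (Sym True False) (Sym False True # suc_bat xs)"
  proof -
    have "suc_next (Sym True False) (Sym False True)" by (simp add: suc_next_def)
    then show ?thesis using Cons.IH[of "Sym False True"] by simp
  qed
  then show ?case unfolding suc_bat_Cons by (rule chain_suc_replicate[OF Cons.prems])
qed (simp add: suc_next_def)

lemma suc_bat_undot: "map undot (suc_bat xs) = bat (map Suc xs)"
  by (induction xs) (auto simp: ent_def replicate_append_same)

lemma suc_bat_filter: "map undot (filter (\<lambda>l. \<not> dotted l) (suc_bat xs)) = bat xs"
  by (induction xs) (auto simp: ent_def)

lemma bat_append_replicate: "bat xs @ replicate k (Sym False False) = bat ys \<Longrightarrow> k = 0"
proof (induction ys arbitrary: xs)
  case Nil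
  then show ?case by simp
next
  case (Cons y ys)
  show ?case
  proof (cases xs)
    case Nil
    with Cons.prems have "Sym False True \<in> set (replicate k (Sym False False))"
      by (simp add: ent_def)
    then show ?thesis by auto
  next
    case (Cons x xs')
    then have "bat xs' @ replicate k (Sym False False) = bat ys"
      using Cons.prems ent_append_eq[of False x _ False y] by simp
    then show ?thesis by (rule Cons.IH)
  qed
qed

lemma bdio_Suc: "bdio (\<lambda>\<nu>. \<nu> i = Suc (\<nu> j))"
proof -
  define D where "D = (\<lambda>\<sigma>. \<exists>w. set w \<subseteq> {Sym False False, Sym True False, Sym False True} \<and>
    chain suc_next Mark w \<and> \<sigma> i = map undot w \<and> filter_map (\<lambda>l. \<not> dotted l) undot w (\<sigma> j))"
  have "dio D"
    unfolding D_def by (intro dio_ex dio_conj dio_subset dio_chain dio_map dio_filter_undot)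
  moreover have "D (cols \<nu>s) \<longleftrightarrow> (\<forall>\<nu>\<in>set \<nu>s. \<nu> i = Suc (\<nu> j))" for \<nu>s
  proof
    assume "D (cols \<nu>s)"
    then obtain w where w: "set w \<subseteq> {Sym False False, Sym True False, Sym False True}"
      "chain suc_next Mark w" "bat (map (\<lambda>\<nu>. \<nu> i) \<nu>s) = map undot w"
      "bat (map (\<lambda>\<nu>. \<nu> j) \<nu>s) = map undot (filter (\<lambda>l. \<not> dotted l) w)"
      by (auto simp: D_def cols_def filter_map_def)
    obtain xs k where xs: "w = suc_bat xs @ replicate k (Sym False False)"
      using chain_suc_imp[OF w(2,1)] by auto
    then have "bat (map Suc xs) @ replicate k (Sym False False) = bat (map (\<lambda>\<nu>. \<nu> i) \<nu>s)"
      using w(3) by (simp add: suc_bat_undot)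
    then have "k = 0" by (rule bat_append_replicate)
    then have "map (\<lambda>\<nu>. \<nu> i) \<nu>s = map Suc xs" "map (\<lambda>\<nu>. \<nu> j) \<nu>s = xs"
      using w(3,4) xs by (simp_all add: suc_bat_undot suc_bat_filter)
    then have "map (\<lambda>\<nu>. \<nu> i) \<nu>s = map (\<lambda>\<nu>. Suc (\<nu> j)) \<nu>s" by auto
    then show "\<forall>\<nu>\<in>set \<nu>s. \<nu> i = Suc (\<nu> j)" by (simp add: map_eq_conv)
  next
    assume a: "\<forall>\<nu>\<in>set \<nu>s. \<nu> i = Suc (\<nu> j)"
    define xs where "xs = map (\<lambda>\<nu>. \<nu> j) \<nu>s"
    have "map (\<lambda>\<nu>. \<nu> i) \<nu>s = map Suc xs" using a by (simp add: xs_def)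
    moreover have "set (suc_bat xs) \<subseteq> {Sym False False, Sym True False, Sym False True}"
      by (induction xs) auto
    ultimately show "D (cols \<nu>s)"
      unfolding D_def cols_def using chain_suc[of Mark xs]
      by (intro exI[of _ "suc_bat xs"])
        (auto simp: suc_bat_undot suc_bat_filter filter_map_def xs_def[symmetric])
  qed
  ultimately show ?thesis by (rule bdioI)
qed

section \<open>Iterated relations\<close>

lemma pick_append_flag: "length fs = length xs \<Longrightarrow> pick b (fs @ [c]) xs = pick b fs xs"
  by (induction fs xs rule: list_induct2) auto

lemma length_pick: "length fs = length xs \<Longrightarrow> length (pick b fs xs) = length (filter (\<lambda>d. d = b) fs)"
  by (induction fs xs rule: list_induct2) auto

lemma set_pick: "set (pick b fs xs) \<subseteq> set xs"
  by (auto simp: pick_def dest: set_zip_rightD)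

text \<open>A sequence of states is cut into blocks, \<open>fs\<close> marking the last states of the blocks; hence
  \<open>True # fs\<close> marks the first ones.\<close>

lemma blocks_imp_rtranclp:
  assumes "length fs = length hs"
  shows "list_all2 R (pick False fs hs) (pick False (True # fs) hs) \<Longrightarrow>
      list_all2 R\<^sup>*\<^sup>* (pick True (True # fs) hs) (pick True fs hs)"
    and "list_all2 R (g # pick False fs hs) (pick False (False # fs) hs) \<Longrightarrow> R\<^sup>*\<^sup>* x g \<Longrightarrow>
      list_all2 R\<^sup>*\<^sup>* (x # pick True (False # fs) hs) (pick True fs hs)"
  using assms
\<comment> \<open>The second statement is about a block that is still open: \<open>x\<close> is its
  first state and \<open>g\<close> the latest one.\<close>
proof (induction fs hs arbitrary: g x rule: list_induct2)
  case Nil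
  {
    case 1
    show ?case by simp
  next
    case 2
    then show ?case by simp
  }
next
  case (Cons f fs h hs)
  {
    case 1
    then show ?case using Cons.IH(1) Cons.IH(2)[of h h] by (cases f) auto
  next
    case 2
    then have "R g h" by simp
    with 2(2) have "R\<^sup>*\<^sup>* x h" by (rule rtranclp.rtrancl_into_rtrancl)
    then show ?case using 2(1) Cons.IH(1) Cons.IH(2)[of h x] by (cases f) auto
  }
qed

text \<open>In a concatenation of runs the i-th state that is not last in its block is followed by
  the i-th one that is not first, so one \<open>list_all2\<close> states all steps.
  \<open>K\<close>, later the length of states, holds for sources of steps and for final states,
  hence for all states.\<close>

lemma rtranclp_imp_blocks:
  assumes "list_all2 R\<^sup>*\<^sup>* X Z" "\<And>s s'. R s s' \<Longrightarrow> K s" "\<And>z. z \<in> set Z \<Longrightarrow> K z"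
  shows "\<exists>fs hs. length fs = length hs \<and> pick True (True # fs) hs = X \<and> pick True fs hs = Z \<and>
    list_all2 R (pick False fs hs) (pick False (True # fs) hs) \<and> (fs = [] \<or> last fs) \<and> (\<forall>h\<in>set hs. K h)"
  using assms(1,3)
proof (induction rule: list_all2_induct)
  case Nil
  show ?case by (intro exI[of _ "[]"]) simp
next
  case (Cons x X z Z)
  then obtain fs hs where IH: "length fs = length hs" "pick True (True # fs) hs = X" "pick True fs hs = Z"
    "list_all2 R (pick False fs hs) (pick False (True # fs) hs)" "fs = [] \<or> last fs" "\<forall>h\<in>set hs. K h"
    by auto
  have "\<exists>fs hs. length fs = length (x # hs) \<and> pick True (True # fs) (x # hs) = x # X \<and> pick True fs (x # hs) = z # Z \<and>
    list_all2 R (pick False fs (x # hs)) (pick False (True # fs) (x # hs)) \<and> last fs \<and> (\<forall>h\<in>set (x # hs). K h)"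
    using Cons.hyps(1)
  \<comment> \<open>The run from \<open>x\<close> to \<open>z\<close> is built backwards, each step
    adding a state at the front of its block.\<close>
  proof (induction rule: converse_rtranclp_induct)
    case base
    show ?case
      using IH Cons.prems by (intro exI[of _ "True # fs"] exI[of _ hs]) auto
  next
    case (step x y)
    then obtain fs hs where *: "length fs = length (y # hs)" "pick True (True # fs) (y # hs) = y # X"
      "pick True fs (y # hs) = z # Z"
      "list_all2 R (pick False fs (y # hs)) (pick False (True # fs) (y # hs))" "last fs" "\<forall>h\<in>set (y # hs). K h"
      by blast
    then have "fs \<noteq> []" by auto
    then show ?case
      using * step.hyps(1) assms(2)[OF step.hyps(1)]
      by (intro exI[of _ "False # fs"] exI[of _ "y # hs"]) auto
  qed
  then obtain fs hs where "length fs = length (x # hs) \<and> pick True (True # fs) (x # hs) = x # X \<and> pick True fs (x # hs) = z # Z \<and>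
    list_all2 R (pick False fs (x # hs)) (pick False (True # fs) (x # hs)) \<and> last fs \<and> (\<forall>h\<in>set (x # hs). K h)"
    by blast
  then show ?case by (intro exI[of _ fs] exI[of _ "x # hs"]) simp
qed

text \<open>One coordinate of a sequence of states. \<open>H\<close> and \<open>H'\<close> carry the
  same numbers, flagged at the last and at the first states of blocks; \<open>p\<close> and
  \<open>p'\<close> are these flags. \<open>U\<close> and \<open>U'\<close> belong to the states
  that are not last and not first, \<open>x\<close> and \<open>z\<close> to the first and the last
  states.\<close>

definition history :: "letter list \<Rightarrow> letter list \<Rightarrow> letter list \<Rightarrow> letter list \<Rightarrow> letter list \<Rightarrow>
    letter list \<Rightarrow> letter list \<Rightarrow> letter list \<Rightarrow> bool" where
  "history H H' p p' U U' x z \<longleftrightarrow>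
     (\<exists>es. H = enc es) \<and> (\<exists>es. H' = enc es) \<and>
     (\<exists>v. filter_map (\<lambda>_. True) undot H v \<and> filter_map (\<lambda>_. True) undot H' v) \<and>
     filter_map is_end (\<lambda>l. l) H p \<and> filter_map is_end (\<lambda>l. l) H' p' \<and>
     filter_map (\<lambda>l. dotted l = False) undot H U \<and> filter_map (\<lambda>l. dotted l = False) undot H' U' \<and>
     filter_map (\<lambda>l. dotted l = True) undot H' x \<and> filter_map (\<lambda>l. dotted l = True) undot H z"

lemma dio_history:
  "dio (\<lambda>\<sigma>. history (\<sigma> i1) (\<sigma> i2) (\<sigma> i3) (\<sigma> i4) (\<sigma> i5) (\<sigma> i6) (\<sigma> i7) (\<sigma> i8))"
  unfolding history_def
  by (intro dio_conj dio_ex dio_range_enc dio_filter_undot dio_filter_map) auto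

lemma map_end_eq_iff [simp]: "map (\<lambda>d. Sym d True) fs = map (\<lambda>d. Sym d True) gs \<longleftrightarrow> fs = gs"
  by (rule inj_map_eq_map) (simp add: inj_def)

lemma historyD:
  assumes "history H H' p p' U U' x z"
  shows "\<exists>fs fs' ns. length fs = length ns \<and> length fs' = length ns \<and>
    p = map (\<lambda>d. Sym d True) fs \<and> p' = map (\<lambda>d. Sym d True) fs' \<and>
    U = bat (pick False fs ns) \<and> U' = bat (pick False fs' ns) \<and>
    x = bat (pick True fs' ns) \<and> z = bat (pick True fs ns)"
proof -
  obtain es es' where H: "H = enc es" "H' = enc es'" using assms unfolding history_def by blast
  have "bat (map snd es) = bat (map snd es')"
    using assms unfolding history_def H filter_map_def by (auto simp: undot_enc)
  then have ns: "map snd es' = map snd es" by simp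
  define fs fs' ns where "fs = map fst es" "fs' = map fst es'" "ns = map snd es"
  have es: "es = zip fs ns" "es' = zip fs' ns" "length fs = length ns" "length fs' = length ns"
    using ns map_eq_imp_length_eq[OF ns] unfolding fs_fs'_ns_def by (simp_all add: zip_map_fst_snd) (metis zip_map_fst_snd)
  have "p = map (\<lambda>d. Sym d True) fs" "p' = map (\<lambda>d. Sym d True) fs'"
    using assms unfolding history_def H filter_map_def by (auto simp: ends_enc fs_fs'_ns_def)
  moreover have "U = bat (pick False fs ns)" "U' = bat (pick False fs' ns)"
    "x = bat (pick True fs' ns)" "z = bat (pick True fs ns)"
    using assms es(3,4) unfolding history_def H filter_map_def es(1,2) by (simp_all add: pick_enc[symmetric])
  ultimately show ?thesis using es by blast
qed

lemma historyI:
  assumes "length fs = length ns" "length fs' = length ns"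
  shows "history (enc (zip fs ns)) (enc (zip fs' ns)) (map (\<lambda>d. Sym d True) fs) (map (\<lambda>d. Sym d True) fs')
    (bat (pick False fs ns)) (bat (pick False fs' ns)) (bat (pick True fs' ns)) (bat (pick True fs ns))"
  using assms set_enc unfolding history_def filter_map_def
  by (auto simp: pick_enc[symmetric] ends_enc undot_enc)

lemma nth_columns_eq:
  assumes "\<And>x. x \<in> set X \<Longrightarrow> length x = k" "\<And>y. y \<in> set Y \<Longrightarrow> length y = k" "0 < k"
    "\<And>t. t < k \<Longrightarrow> map (\<lambda>x. x ! t) X = map (\<lambda>y. y ! t) Y"
  shows "X = Y"
proof (rule nth_equalityI)
  show len: "length X = length Y" using map_eq_imp_length_eq[OF assms(4)[OF assms(3)]] .
  fix i assume i: "i < length X"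
  show "X ! i = Y ! i"
  proof (rule nth_equalityI)
    show "length (X ! i) = length (Y ! i)" using i len assms(1,2) by simp
    fix t assume "t < length (X ! i)"
    then have "t < k" using i assms(1) by simp
    then have "map (\<lambda>x. x ! t) X ! i = map (\<lambda>y. y ! t) Y ! i" using assms(4) by simp
    then show "X ! i ! t = Y ! i ! t" using i len by simp
  qed
qed

text \<open>The runs for all environments are joined into one sequence, one block per environment.
  Its steps form a batch for \<open>R\<close> whose size is independent of the number of
  environments.\<close>

lemma bdio_rtranclp:
  fixes R :: "nat list \<Rightarrow> nat list \<Rightarrow> bool"
  assumes R: "bdio (\<lambda>\<nu>. R (map \<nu> [0..<k]) (map \<nu> [k..<2 * k]))"
    and len: "\<And>s s'. R s s' \<Longrightarrow> length s = k \<and> length s' = k"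
    and k: "0 < k" and ij: "length is = k" "length js = k"
  shows "bdio (\<lambda>\<nu>. R\<^sup>*\<^sup>* (map \<nu> is) (map \<nu> js))"
proof -
  obtain C where C: "dio C" "\<And>\<nu>s. C (cols \<nu>s) \<longleftrightarrow> (\<forall>\<nu>\<in>set \<nu>s. R (map \<nu> [0..<k]) (map \<nu> [k..<2 * k]))"
    using R by (rule bdioE) blast
  \<comment> \<open>All columns of a batch must have the same length, so a copy of the first column
    is used from index \<open>2 * k\<close> on.\<close>
  have C_iff: "C (\<lambda>t. if t < k then bat (map (\<lambda>s. s ! t) U) else if t < 2 * k
      then bat (map (\<lambda>s. s ! (t - k)) U') else bat (map (\<lambda>s. s ! 0) U)) \<longleftrightarrow> list_all2 R U U'"
    (is "C ?c \<longleftrightarrow> _")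
    if U: "length U = length U'" "\<And>s. s \<in> set U \<Longrightarrow> length s = k" "\<And>s. s \<in> set U' \<Longrightarrow> length s = k" for U U'
  proof -
    define \<nu> where "\<nu> = (\<lambda>s s' t. if t < k then s ! t else if t < 2 * k then s' ! (t - k) else s ! 0 :: nat)"
    have "?c = cols (map2 \<nu> U U')"
      unfolding cols_def using U(1) by (intro ext) (auto simp: \<nu>_def intro!: nth_equalityI)
    moreover have "map (\<nu> s s') [0..<k] = s" "map (\<nu> s s') [k..<2 * k] = s'"
      if "length s = k" "length s' = k" for s s'
      using that by (auto simp: \<nu>_def intro!: nth_equalityI)
    moreover have "length s = k \<and> length s' = k" if "(s, s') \<in> set (zip U U')" for s s'
      using that U(2,3) by (meson set_zip_leftD set_zip_rightD)
    ultimately have "C ?c \<longleftrightarrow> (\<forall>(s, s')\<in>set (zip U U'). R s s')"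
      by (fastforce simp: C(2))
    then show ?thesis by (simp add: list_all2_iff U(1))
  qed
  \<comment> \<open>The coordinates of the states have separate columns but share the flags. The
    equation for \<open>p\<close> and \<open>p'\<close> says that the sequence begins with a first
    state, that first states are otherwise those after a last state, and that the final block is
    closed.\<close>
  define D where "D = (\<lambda>\<sigma>. \<exists>Hs. length Hs = k \<and> (\<exists>Hs'. length Hs' = k \<and> (\<exists>Us. length Us = k \<and>
    (\<exists>Us'. length Us' = k \<and> (\<exists>p p'. Sym True True # p = p' @ [Sym True True] \<and>
      (\<forall>t<k. history (Hs ! t) (Hs' ! t) p p' (Us ! t) (Us' ! t) (\<sigma> (is ! t)) (\<sigma> (js ! t))) \<and>
      C (\<lambda>t. if t < k then Us ! t else if t < 2 * k then Us' ! (t - k) else Us ! 0))))))"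
  have "dio D"
    unfolding D_def
  proof (intro dio_ex_list dio_ex dio_conj dio_All_less)
    show "dio (\<lambda>\<sigma>. Sym True True # \<sigma> (Suc 0) = \<sigma> 0 @ [Sym True True])"
      using dio_eq[of "[Inl (Sym True True), Inr 1]" "[Inr 0, Inl (Sym True True)]"]
      by (simp add: subst_def)
  next
    fix t assume t: "t < k"
    show "dio (\<lambda>\<sigma>. history (map (\<lambda>n. \<sigma> (Suc (Suc (n + k + k + k)))) [0..<k] ! t)
      (map (\<lambda>n. \<sigma> (Suc (Suc (n + k + k)))) [0..<k] ! t) (\<sigma> (Suc 0)) (\<sigma> 0)
      (map (\<lambda>n. \<sigma> (Suc (Suc (n + k)))) [0..<k] ! t) (map (\<lambda>n. \<sigma> (Suc (Suc n))) [0..<k] ! t)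
      (\<sigma> (Suc (Suc (is ! t + k + k + k + k)))) (\<sigma> (Suc (Suc (js ! t + k + k + k + k)))))"
      using t dio_history by simp
  next
    \<comment> \<open>Positions under the quantifiers: \<open>p'\<close> and \<open>p\<close> have
      indices 0 and 1, \<open>Us'\<close> the next \<open>k\<close> and \<open>Us\<close> the
      \<open>k\<close> after these.\<close>
    define f where "f = (\<lambda>t. if t < k then Suc (Suc (t + k)) else if t < 2 * k then Suc (Suc (t - k)) else Suc (Suc k))"
    have "(\<lambda>t. if t < k then map (\<lambda>n. \<sigma> (Suc (Suc (n + k)))) [0..<k] ! t
        else if t < 2 * k then map (\<lambda>n. \<sigma> (Suc (Suc n))) [0..<k] ! (t - k)
        else map (\<lambda>n. \<sigma> (Suc (Suc (n + k)))) [0..<k] ! 0) = (\<lambda>t. \<sigma> (f t))" for \<sigma> :: "nat \<Rightarrow> letter list"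
      using k by (intro ext) (auto simp: f_def)
    then show "dio (\<lambda>\<sigma>. C (\<lambda>t. if t < k then map (\<lambda>n. \<sigma> (Suc (Suc (n + k)))) [0..<k] ! t
        else if t < 2 * k then map (\<lambda>n. \<sigma> (Suc (Suc n))) [0..<k] ! (t - k)
        else map (\<lambda>n. \<sigma> (Suc (Suc (n + k)))) [0..<k] ! 0))"
      using dio_rename[OF C(1), of f] by simp
  qed
  moreover have "D (cols \<nu>s) \<longleftrightarrow> (\<forall>\<nu>\<in>set \<nu>s. R\<^sup>*\<^sup>* (map \<nu> is) (map \<nu> js))" for \<nu>s
  proof
    assume "D (cols \<nu>s)"
    then obtain Hs Hs' Us Us' p p' where p: "Sym True True # p = p' @ [Sym True True]"
      and h: "\<And>t. t < k \<Longrightarrow> history (Hs ! t) (Hs' ! t) p p' (Us ! t) (Us' ! t) (cols \<nu>s (is ! t)) (cols \<nu>s (js ! t))"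
      and c: "C (\<lambda>t. if t < k then Us ! t else if t < 2 * k then Us' ! (t - k) else Us ! 0)"
      unfolding D_def by blast
    obtain fs fs' where fs: "p = map (\<lambda>d. Sym d True) fs" "p' = map (\<lambda>d. Sym d True) fs'"
      using historyD[OF h[OF k]] by blast
    have "map (\<lambda>d. Sym d True) (True # fs) = map (\<lambda>d. Sym d True) (fs' @ [True])"
      using p unfolding fs by simp
    then have ff: "True # fs = fs' @ [True]" by (simp only: map_end_eq_iff)
    have "\<exists>ns. length fs = length ns \<and> Us ! t = bat (pick False fs ns) \<and> Us' ! t = bat (pick False fs' ns) \<and>
        cols \<nu>s (is ! t) = bat (pick True fs' ns) \<and> cols \<nu>s (js ! t) = bat (pick True fs ns)" if "t < k" for t
      using historyD[OF h[OF that]] unfolding fs by auto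
    then obtain ns where ns: "\<And>t. t < k \<Longrightarrow> length (ns t) = length fs"
      "\<And>t. t < k \<Longrightarrow> Us ! t = bat (pick False fs (ns t))" "\<And>t. t < k \<Longrightarrow> Us' ! t = bat (pick False fs' (ns t))"
      "\<And>t. t < k \<Longrightarrow> cols \<nu>s (is ! t) = bat (pick True fs' (ns t))"
      "\<And>t. t < k \<Longrightarrow> cols \<nu>s (js ! t) = bat (pick True fs (ns t))"
      by metis
    \<comment> \<open>The columns \<open>ns t\<close> are transposed into a list of states.\<close>
    define hs where "hs = map (\<lambda>i. map (\<lambda>t. ns t ! i) [0..<k]) [0..<length fs]"
    have hs: "length hs = length fs" "\<And>h. h \<in> set hs \<Longrightarrow> length h = k" by (auto simp: hs_def)
    have ns_hs: "ns t = map (\<lambda>h. h ! t) hs" if "t < k" for t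
      using that ns(1)[OF that] by (auto simp: hs_def intro!: nth_equalityI)
    have len': "length fs' = length hs" using hs(1) arg_cong[OF ff, of length] by simp
    have "filter (\<lambda>d. d = False) (True # fs) = filter (\<lambda>d. d = False) (fs' @ [True])"
      by (simp only: ff)
    then have lp: "length (pick False fs hs) = length (pick False fs' hs)"
      using len' hs(1) by (simp add: length_pick)
    have kk: "length h = k" if "h \<in> set (pick b gs hs)" for b gs h
      using that set_pick[of b gs hs] hs(2) by blast
    have "(\<lambda>t. if t < k then Us ! t else if t < 2 * k then Us' ! (t - k) else Us ! 0) =
      (\<lambda>t. if t < k then bat (map (\<lambda>s. s ! t) (pick False fs hs)) else if t < 2 * k
      then bat (map (\<lambda>s. s ! (t - k)) (pick False fs' hs)) else bat (map (\<lambda>s. s ! 0) (pick False fs hs)))"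
      using ns(2,3) k by (auto simp: ns_hs pick_map)
    then have "list_all2 R (pick False fs hs) (pick False fs' hs)"
      using c C_iff[OF lp kk kk] by simp
    moreover have flag: "pick b fs' hs = pick b (True # fs) hs" for b
      unfolding ff using pick_append_flag[OF len'] by simp
    ultimately have rt: "list_all2 R\<^sup>*\<^sup>* (pick True fs' hs) (pick True fs hs)"
      using blocks_imp_rtranclp(1)[OF hs(1)[symmetric]] by simp
    have "pick True fs' hs = map (\<lambda>\<nu>. map \<nu> is) \<nu>s"
    proof (rule nth_columns_eq[of _ k])
      show "map (\<lambda>x. x ! t) (pick True fs' hs) = map (\<lambda>y. y ! t) (map (\<lambda>\<nu>. map \<nu> is) \<nu>s)" if "t < k" for t
        using ns(4)[OF that] that ij by (simp add: ns_hs pick_map cols_def comp_def)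
    qed (use kk ij k in auto)
    moreover have "pick True fs hs = map (\<lambda>\<nu>. map \<nu> js) \<nu>s"
    proof (rule nth_columns_eq[of _ k])
      show "map (\<lambda>x. x ! t) (pick True fs hs) = map (\<lambda>y. y ! t) (map (\<lambda>\<nu>. map \<nu> js) \<nu>s)" if "t < k" for t
        using ns(5)[OF that] that ij by (simp add: ns_hs pick_map cols_def comp_def)
    qed (use kk ij k in auto)
    ultimately show "\<forall>\<nu>\<in>set \<nu>s. R\<^sup>*\<^sup>* (map \<nu> is) (map \<nu> js)"
      using rt by (simp add: list_all2_map1 list_all2_map2 list_all2_same)
  next
    assume "\<forall>\<nu>\<in>set \<nu>s. R\<^sup>*\<^sup>* (map \<nu> is) (map \<nu> js)"
    then have rt: "list_all2 R\<^sup>*\<^sup>* (map (\<lambda>\<nu>. map \<nu> is) \<nu>s) (map (\<lambda>\<nu>. map \<nu> js) \<nu>s)"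
      by (simp add: list_all2_map1 list_all2_map2 list_all2_same)
    obtain fs hs where hs: "length fs = length hs" "pick True (True # fs) hs = map (\<lambda>\<nu>. map \<nu> is) \<nu>s"
      "pick True fs hs = map (\<lambda>\<nu>. map \<nu> js) \<nu>s"
      "list_all2 R (pick False fs hs) (pick False (True # fs) hs)" "fs = [] \<or> last fs" "\<forall>h\<in>set hs. length h = k"
    proof -
      have "R s s' \<Longrightarrow> length s = k" for s s' using len by blast
      moreover have "z \<in> set (map (\<lambda>\<nu>. map \<nu> js) \<nu>s) \<Longrightarrow> length z = k" for z using ij by auto
      ultimately show thesis
        using rtranclp_imp_blocks[OF rt, of "\<lambda>h. length h = k"] that by blast
    qed
    define fs' where "fs' = butlast (True # fs)"
    have ff: "True # fs = fs' @ [True]"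
      using hs(5) append_butlast_last_id[of "True # fs"] by (simp add: fs'_def split: if_splits)
    have len': "length fs' = length hs" using hs(1) arg_cong[OF ff, of length] by simp
    have flag: "pick b fs' hs = pick b (True # fs) hs" for b
      unfolding ff using pick_append_flag[OF len'] by simp
    let ?n = "\<lambda>t. map (\<lambda>h. h ! t) hs"
    define Hs Hs' Us Us' where "Hs = map (\<lambda>t. enc (zip fs (?n t))) [0..<k]"
      "Hs' = map (\<lambda>t. enc (zip fs' (?n t))) [0..<k]"
      "Us = map (\<lambda>t. bat (pick False fs (?n t))) [0..<k]" "Us' = map (\<lambda>t. bat (pick False fs' (?n t))) [0..<k]"
    define p p' where "p = map (\<lambda>d. Sym d True) fs" "p' = map (\<lambda>d. Sym d True) fs'"
    have "Sym True True # p = p' @ [Sym True True]"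
      using arg_cong[OF ff, of "map (\<lambda>d. Sym d True)"] by (simp add: p_p'_def)
    moreover have "history (Hs ! t) (Hs' ! t) p p' (Us ! t) (Us' ! t) (cols \<nu>s (is ! t)) (cols \<nu>s (js ! t))"
      if t: "t < k" for t
    proof -
      have "cols \<nu>s (is ! t) = bat (pick True fs' (?n t))" "cols \<nu>s (js ! t) = bat (pick True fs (?n t))"
        using t ij by (simp_all add: cols_def pick_map flag hs(2,3) comp_def)
      then show ?thesis
        using t historyI[of fs "?n t" fs'] hs(1) len' by (simp add: Hs_Hs'_Us_Us'_def p_p'_def)
    qed
    moreover have "C (\<lambda>t. if t < k then Us ! t else if t < 2 * k then Us' ! (t - k) else Us ! 0)"
    proof -
      have kk: "length h = k" if "h \<in> set (pick b gs hs)" for b gs h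
        using that set_pick[of b gs hs] hs(6) by blast
      have R': "list_all2 R (pick False fs hs) (pick False fs' hs)" using hs(4) flag by simp
      have "(\<lambda>t. if t < k then Us ! t else if t < 2 * k then Us' ! (t - k) else Us ! 0) =
        (\<lambda>t. if t < k then bat (map (\<lambda>s. s ! t) (pick False fs hs)) else if t < 2 * k
        then bat (map (\<lambda>s. s ! (t - k)) (pick False fs' hs)) else bat (map (\<lambda>s. s ! 0) (pick False fs hs)))"
        using k by (auto simp: Hs_Hs'_Us_Us'_def pick_map)
      then show ?thesis
        using R' C_iff[OF list_all2_lengthD[OF R'] kk kk] by simp
    qed
    moreover have "length Hs = k" "length Hs' = k" "length Us = k" "length Us' = k"
      by (simp_all add: Hs_Hs'_Us_Us'_def)
    ultimately show "D (cols \<nu>s)" unfolding D_def by blast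
  qed
  ultimately show ?thesis by (rule bdioI)
qed

section \<open>Graphs of partial recursive functions\<close>

lemma rec_eval_Zero_iff: "rec_eval Zero xs y \<longleftrightarrow> y = 0"
  by (auto elim: rec_evalE intro: rec_eval.intros)

lemma rec_eval_Succ_iff: "rec_eval Succ xs y \<longleftrightarrow> (\<exists>x. xs = [x] \<and> y = Suc x)"
  by (auto elim: rec_evalE intro: rec_eval.intros)

lemma rec_eval_Proj_iff: "rec_eval (Proj i) xs y \<longleftrightarrow> i < length xs \<and> y = xs ! i"
  by (auto elim: rec_evalE intro: rec_eval.intros)

lemma rec_eval_Comp_iff:
  "rec_eval (Comp f gs) xs y \<longleftrightarrow>
    (\<exists>ys. length ys = length gs \<and> (\<forall>i<length gs. rec_eval (gs ! i) xs (ys ! i)) \<and> rec_eval f ys y)"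
proof
  assume "rec_eval (Comp f gs) xs y"
  then obtain ys where "list_all2 (\<lambda>g. rec_eval g xs) gs ys" "rec_eval f ys y"
    by (auto elim: rec_evalE)
  then show "\<exists>ys. length ys = length gs \<and> (\<forall>i<length gs. rec_eval (gs ! i) xs (ys ! i)) \<and> rec_eval f ys y"
    by (auto simp: list_all2_conv_all_nth)
next
  assume "\<exists>ys. length ys = length gs \<and> (\<forall>i<length gs. rec_eval (gs ! i) xs (ys ! i)) \<and> rec_eval f ys y"
  then obtain ys where "list_all2 (\<lambda>g. rec_eval g xs) gs ys" "rec_eval f ys y"
    by (metis list_all2_conv_all_nth)
  then show "rec_eval (Comp f gs) xs y" by (rule rec_eval.intros)
qed

section \<open>Primitive recursion and minimization as iterations\<close>

lemma not_rec_eval_PrimRec_Nil: "\<not> rec_eval (PrimRec f g) [] y"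
  by (auto elim: rec_eval.cases)

text \<open>A state holds counter, value and parameters: the parameters travel along because a step
  sees only its two states.\<close>

definition primrec_step :: "nat \<Rightarrow> recf \<Rightarrow> nat list \<Rightarrow> nat list \<Rightarrow> bool" where
  "primrec_step k g s s' \<longleftrightarrow> length s = k + 2 \<and> length s' = k + 2 \<and> s' ! 0 = Suc (s ! 0) \<and>
     rec_eval g s (s' ! 1) \<and> (\<forall>t<k. s' ! (t + 2) = s ! (t + 2))"

lemma primrec_step_length: "primrec_step k g s s' \<Longrightarrow> length s = k + 2 \<and> length s' = k + 2"
  by (simp add: primrec_step_def)

lemma primrec_step_iff:
  assumes "length xs = k"
  shows "primrec_step k g (n # v # xs) s' \<longleftrightarrow> (\<exists>w. s' = Suc n # w # xs \<and> rec_eval g (n # v # xs) w)"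
proof
  assume a: "primrec_step k g (n # v # xs) s'"
  then obtain m w ys where s': "s' = m # w # ys" "length ys = k"
    by (auto simp: primrec_step_def length_Suc_conv)
  then have "ys = xs" using a assms by (auto simp: primrec_step_def intro: nth_equalityI)
  then show "\<exists>w. s' = Suc n # w # xs \<and> rec_eval g (n # v # xs) w"
    using a s' by (auto simp: primrec_step_def)
qed (use assms in \<open>auto simp: primrec_step_def\<close>)

lemma rec_eval_PrimRec_iff:
  assumes "length xs = k"
  shows "rec_eval (PrimRec f g) (n # xs) y \<longleftrightarrow>
    (\<exists>v. rec_eval f xs v \<and> (primrec_step k g)\<^sup>*\<^sup>* (0 # v # xs) (n # y # xs))"
proof
  assume "rec_eval (PrimRec f g) (n # xs) y"
  then show "\<exists>v. rec_eval f xs v \<and> (primrec_step k g)\<^sup>*\<^sup>* (0 # v # xs) (n # y # xs)"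
  proof (induction n arbitrary: y)
    case 0
    then show ?case by (auto elim: rec_evalE)
  next
    case (Suc n)
    then obtain w where w: "rec_eval (PrimRec f g) (n # xs) w" "rec_eval g (n # w # xs) y"
      by (auto elim: rec_evalE)
    from Suc.IH[OF w(1)] obtain v where "rec_eval f xs v"
      "(primrec_step k g)\<^sup>*\<^sup>* (0 # v # xs) (n # w # xs)" by blast
    moreover have "primrec_step k g (n # w # xs) (Suc n # y # xs)"
      using w(2) assms by (simp add: primrec_step_iff)
    ultimately show ?case by (meson rtranclp.rtrancl_into_rtrancl)
  qed
next
  assume "\<exists>v. rec_eval f xs v \<and> (primrec_step k g)\<^sup>*\<^sup>* (0 # v # xs) (n # y # xs)"
  then obtain v where v: "rec_eval f xs v" "(primrec_step k g)\<^sup>*\<^sup>* (0 # v # xs) (n # y # xs)" by blast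
  have "\<exists>n y. s = n # y # xs \<and> rec_eval (PrimRec f g) (n # xs) y"
    if "(primrec_step k g)\<^sup>*\<^sup>* (0 # v # xs) s" for s
    using that
  proof (induction rule: rtranclp_induct)
    case base
    then show ?case using v(1) by (auto intro: rec_eval.intros)
  next
    case (step s s')
    then obtain n y where "s = n # y # xs" "rec_eval (PrimRec f g) (n # xs) y" by blast
    moreover from this step.hyps(2) obtain w where "s' = Suc n # w # xs" "rec_eval g (n # y # xs) w"
      using primrec_step_iff[OF assms] by blast
    ultimately show ?case using rec_eval.intros(6) by blast
  qed
  from this[OF v(2)] show "rec_eval (PrimRec f g) (n # xs) y" by simp
qed

text \<open>The step is blocked unless \<open>f\<close> is defined with a positive value, so a run
  up to \<open>n\<close> certifies that all smaller candidates fail. Positivity is written with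
  \<open>Suc\<close> to be definable by \<open>bdio_Suc\<close>.\<close>

definition search_step :: "nat \<Rightarrow> recf \<Rightarrow> nat list \<Rightarrow> nat list \<Rightarrow> bool" where
  "search_step k f s s' \<longleftrightarrow> length s = k + 1 \<and> length s' = k + 1 \<and> s' ! 0 = Suc (s ! 0) \<and>
     (\<exists>w v. w = Suc v \<and> rec_eval f s w) \<and> (\<forall>t<k. s' ! (t + 1) = s ! (t + 1))"

lemma search_step_length: "search_step k f s s' \<Longrightarrow> length s = k + 1 \<and> length s' = k + 1"
  by (simp add: search_step_def)

lemma search_step_iff:
  assumes "length xs = k"
  shows "search_step k f (n # xs) s' \<longleftrightarrow> s' = Suc n # xs \<and> (\<exists>v. rec_eval f (n # xs) (Suc v))"
proof
  assume a: "search_step k f (n # xs) s'"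
  then obtain m ys where s': "s' = m # ys" "length ys = k"
    by (auto simp: search_step_def length_Suc_conv)
  then have "ys = xs" using a assms by (auto simp: search_step_def intro: nth_equalityI)
  then show "s' = Suc n # xs \<and> (\<exists>v. rec_eval f (n # xs) (Suc v))"
    using a s' by (auto simp: search_step_def)
qed (use assms in \<open>auto simp: search_step_def\<close>)

lemma rec_eval_Minimize_iff:
  assumes "length xs = k"
  shows "rec_eval (Minimize f) xs n \<longleftrightarrow> (search_step k f)\<^sup>*\<^sup>* (0 # xs) (n # xs) \<and> rec_eval f (n # xs) 0"
proof
  assume "rec_eval (Minimize f) xs n"
  then have n: "rec_eval f (n # xs) 0" "\<forall>m<n. \<exists>y>0. rec_eval f (m # xs) y"
    by (auto elim: rec_evalE)
  have "(search_step k f)\<^sup>*\<^sup>* (0 # xs) (m # xs)" if "m \<le> n" for m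
    using that
  proof (induction m)
    case (Suc m)
    then obtain y where "y > 0" "rec_eval f (m # xs) y" using n(2) by (auto simp: Suc_le_eq)
    then have "search_step k f (m # xs) (Suc m # xs)"
      using assms by (auto simp: search_step_iff gr0_conv_Suc)
    with Suc show ?case by (meson Suc_leD rtranclp.rtrancl_into_rtrancl)
  qed simp
  with n(1) show "(search_step k f)\<^sup>*\<^sup>* (0 # xs) (n # xs) \<and> rec_eval f (n # xs) 0" by simp
next
  assume a: "(search_step k f)\<^sup>*\<^sup>* (0 # xs) (n # xs) \<and> rec_eval f (n # xs) 0"
  have "\<exists>n. s = n # xs \<and> (\<forall>m<n. \<exists>y>0. rec_eval f (m # xs) y)" if "(search_step k f)\<^sup>*\<^sup>* (0 # xs) s" for s
    using that
  proof (induction rule: rtranclp_induct)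
    case (step s s')
    then show ?case using search_step_iff[OF assms] by (auto simp: less_Suc_eq)
  qed simp
  with a have "\<forall>m<n. \<exists>y>0. rec_eval f (m # xs) y" by blast
  with a show "rec_eval (Minimize f) xs n" by (auto intro: rec_eval.intros)
qed

text \<open>The columns \<open>is\<close> and \<open>y\<close> vary in the induction, since subterms
  are evaluated at other columns. Wrong numbers of arguments give the empty relation.\<close>

lemma bdio_rec_eval: "bdio (\<lambda>\<nu>. rec_eval g (map \<nu> is) (\<nu> y))"
proof (induction g arbitrary: "is" y)
  case Zero
  then show ?case by (simp add: rec_eval_Zero_iff bdio_zero)
next
  case Succ
  show ?case
  proof (cases "\<exists>i. is = [i]")
    case True
    then show ?thesis by (auto simp: rec_eval_Succ_iff bdio_Suc)
  next
    case False
    then have "\<not> rec_eval Succ (map \<nu> is) (\<nu> y)" for \<nu> by (auto simp: rec_eval_Succ_iff)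
    then show ?thesis by (simp add: bdio_False)
  qed
next
  case (Proj i)
  show ?case
    by (cases "i < length is") (simp_all add: rec_eval_Proj_iff bdio_eq bdio_False)
next
  case (Comp f gs)
  let ?k = "length gs"
  have "bdio (\<lambda>\<nu>. \<exists>ys. length ys = ?k \<and>
    ((\<forall>i<?k. rec_eval (gs ! i) (map \<nu> is) (ys ! i)) \<and> rec_eval f ys (\<nu> y)))"
  proof (intro bdio_ex_list bdio_conj bdio_All_less)
    fix i assume i: "i < ?k"
    then show "bdio (\<lambda>\<nu>. rec_eval (gs ! i) (map (\<lambda>n. \<nu> (n + ?k)) is) (map \<nu> [0..<?k] ! i))"
      using Comp.IH(2)[of "gs ! i" "map (\<lambda>n. n + ?k) is" i] by (simp add: comp_def)
  next
    show "bdio (\<lambda>\<nu>. rec_eval f (map \<nu> [0..<?k]) (\<nu> (y + ?k)))"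
      by (rule Comp.IH(1))
  qed
  then show ?case by (simp add: rec_eval_Comp_iff)
next
  case (PrimRec f g)
  show ?case
  proof (cases "is")
    case Nil
    then show ?thesis by (simp add: not_rec_eval_PrimRec_Nil bdio_False)
  next
    case (Cons n js)
    define k where "k = length js"
    have step: "bdio (\<lambda>\<nu>. primrec_step k g (map \<nu> [0..<k + 2]) (map \<nu> [k + 2..<2 * (k + 2)]))"
    proof -
      have "bdio (\<lambda>\<nu>. \<nu> (k + 2) = Suc (\<nu> 0) \<and> rec_eval g (map \<nu> [0..<k + 2]) (\<nu> (k + 3)) \<and>
        (\<forall>t<k. \<nu> (k + 4 + t) = \<nu> (t + 2)))"
        by (intro bdio_conj bdio_Suc PrimRec.IH(2) bdio_All_less bdio_eq)
      moreover have "primrec_step k g (map \<nu> [0..<k + 2]) (map \<nu> [k + 2..<2 * (k + 2)]) \<longleftrightarrow>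
        \<nu> (k + 2) = Suc (\<nu> 0) \<and> rec_eval g (map \<nu> [0..<k + 2]) (\<nu> (k + 3)) \<and>
        (\<forall>t<k. \<nu> (k + 4 + t) = \<nu> (t + 2))" for \<nu>
      proof -
        have "map \<nu> [0..<k + 2] ! t = \<nu> t" "map \<nu> [k + 2..<2 * (k + 2)] ! t = \<nu> (k + 2 + t)" if "t < k + 2" for t
          using that by (simp_all del: upt_Suc)
        from this[of 0] this[of 1] this[of "_ + 2"] show ?thesis
          unfolding primrec_step_def by (simp add: ac_simps eval_nat_numeral del: upt_Suc)
      qed
      ultimately show ?thesis by simp
    qed
    \<comment> \<open>\<open>bdio_rtranclp\<close> accepts only columns, so the initial counter 0 is
      a quantified column \<open>z\<close>.\<close>
    have "bdio (\<lambda>\<nu>. \<exists>z v. z = 0 \<and> rec_eval f (map \<nu> js) v \<and>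
      (primrec_step k g)\<^sup>*\<^sup>* (z # v # map \<nu> js) (\<nu> n # \<nu> y # map \<nu> js))"
    proof (intro bdio_ex bdio_conj bdio_zero)
      show "bdio (\<lambda>\<nu>. rec_eval f (map (\<lambda>n. \<nu> (Suc (Suc n))) js) (\<nu> 0))"
        using PrimRec.IH(1)[of "map (\<lambda>n. Suc (Suc n)) js" 0] by (simp add: comp_def)
      show "bdio (\<lambda>\<nu>. (primrec_step k g)\<^sup>*\<^sup>* (\<nu> (Suc 0) # \<nu> 0 # map (\<lambda>n. \<nu> (Suc (Suc n))) js)
        (\<nu> (Suc (Suc n)) # \<nu> (Suc (Suc y)) # map (\<lambda>n. \<nu> (Suc (Suc n))) js))"
        using bdio_rtranclp[OF step primrec_step_length[of k g], of "Suc 0 # 0 # map (\<lambda>n. Suc (Suc n)) js"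
            "Suc (Suc n) # Suc (Suc y) # map (\<lambda>n. Suc (Suc n)) js"]
        by (simp add: comp_def k_def)
    qed
    then show ?thesis
      using Cons rec_eval_PrimRec_iff[of _ k f g] by (simp add: k_def)
  qed
next
  case (Minimize f)
  define k where "k = length is"
  have step: "bdio (\<lambda>\<nu>. search_step k f (map \<nu> [0..<k + 1]) (map \<nu> [k + 1..<2 * (k + 1)]))"
  proof -
    have "bdio (\<lambda>\<nu>. \<nu> (k + 1) = Suc (\<nu> 0) \<and> (\<exists>w v. w = Suc v \<and> rec_eval f (map \<nu> [0..<k + 1]) w) \<and>
      (\<forall>t<k. \<nu> (k + 2 + t) = \<nu> (t + 1)))"
    proof (intro bdio_conj bdio_Suc bdio_All_less bdio_eq bdio_ex)
      show "bdio (\<lambda>\<nu>. rec_eval f (map (\<lambda>n. \<nu> (Suc (Suc n))) [0..<k + 1]) (\<nu> (Suc 0)))"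
        using Minimize.IH[of "map (\<lambda>n. Suc (Suc n)) [0..<k + 1]" "Suc 0"] by (simp add: comp_def del: upt_Suc)
    qed
    moreover have "search_step k f (map \<nu> [0..<k + 1]) (map \<nu> [k + 1..<2 * (k + 1)]) \<longleftrightarrow>
      \<nu> (k + 1) = Suc (\<nu> 0) \<and> (\<exists>w v. w = Suc v \<and> rec_eval f (map \<nu> [0..<k + 1]) w) \<and>
      (\<forall>t<k. \<nu> (k + 2 + t) = \<nu> (t + 1))" for \<nu>
    proof -
      have "map \<nu> [0..<k + 1] ! t = \<nu> t" "map \<nu> [k + 1..<2 * (k + 1)] ! t = \<nu> (k + 1 + t)" if "t < k + 1" for t
        using that by (simp_all del: upt_Suc)
      from this[of 0] this[of "_ + 1"] show ?thesis
        unfolding search_step_def by (simp add: ac_simps del: upt_Suc)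
    qed
    ultimately show ?thesis by simp
  qed
  \<comment> \<open>Here \<open>z\<close> is both the initial counter and the value 0 of
    \<open>f\<close> at the result.\<close>
  have "bdio (\<lambda>\<nu>. \<exists>z. z = 0 \<and> (search_step k f)\<^sup>*\<^sup>* (z # map \<nu> is) (\<nu> y # map \<nu> is) \<and>
    rec_eval f (\<nu> y # map \<nu> is) z)"
  proof (intro bdio_ex bdio_conj bdio_zero)
    show "bdio (\<lambda>\<nu>. (search_step k f)\<^sup>*\<^sup>* (\<nu> 0 # map (\<lambda>n. \<nu> (Suc n)) is) (\<nu> (Suc y) # map (\<lambda>n. \<nu> (Suc n)) is))"
      using bdio_rtranclp[OF step search_step_length[of k f], of "0 # map Suc is" "Suc y # map Suc is"]
      by (simp add: comp_def k_def)
    show "bdio (\<lambda>\<nu>. rec_eval f (\<nu> (Suc y) # map (\<lambda>n. \<nu> (Suc n)) is) (\<nu> 0))"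
      using Minimize.IH[of "Suc y # map Suc is" 0] by (simp add: comp_def)
  qed
  then show ?case
    using rec_eval_Minimize_iff[of _ k f] by (simp add: k_def)
qed

section \<open>Undecidability\<close>

text \<open>A batch with a single environment. The parameter is given without its end letter, so
  that one equation with a power of a generator on its right-hand side fixes it.\<close>

lemma rec_eval_system:
  "\<exists>E\<in>systems_over (range code). \<forall>n. rec_eval g [n] 0 \<longleftrightarrow>
    (\<exists>\<theta>. (\<forall>x. \<theta> x \<in> lists (range code)) \<and> nf (\<theta> 0) = emb (replicate n (Sym False False)) \<and> sat \<theta> E)"
proof -
  obtain D where D: "dio D" "\<And>\<nu>s. D (cols \<nu>s) \<longleftrightarrow> (\<forall>\<nu>\<in>set \<nu>s. rec_eval g (map \<nu> [0]) (\<nu> 1))"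
    using bdio_rec_eval[of g "[0]" 1] by (rule bdioE) blast
  \<comment> \<open>Column 0 holds the argument with its end letter restored; all others hold the
    number 0, among them column 1, the value of \<open>g\<close>.\<close>
  define Q where "Q = (\<lambda>\<sigma> :: nat \<Rightarrow> letter list. \<exists>x y. x = \<sigma> 0 @ [Sym False True] \<and> y = [Sym False True] \<and>
    D (\<lambda>i. if i = 0 then x else y))"
  have "dio Q"
    unfolding Q_def
  proof (intro dio_ex dio_conj)
    show "dio (\<lambda>\<sigma>. \<sigma> (Suc 0) = \<sigma> (Suc (Suc 0)) @ [Sym False True])"
      using dio_eq[of "[Inr 1]" "[Inr 2, Inl (Sym False True)]"] by (simp add: subst_def eval_nat_numeral)
    show "dio (\<lambda>\<sigma>. \<sigma> 0 = [Sym False True])"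
      using dio_eq[of "[Inr 0]" "[Inl (Sym False True)]"] by (simp add: subst_def)
    have "dio (\<lambda>\<sigma>. D (\<lambda>i. \<sigma> (if i = 0 then Suc 0 else 0)))"
      by (rule dio_rename[OF D(1)])
    then show "dio (\<lambda>\<sigma>. D (\<lambda>i. if i = 0 then \<sigma> (Suc 0) else \<sigma> 0))"
      by (simp add: if_distrib)
  qed
  then obtain E where E: "E \<in> systems_over (range code)" and dQ: "defined_by Q E"
    by (rule dioE)
  note Q = defined_byD[OF dQ]
  \<comment> \<open>Giving every argument the same word allows all even variables to be identified
    with variable 0, the only one left to fix.\<close>
  define r where "r = (\<lambda>n::nat. if even n then 0 else n)"
  have Q_iff: "Q (\<lambda>_. replicate n (Sym False False)) \<longleftrightarrow> rec_eval g [n] 0" for n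
  proof -
    have "(\<lambda>i. if i = 0 then replicate n (Sym False False) @ [Sym False True] else [Sym False True]) =
      cols [\<lambda>i. if i = 0 then n else 0]"
      by (auto simp: cols_def ent_def)
    then show ?thesis by (simp add: Q_def D(2))
  qed
  have "(\<exists>\<theta>. (\<forall>x. \<theta> x \<in> lists (range code)) \<and> nf (\<theta> 0) = emb w \<and> sat \<theta> (ren r E)) \<longleftrightarrow> Q (\<lambda>_. w)" for w
  proof
    assume "\<exists>\<theta>. (\<forall>x. \<theta> x \<in> lists (range code)) \<and> nf (\<theta> 0) = emb w \<and> sat \<theta> (ren r E)"
    then obtain \<theta> where \<theta>: "\<And>x. \<theta> x \<in> lists (range code)" "nf (\<theta> 0) = emb w" "sat (\<theta> \<circ> r) E" by auto
    define \<zeta> where "\<zeta> = (\<lambda>n. if even n then emb w else \<theta> n)"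
    have "nf (\<zeta> n) = nf ((\<theta> \<circ> r) n)" for n
      using \<theta>(2) by (simp add: \<zeta>_def r_def)
    then have "sat \<zeta> E" using sat_cong[of \<zeta> "\<theta> \<circ> r" E] \<theta>(3) by simp
    moreover have "\<zeta> x \<in> lists (range code)" for x
      using \<theta>(1) by (simp add: \<zeta>_def)
    ultimately show "Q (\<lambda>_. w)"
      unfolding Q by (intro exI[of _ \<zeta>]) (simp add: \<zeta>_def)
  next
    assume "Q (\<lambda>_. w)"
    then obtain \<theta> where \<theta>: "\<And>x. \<theta> x \<in> lists (range code)" "\<And>i. \<theta> (2 * i) = emb w" "sat \<theta> E"
      unfolding Q by blast
    have "\<theta> \<circ> r = \<theta>"
    proof
      fix n
      show "(\<theta> \<circ> r) n = \<theta> n"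
        using \<theta>(2)[of 0] \<theta>(2)[of "n div 2"] by (cases "even n") (simp_all add: r_def)
    qed
    moreover have "nf (\<theta> 0) = emb w" using \<theta>(2)[of 0] by simp
    ultimately show "\<exists>\<theta>. (\<forall>x. \<theta> x \<in> lists (range code)) \<and> nf (\<theta> 0) = emb w \<and> sat \<theta> (ren r E)"
      using \<theta>(1,3) by (intro exI[of _ \<theta>]) simp
  qed
  then show ?thesis
    using ren_systems_over[OF E] Q_iff by (intro bexI[of _ "ren r E"]) simp_all
qed

text \<open>With the new equation in front, the code of \<open>E\<close> is a component of the code
  of the instance and need not be decoded.\<close>

definition instance_system :: "nat \<Rightarrow> equation_system \<Rightarrow> equation_system" where
  "instance_system n E = ([Inr 0], replicate n (Inl (code (Lo (Sym False False))))) # E"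

lemma instance_system_in:
  "E \<in> systems_over (range code) \<Longrightarrow> instance_system n E \<in> systems_over (range code)"
  by (auto simp: instance_system_def systems_over_def)

lemma sat_instance_system:
  "sat \<theta> (instance_system n E) \<longleftrightarrow> nf (\<theta> 0) = emb (replicate n (Sym False False)) \<and> sat \<theta> E"
proof -
  have "val \<theta> (replicate n (Inl a)) = replicate n a" for a
    by (induction n) auto
  then have "val \<theta> (replicate n (Inl (code (Lo (Sym False False))))) = emb (replicate n (Sym False False))"
    by (simp add: emb_def)
  then show ?thesis by (simp add: instance_system_def)
qed

section \<open>A recursive function for the code of the diagonal instance\<close>

lemma rec_eval_Comp1: "rec_eval g xs a \<Longrightarrow> rec_eval f [a] y \<Longrightarrow> rec_eval (Comp f [g]) xs y"
  by (rule rec_eval.intros(4)[of _ _ "[a]"]) simp_all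

lemma rec_eval_Comp2:
  "rec_eval g xs a \<Longrightarrow> rec_eval h xs b \<Longrightarrow> rec_eval f [a, b] y \<Longrightarrow> rec_eval (Comp f [g, h]) xs y"
  by (rule rec_eval.intros(4)[of _ _ "[a, b]"]) simp_all

fun rec_const :: "nat \<Rightarrow> recf" where
  "rec_const 0 = Zero"
| "rec_const (Suc n) = Comp Succ [rec_const n]"

definition rec_add :: recf where
  "rec_add = PrimRec (Proj 0) (Comp Succ [Proj 1])"

text \<open>Triangular numbers enter because \<open>prod_encode (m, n)\<close> is
  \<open>triangle (m + n) + m\<close>.\<close>

definition rec_triangle :: recf where
  "rec_triangle = PrimRec Zero (Comp rec_add [Comp Succ [Proj 0], Proj 1])"

definition rec_pair :: recf where
  "rec_pair = Comp rec_add [Comp rec_triangle [rec_add], Proj 0]"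

definition rec_power :: "nat \<Rightarrow> recf" where
  "rec_power c = PrimRec Zero (Comp Succ [Comp rec_pair [rec_const c, Proj 1]])"

text \<open>The form comes from
  \<open>list_encode (a # l) = Suc (prod_encode (a, list_encode l))\<close>. The input is used
  twice: as the exponent in the new equation and as the code of the remaining system.\<close>

definition rec_instance :: recf where
  "rec_instance = Comp Succ [Comp rec_pair [Comp rec_pair [rec_const (word_code [Inr 0]),
     rec_power (sum_encode (Inl (code (Lo (Sym False False)))))], Proj 0]]"

lemma rec_eval_const: "rec_eval (rec_const n) xs n"
  by (induction n) (auto intro: rec_eval.intros rec_eval_Comp1)

lemma rec_eval_Proj: "i < length xs \<Longrightarrow> y = xs ! i \<Longrightarrow> rec_eval (Proj i) xs y"
  by (auto intro: rec_eval.intros)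

lemma rec_eval_add: "rec_eval rec_add [m, n] (m + n)"
  unfolding rec_add_def
proof (induction m)
  case 0
  show ?case by (intro rec_eval.intros(5) rec_eval_Proj) simp_all
next
  case (Suc m)
  show ?case
    by (rule rec_eval.intros(6)[OF Suc])
      (auto intro!: rec_eval_Comp1[where a = "m + n"] rec_eval_Proj rec_eval.intros(2))
qed

lemma rec_eval_triangle: "rec_eval rec_triangle [n] (triangle n)"
  unfolding rec_triangle_def
proof (induction n)
  case 0
  show ?case by (auto intro: rec_eval.intros)
next
  case (Suc n)
  have "rec_eval rec_add [Suc n, triangle n] (triangle (Suc n))"
    using rec_eval_add[of "Suc n" "triangle n"] by (simp add: add.commute)
  then have "rec_eval (Comp rec_add [Comp Succ [Proj 0], Proj 1]) [n, triangle n] (triangle (Suc n))"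
    by (intro rec_eval_Comp2[where a = "Suc n" and b = "triangle n"] rec_eval_Comp1[where a = n]
        rec_eval_Proj rec_eval.intros(2)) simp_all
  then show ?case by (rule rec_eval.intros(6)[OF Suc])
qed

lemma rec_eval_pair: "rec_eval rec_pair [m, n] (prod_encode (m, n))"
  unfolding rec_pair_def prod_encode_def
  by (auto intro!: rec_eval_Comp2[where a = "triangle (m + n)" and b = m] rec_eval_Comp1[where a = "m + n"]
      rec_eval_Proj rec_eval_add rec_eval_triangle)

lemma rec_eval_power: "rec_eval (rec_power c) [n] (list_encode (replicate n c))"
  unfolding rec_power_def
proof (induction n)
  case 0
  show ?case by (auto intro: rec_eval.intros)
next
  case (Suc n)
  show ?case
    by (rule rec_eval.intros(6)[OF Suc])
      (auto intro!: rec_eval_Comp1[where a = "prod_encode (c, list_encode (replicate n c))"]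
        rec_eval_Comp2[where a = c and b = "list_encode (replicate n c)"] rec_eval_pair
        rec_eval_const rec_eval_Proj rec_eval.intros(2))
qed

lemma rec_eval_instance: "rec_eval rec_instance [system_code E] (system_code (instance_system (system_code E) E))"
proof -
  let ?k = "system_code E" and ?c = "sum_encode (Inl (code (Lo (Sym False False))))"
  let ?p = "prod_encode (word_code [Inr 0], list_encode (replicate ?k ?c))"
  have "system_code (instance_system ?k E) = Suc (prod_encode (?p, ?k))"
    by (simp add: system_code_def instance_system_def word_code_def)
  moreover have "rec_eval rec_instance [?k] (Suc (prod_encode (?p, ?k)))"
    unfolding rec_instance_def
    by (rule rec_eval_Comp1[where a = "prod_encode (?p, ?k)"],
        rule rec_eval_Comp2[where a = ?p and b = ?k],
        rule rec_eval_Comp2[where a = "word_code [Inr 0]" and b = "list_encode (replicate ?k ?c)"])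
      (simp_all add: rec_eval_const rec_eval_power rec_eval_pair rec_eval_Proj rec_eval.intros(2))
  ultimately show ?thesis by simp
qed

lemma not_diophantine_decidable: "\<not> diophantine_decidable M (range code) (generator (range code) W)"
proof
  let ?S = "solvable M (generator (range code) W)"
  assume "diophantine_decidable M (range code) (generator (range code) W)"
  then obtain f where f: "\<And>E. E \<in> systems_over (range code) \<Longrightarrow>
      rec_eval f [system_code E] (if ?S E then 1 else 0)"
    unfolding diophantine_decidable_def decidable_problem_def by auto
  define g where "g = Comp f [rec_instance]"
  obtain E where E: "E \<in> systems_over (range code)"
    and gE: "\<And>n. rec_eval g [n] 0 \<longleftrightarrow> (\<exists>\<theta>. (\<forall>x. \<theta> x \<in> lists (range code)) \<and>
      nf (\<theta> 0) = emb (replicate n (Sym False False)) \<and> sat \<theta> E)"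
    using rec_eval_system[of g] by blast
  define k where "k = system_code E"
  have S: "instance_system k E \<in> systems_over (range code)" by (rule instance_system_in[OF E])
  have "?S (instance_system k E) \<longleftrightarrow> rec_eval g [k] 0"
    using solvable_iff_sat[OF pairing_axioms S] by (simp add: gE sat_instance_system)
  moreover have "rec_eval g [k] (if ?S (instance_system k E) then 1 else 0)"
    unfolding g_def k_def by (rule rec_eval_Comp1[OF rec_eval_instance f]) (use S k_def in simp)
  ultimately show False
    using rec_eval_deterministic by (fastforce split: if_splits)
qed

theorem theorem2:
  shows "\<exists>(A :: nat set) (W :: nat list set).
    finite A \<and> finite W \<and> W \<subseteq> lists A \<and>
    trivial_group (units_of (special_monoid A W)) \<and>
    context_free_word_problem (special_monoid A W) A (generator A W) \<and>
    word_hyperbolic (special_monoid A W) A (generator A W) \<and>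
    \<not> diophantine_decidable (special_monoid A W) A (generator A W)"
proof (intro exI conjI)
  show "finite (range code)" by (rule finite_A)
  show "finite W" using finite_Rel by (simp add: W_def)
  show "W \<subseteq> lists (range code)" by (rule W_subset)
  show "trivial_group (units_of M)" by (rule trivial_group_units)
  show "context_free_word_problem M (range code) (generator (range code) W)"
    by (rule context_free_word_problem)
  show "word_hyperbolic M (range code) (generator (range code) W)"
    by (rule word_hyperbolic)
  show "\<not> diophantine_decidable M (range code) (generator (range code) W)"
    by (rule not_diophantine_decidable)
qed

end
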